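(* Let $n\ge1$, $g>0$, let $\lambda=(\lambda_1,\dots,\lambda_n)$, $\lambda_1\ge\dots\ge\lambda_n\ge0$, be a partition, and let $q_\lambda(z)$ be the eigenvalue of the operator $Q_z$ on the Jack polynomial $P_\lambda^{(1/g)}$, i.e. $Q_zP_\lambda^{(1/g)}=q_\lambda(z)P_\lambda^{(1/g)}$. Then the polynomial $q_\lambda(z)\in\mathbb{C}(g)[z]$ is given by $$q_\lambda(z)=z^{\lambda_n}\sum_{k_1=0}^{\lambda_{1,2}}\cdots\sum_{k_{n-1}=0}^{\lambda_{n-1,n}}\ \prod_{i=1}^{n-1}(1-z)^{k_i}\,\frac{(-\lambda_{i,i+1})_{k_i}}{k_i!}\,\frac{(ig)_{k_1+\dots+k_i}}{((i+1)g)_{k_1+\dots+k_i}}\,.$$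
   Context: Notation: $\lambda_{i,j}=\lambda_i-\lambda_j$; $(\alpha)_k=\alpha(\alpha+1)\cdots(\alpha+k-1)$ is the Pochhammer symbol; $\Delta_n(\mathbf{x})=\prod_{1\le i<j\le n}(x_j-x_i)$; $\mathbb{C}[\mathbf{x}]^{S_n}$ is the ring of symmetric polynomials in $\mathbf{x}=(x_1,\dots,x_n)$. The operator $Q_z$. For $g>0$, real $z>1$, and reals $0<y_1<\dots<y_n$, and $p\in\mathbb{C}[\mathbf{x}]^{S_n}$ put $$[Q_zp](\mathbf{y})=\frac{\Gamma(ng)}{\Gamma(g)^n}\,\frac{(z-1)^{1-ng}}{\Delta_n(\mathbf{y})\prod_{i=1}^n y_i^{g-1}}\int_{\Omega_{\mathbf{x}}}d\mathbf{x}\;\delta(x_1\cdots x_n-z\,y_1\cdots y_n)\,\Delta_n(\mathbf{x})\Big[\prod_{i=1}^n\xi_i^{g-1}\Big]p(\mathbf{x}),$$ where $\Omega_{\mathbf{x}}=\{\mathbf{x}\in\mathbb{R}^n: 0<y_1<x_1<y_2<\dots<x_{n-1}<y_n<x_n<\infty\}$, $\xi_i=\prod_{k=1}^n(x_k-y_i)\big/\prod_{k\ne i}(y_k-y_i)>0$, and $\delta$ is the Dirac delta function (so $\int\delta(h(\mathbf x))F(\mathbf x)d\mathbf x=\int_{\{h=0\}}F\,dS/|\nabla h|$). The function $[Q_zp](\mathbf{y})$ is a polynomial in $z$ and a symmetric polynomial in $\mathbf{y}$; accordingly $Q_z$ is extended to all $z\in\mathbb{C}$ and (renaming $\mathbf{y}$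 as $\mathbf{x}$) regarded as a linear operator on $\mathbb{C}[\mathbf{x}]^{S_n}$. The Jack polynomials are eigenfunctions of $Q_z$, with eigenvalues $q_\lambda(z)\in\mathbb{C}(g)[z]$. Jack polynomials. For partitions $\mu,\lambda$ with $n$ parts (zeros allowed), $\mu\preceq\lambda$ means $\sum_{j=1}^n\mu_j=\sum_{j=1}^n\lambda_j$ and $\sum_{j=1}^k\mu_j\le\sum_{j=1}^k\lambda_j$ for $k=1,\dots,n-1$. $m_\lambda(\mathbf{x})$ is the sum of $x_1^{\nu_1}\cdots x_n^{\nu_n}$ over all distinct permutations $\nu$ of $\lambda$. The Jack polynomials $P_\lambda^{(1/g)}(\mathbf{x})\in\mathbb{C}(g)[\mathbf{x}]^{S_n}$ are the unique symmetric polynomials of the form $P_\lambda^{(1/g)}=m_\lambda+\sum_{\mu\prec\lambda}v_{\lambda\mu}(g)m_\mu$ such that $D(u;g)P_\lambda^{(1/g)}=\big[\prod_{i=1}^n(\lambda_i+(n-i)g+u)\big]P_\lambda^{(1/g)}$, where $$D(u;g)=\frac{(-1)^{n(n-1)/2}}{\Delta_n(\mathbf{x})}\det\Big[x_i^{n-j}\Big(x_i\frac{\partial}{\partial x_i}+(n-j)g+u\Big)\Big]_{i,j=1}^n .$$ *)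

theory Defs
  imports
    "HOL-Analysis.Analysis"
    "HOL-Computational_Algebra.Computational_Algebra"
    "HOL-Computational_Algebra.Field_as_Ring"
    "HOL-Combinatorics.Permutations"
    "HOL-Library.Poly_Mapping"
begin

section \<open>Symmetric polynomials\<close>

text \<open>
  A polynomial in \<open>x\<^sub>1, x\<^sub>2, \<dots>\<close> is a finitely supported function from exponent vectors to
  coefficients. Variables are indexed from 1, so the polynomials in \<open>n\<close> variables are those
  whose exponent vectors are supported on \<open>{1..n}\<close>.
\<close>

type_synonym 'a mpoly = "(nat \<Rightarrow>\<^sub>0 nat) \<Rightarrow>\<^sub>0 'a"

definition Const :: "'a::zero \<Rightarrow> 'a mpoly"
  where "Const c = Poly_Mapping.single 0 c"

definition Var :: "nat \<Rightarrow> ('a::zero_neq_one) mpoly"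
  where "Var i = Poly_Mapping.single (Poly_Mapping.single i 1) 1"

definition eval_mpoly :: "('a::comm_semiring_1) mpoly \<Rightarrow> (nat \<Rightarrow> 'a) \<Rightarrow> 'a"
  where "eval_mpoly p x =
    (\<Sum>m\<in>Poly_Mapping.keys p. Poly_Mapping.lookup p m *
      (\<Prod>i\<in>Poly_Mapping.keys m. x i ^ Poly_Mapping.lookup m i))"

definition partial_deriv :: "nat \<Rightarrow> ('a::comm_semiring_1) mpoly \<Rightarrow> 'a mpoly"
  where "partial_deriv i p =
    (\<Sum>m\<in>Poly_Mapping.keys p.
      Poly_Mapping.single (m - Poly_Mapping.single i 1)
        (of_nat (Poly_Mapping.lookup m i) * Poly_Mapping.lookup p m))"

text \<open>
  For a permutation \<open>s\<close>, the vector \<open>Poly_Mapping.map_key s m\<close> has \<open>i\<close>-th entry \<open>m (s i)\<close>.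
\<close>

definition symmetric_mpoly :: "nat \<Rightarrow> ('a::zero) mpoly \<Rightarrow> bool"
  where "symmetric_mpoly n p \<longleftrightarrow>
    (\<forall>m\<in>Poly_Mapping.keys p. Poly_Mapping.keys m \<subseteq> {1..n}) \<and>
    (\<forall>s. s permutes {1..n} \<longrightarrow>
      (\<forall>m. Poly_Mapping.lookup p (Poly_Mapping.map_key s m) = Poly_Mapping.lookup p m))"

definition is_partition :: "nat \<Rightarrow> (nat \<Rightarrow>\<^sub>0 nat) \<Rightarrow> bool"
  where "is_partition n lam \<longleftrightarrow>
    Poly_Mapping.keys lam \<subseteq> {1..n} \<and>
    (\<forall>i\<in>{1..<n}. Poly_Mapping.lookup lam (i + 1) \<le> Poly_Mapping.lookup lam i)"

definition dominated :: "nat \<Rightarrow> (nat \<Rightarrow>\<^sub>0 nat) \<Rightarrow> (nat \<Rightarrow>\<^sub>0 nat) \<Rightarrow> bool"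
  where "dominated n mu lam \<longleftrightarrow>
    (\<Sum>j=1..n. Poly_Mapping.lookup mu j) = (\<Sum>j=1..n. Poly_Mapping.lookup lam j) \<and>
    (\<forall>k\<in>{1..<n}. (\<Sum>j=1..k. Poly_Mapping.lookup mu j) \<le> (\<Sum>j=1..k. Poly_Mapping.lookup lam j))"

definition monomial_symmetric :: "nat \<Rightarrow> (nat \<Rightarrow>\<^sub>0 nat) \<Rightarrow> ('a::comm_semiring_1) mpoly"
  where "monomial_symmetric n lam =
    (\<Sum>nu\<in>{Poly_Mapping.map_key s lam |s. s permutes {1..n}}. Poly_Mapping.single nu 1)"

section \<open>Jack polynomials\<close>

text \<open>
  The entries of the operator matrix
  \<open>x\<^sub>i\<^bsup>n - j\<^esup> (x\<^sub>i \<partial>/\<partial>x\<^sub>i + (n - j) g + u)\<close>. Entries from different rows commute, so the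
  determinant is unambiguous: the order of the factors in each term of the Leibniz sum is
  irrelevant.
\<close>

definition sekiguchi_entry :: "nat \<Rightarrow> 'a::comm_ring_1 \<Rightarrow> 'a \<Rightarrow> nat \<Rightarrow> nat \<Rightarrow> 'a mpoly \<Rightarrow> 'a mpoly"
  where "sekiguchi_entry n g u i j p =
    Var i ^ (n - j) * (Var i * partial_deriv i p + Const (of_nat (n - j) * g + u) * p)"

definition sekiguchi_det :: "nat \<Rightarrow> 'a::comm_ring_1 \<Rightarrow> 'a \<Rightarrow> 'a mpoly \<Rightarrow> 'a mpoly"
  where "sekiguchi_det n g u p =
    (\<Sum>s\<in>{s. s permutes {1..n}}.
      of_int (sign s) * foldr (\<lambda>i. sekiguchi_entry n g u i (s i)) [1..<Suc n] p)"

definition vandermonde :: "nat \<Rightarrow> (nat \<Rightarrow> 'a::comm_ring_1) \<Rightarrow> 'a"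
  where "vandermonde n x = (\<Prod>j\<in>{1..n}. \<Prod>i\<in>{1..<j}. x j - x i)"

text \<open>
  On symmetric polynomials the determinant is antisymmetric, hence divisible by the
  Vandermonde product; the quotient is unique because the polynomials form a domain.
\<close>

definition sekiguchi :: "nat \<Rightarrow> 'a::idom \<Rightarrow> 'a \<Rightarrow> 'a mpoly \<Rightarrow> 'a mpoly"
  where "sekiguchi n g u p =
    (THE r. vandermonde n Var * r = (-1) ^ (n * (n - 1) div 2) * sekiguchi_det n g u p)"

definition is_jack :: "nat \<Rightarrow> 'a::field \<Rightarrow> (nat \<Rightarrow>\<^sub>0 nat) \<Rightarrow> 'a mpoly \<Rightarrow> bool"
  where "is_jack n g lam P \<longleftrightarrow>
    symmetric_mpoly n P \<and>
    (\<exists>v. P = monomial_symmetric n lam +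
      (\<Sum>mu\<in>{mu. is_partition n mu \<and> dominated n mu lam \<and> mu \<noteq> lam}.
        Const (v mu) * monomial_symmetric n mu)) \<and>
    (\<forall>u. sekiguchi n g u P =
      Const (\<Prod>i=1..n. of_nat (Poly_Mapping.lookup lam i) + of_nat (n - i) * g + u) * P)"

text \<open>
  The field \<open>\<complex>(g)\<close>, its generator, and the value of a rational function at a point, computed
  from the coprime representation (junk value 0 at a pole).
\<close>

type_synonym ratfun = "complex poly fract"

definition ratfun_gen :: ratfun
  where "ratfun_gen = to_fract [:0, 1:]"

definition ratfun_eval :: "complex \<Rightarrow> ratfun \<Rightarrow> complex"
  where "ratfun_eval a r = (case quot_of_fract r of (num, den) \<Rightarrow> poly num a / poly den a)"

definition specialize :: "complex \<Rightarrow> ratfun mpoly \<Rightarrow> complex mpoly"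
  where "specialize a P = Poly_Mapping.map (ratfun_eval a) P"

section \<open>The operator \<open>Q\<^sub>z\<close>\<close>

definition ordered_point :: "nat \<Rightarrow> (nat \<Rightarrow> real) \<Rightarrow> bool"
  where "ordered_point n y \<longleftrightarrow> 0 < y 1 \<and> (\<forall>i\<in>{1..<n}. y i < y (i + 1))"

definition Omega :: "nat \<Rightarrow> (nat \<Rightarrow> real) \<Rightarrow> (nat \<Rightarrow> real) set"
  where "Omega n y = {x. \<forall>i\<in>{1..n}. y i < x i \<and> (i < n \<longrightarrow> x i < y (i + 1))}"

definition xi :: "nat \<Rightarrow> (nat \<Rightarrow> real) \<Rightarrow> (nat \<Rightarrow> real) \<Rightarrow> nat \<Rightarrow> real"
  where "xi n y x i = (\<Prod>k=1..n. x k - y i) / (\<Prod>k\<in>{1..n} - {i}. y k - y i)"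

definition partial_at :: "((nat \<Rightarrow> real) \<Rightarrow> real) \<Rightarrow> nat \<Rightarrow> (nat \<Rightarrow> real) \<Rightarrow> real"
  where "partial_at f i x = deriv (\<lambda>t. f (x(i := t))) (x i)"

text \<open>
  \<open>\<integral>\<^sub>\<Omega> \<delta>(h) F\<close>, understood as \<open>\<integral> F dS / |grad h|\<close> over the part of \<open>{h = 0}\<close> lying in \<open>\<Omega>\<close>, for
  a hypersurface which inside \<open>\<Omega>\<close> is the graph \<open>x\<^sub>n = \<phi>(x\<^sub>1, \<dots>, x\<^bsub>n-1\<^esub>)\<close>. The surface element
  of the graph is \<open>dS = sqrt (1 + |grad \<phi>|\<^sup>2) dx\<^sub>1 \<dots> dx\<^bsub>n-1\<^esub>\<close>. For \<open>n = 1\<close> the surface is a point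
  and \<open>dS\<close> its counting measure.
\<close>

definition delta_integral ::
    "nat \<Rightarrow> (nat \<Rightarrow> real) set \<Rightarrow> ((nat \<Rightarrow> real) \<Rightarrow> real) \<Rightarrow> ((nat \<Rightarrow> real) \<Rightarrow> real) \<Rightarrow>
      ((nat \<Rightarrow> real) \<Rightarrow> complex) \<Rightarrow> complex"
  where "delta_integral n Om h phi F =
    (\<integral>u. (let x = u(n := phi u) in
        if x \<in> Om
        then F x * of_real (sqrt (1 + (\<Sum>i\<in>{1..<n}. (partial_at phi i u)\<^sup>2)) /
                            sqrt (\<Sum>i\<in>{1..n}. (partial_at h i x)\<^sup>2))
        else 0)
      \<partial>(Pi\<^sub>M {1..<n} (\<lambda>_. lborel :: real measure)))"

definition Q_constraint :: "nat \<Rightarrow> real \<Rightarrow> (nat \<Rightarrow> real) \<Rightarrow> (nat \<Rightarrow> real) \<Rightarrow> real"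
  where "Q_constraint n z y x = (\<Prod>i=1..n. x i) - z * (\<Prod>i=1..n. y i)"

definition Q_graph :: "nat \<Rightarrow> real \<Rightarrow> (nat \<Rightarrow> real) \<Rightarrow> (nat \<Rightarrow> real) \<Rightarrow> real"
  where "Q_graph n z y u = z * (\<Prod>i=1..n. y i) / (\<Prod>i\<in>{1..<n}. u i)"

lemma Q_constraint_graph:
  assumes "n \<ge> 1" "ordered_point n y" "x \<in> Omega n y"
  shows "Q_constraint n z y x = 0 \<longleftrightarrow> x n = Q_graph n z y x"
proof -
  have y: "y i > 0" if "1 \<le> i" "i \<le> n" for i
    using that
  proof (induction i rule: dec_induct)
    case base
    then show ?case using assms(2) by (simp add: ordered_point_def)
  next
    case (step k)
    then have "y k < y (k + 1)" using assms(2) by (simp add: ordered_point_def)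
    with step show ?case by simp
  qed
  have "x i > 0" if "i \<in> {1..<n}" for i
    using y[of i] that assms(3) by (force simp: Omega_def)
  then have "(\<Prod>i\<in>{1..<n}. x i) \<noteq> 0" by (force simp: prod_zero_iff)
  moreover have "(\<Prod>i=1..n. x i) = x n * (\<Prod>i\<in>{1..<n}. x i)"
    using assms(1) by (simp add: prod.last_plus)
  ultimately show ?thesis
    by (simp add: Q_constraint_def Q_graph_def field_simps)
qed

definition Q_integral :: "nat \<Rightarrow> real \<Rightarrow> real \<Rightarrow> complex mpoly \<Rightarrow> (nat \<Rightarrow> real) \<Rightarrow> complex"
  where "Q_integral n g z p y =
    of_real (Gamma (real n * g) / Gamma g ^ n *
      ((z - 1) powr (1 - real n * g) / (vandermonde n y * (\<Prod>i=1..n. y i powr (g - 1))))) *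
    delta_integral n (Omega n y) (Q_constraint n z y) (Q_graph n z y)
      (\<lambda>x. of_real (vandermonde n x * (\<Prod>i=1..n. xi n y x i powr (g - 1))) *
            eval_mpoly p (\<lambda>i. of_real (x i)))"

text \<open>
  \<open>Q_poly n g p\<close> is \<open>Q\<^sub>z p\<close> as a polynomial in \<open>z\<close> whose coefficients are symmetric polynomials in
  \<open>n\<close> variables; it is determined by its values for real \<open>z > 1\<close> and \<open>0 < y\<^sub>1 < \<dots> < y\<^sub>n\<close>.
\<close>

definition Q_poly :: "nat \<Rightarrow> real \<Rightarrow> complex mpoly \<Rightarrow> complex mpoly poly"
  where "Q_poly n g p =
    (THE R. (\<forall>k. symmetric_mpoly n (coeff R k)) \<and>
      (\<forall>z y. z > 1 \<longrightarrow> ordered_point n y \<longrightarrow>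
        eval_mpoly (poly R (Const (of_real z))) (\<lambda>i. of_real (y i)) = Q_integral n g z p y))"

definition Q_op :: "nat \<Rightarrow> real \<Rightarrow> complex \<Rightarrow> complex mpoly \<Rightarrow> complex mpoly"
  where "Q_op n g z p = poly (Q_poly n g p) (Const z)"

end

theory Submission
  imports Defs
begin

text \<open>
  Put \<open>\<tau>\<^sub>i = \<xi>\<^sub>i / y\<^sub>i\<close>. The partial fraction expansion of \<open>\<Prod>(t - x\<^sub>k) / \<Prod>(t - y\<^sub>k)\<close> turns the constraint
  \<open>\<Prod>x\<^sub>k = z \<Prod>y\<^sub>k\<close> into \<open>\<Sum>\<tau>\<^sub>i = z - 1\<close> and gives
  \<open>e\<^sub>k(x) = \<Sum>\<^bsub>card S = k\<^esub> y\<^sup>S (1 + \<Sum>\<^bsub>i \<in> S\<^esub> \<tau>\<^sub>i)\<close>, while the factor \<open>\<Delta>(x) / \<Delta>(y) / (x\<^sub>1 \<dots> x\<^bsub>n-1\<^esub>)\<close> is exactly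
  the Jacobian of \<open>x \<mapsto> \<tau>\<close>. So \<open>Q\<^sub>z p\<close> is the expectation of \<open>p(x)\<close> under a Dirichlet distribution of \<open>\<tau>\<close>,
  which is visibly a polynomial in \<open>z\<close> and a symmetric polynomial in \<open>y\<close>. Only the triangularity of the Jack
  polynomial matters for the eigenvalue: expanding it in the products \<open>\<Prod> e\<^sub>k\<^bsup>\<mu>\<^sub>k - \<mu>\<^sub>k\<^sub>+\<^sub>1\<^esup>\<close>, the coefficient of
  the leading monomial \<open>y\<^sup>\<lambda>\<close> comes from \<open>\<mu> = \<lambda>\<close> alone and equals the expectation of
  \<open>\<Prod> (1 + \<tau>\<^sub>1 + \<dots> + \<tau>\<^sub>k)\<^bsup>\<lambda>\<^sub>k - \<lambda>\<^sub>k\<^sub>+\<^sub>1\<^esup>\<close>, which expands binomially into iterated Beta integrals.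

  The Jacobian is computed one variable at a time, peeling off \<open>x\<^sub>j\<close> for increasing \<open>j\<close>: the remaining
  variables satisfy a constraint of the same kind with \<open>z\<close> replaced by \<open>z y\<^sub>j / x\<^sub>j\<close>.
\<close>

section \<open>Substitution and interpolation\<close>

text \<open>No Jacobian determinant in several variables is computed, and
  \<open>x \<mapsto> \<tau>\<close> is never inverted as a whole. The inductive step goes through
  mixed coordinates, in which \<open>x j\<close> is kept while the variables after it are already
  simplex coordinates; moving \<open>x j\<close> to the innermost integral leaves one monotone
  substitution of a single real variable. That is why everything is first proved for arbitrary
  nonnegative measurable functions: no integrability is at stake, and the weight gained in a step is
  absorbed into the next integrand. Products of elementary polynomials are the suitable basis
  because each \<open>e_k(x)\<close> is affine in \<tau>: reading the diagram by columns, every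
  choice of one monomial per column contributes a single expectation. \<open>Q_poly\<close> is a
  definite description, so its expansion also has to be unique; this rests on the fact that a
  polynomial vanishing at all ordered points is zero. In passing from rational functions of the
  parameter to a real \<open>g\<close>, only the coefficients 0 and 1 of the Jack polynomial have to
  keep their values, and these are not affected by poles of other coefficients.\<close>

lemma nn_integral_substitution_inj:
  fixes \<psi> \<psi>' :: "real \<Rightarrow> real" and H :: "real \<Rightarrow> ennreal"
  assumes [measurable]: "S \<in> sets borel" "\<psi> \<in> borel_measurable borel"
      "\<psi>' \<in> borel_measurable borel" "H \<in> borel_measurable borel"
    and der: "\<And>s. s \<in> S \<Longrightarrow> (\<psi> has_real_derivative \<psi>' s) (at s)"
    and nonneg: "\<And>s. s \<in> S \<Longrightarrow> \<psi>' s \<ge> 0"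
    and inj: "inj_on \<psi> S" and img: "\<psi> ` S = {a<..<b}"
  shows "(\<integral>\<^sup>+s. indicator S s * (ennreal (\<psi>' s) * H (\<psi> s)) \<partial>lborel) =
    (\<integral>\<^sup>+v. indicator {a<..<b} v * H v \<partial>lborel)"
proof -
  define M1 where "M1 = density lborel (\<lambda>s. indicator S s * ennreal (\<psi>' s))"
  define M2 where "M2 = density lborel (indicator {a<..<b} :: real \<Rightarrow> ennreal)"
  \<comment> \<open>Change of variables is invoked for indicators of Borel sets alone, where
    absolute integrability is automatic because \<open>{a<..<b}\<close> is bounded; agreement of the
    two measures then covers every \<open>H\<close>, infinite values included.\<close>
  have "distr M1 borel \<psi> = M2"
  proof (rule measure_eqI)
    show "sets (distr M1 borel \<psi>) = sets M2" by (simp add: M2_def)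
    fix A :: "real set" assume "A \<in> sets (distr M1 borel \<psi>)"
    then have A[measurable]: "A \<in> sets borel" by simp
    let ?f = "indicator A :: real \<Rightarrow> real"
    let ?m = "measure lborel (A \<inter> {a<..<b})"
    have fin: "emeasure lborel (A \<inter> {a<..<b}) < \<infinity>"
      by (rule order.strict_trans1[OF emeasure_mono[of _ "{a..b}"]])
         (auto simp: emeasure_lborel_Icc_eq)
    have "set_integrable lebesgue {a<..<b} ?f"
    proof -
      have "set_integrable lborel {a<..<b} ?f"
        unfolding set_integrable_def
        using fin by (simp add: indicator_inter_arith[symmetric] Int_commute integrable_indicator_iff)
      then show ?thesis unfolding set_integrable_def by (rule integrable_completion[THEN iffD2, rotated]) auto
    qed
    moreover have "integral {a<..<b} ?f = ?m"
    proof -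
      have "(\<integral>\<^sup>+x. ennreal (indicator (A \<inter> {a<..<b}) x) \<partial>lborel) = ennreal ?m"
        using fin by (simp add: ennreal_indicator emeasure_eq_ennreal_measure)
      then have "((indicator (A \<inter> {a<..<b}) :: real \<Rightarrow> real) has_integral ?m) UNIV"
        by (intro nn_integral_has_integral) auto
      moreover have "indicator (A \<inter> {a<..<b}) = (\<lambda>x. if x \<in> {a<..<b} then ?f x else 0)"
        by (auto simp: indicator_def)
      ultimately have "(?f has_integral ?m) {a<..<b}"
        using has_integral_restrict_UNIV[of "{a<..<b}" ?f] by simp
      then show ?thesis by (rule integral_unique)
    qed
    ultimately have "(\<lambda>x. \<bar>\<psi>' x\<bar> * ?f (\<psi> x)) absolutely_integrable_on S \<and>
        integral S (\<lambda>x. \<bar>\<psi>' x\<bar> * ?f (\<psi> x)) = ?m"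
      using has_absolute_integral_change_of_variables_1'[of S \<psi> \<psi>' ?f ?m] der inj img
      by (auto intro: has_field_derivative_at_within)
    then have "((\<lambda>x. \<bar>\<psi>' x\<bar> * ?f (\<psi> x)) has_integral ?m) S"
      by (auto simp: has_integral_iff dest: set_lebesgue_integral_eq_integral(1))
    from nn_integral_has_integral_lebesgue[OF _ this]
    have *: "(\<integral>\<^sup>+x. ennreal (indicator S x * (\<bar>\<psi>' x\<bar> * ?f (\<psi> x))) \<partial>lborel) = ennreal ?m"
      by simp
    have "emeasure (distr M1 borel \<psi>) A = (\<integral>\<^sup>+x. indicator S x * ennreal (\<psi>' x) * indicator (\<psi> -` A) x \<partial>lborel)"
    proof -
      have "\<psi> -` A \<in> sets lborel" using measurable_sets[of \<psi> borel borel A] by simp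
      then show ?thesis by (simp add: M1_def emeasure_distr emeasure_density)
    qed
    also have "\<dots> = (\<integral>\<^sup>+x. ennreal (indicator S x * (\<bar>\<psi>' x\<bar> * ?f (\<psi> x))) \<partial>lborel)"
      using nonneg by (intro nn_integral_cong) (auto simp: indicator_def)
    also have "\<dots> = emeasure lborel (A \<inter> {a<..<b})"
      using * fin by (simp add: emeasure_eq_ennreal_measure)
    also have "\<dots> = emeasure M2 A"
    proof -
      have "emeasure M2 A = (\<integral>\<^sup>+x. indicator {a<..<b} x * indicator A x \<partial>lborel)"
        unfolding M2_def by (rule emeasure_density) simp_all
      also have "\<dots> = (\<integral>\<^sup>+x. indicator (A \<inter> {a<..<b}) x \<partial>lborel)"
        by (intro nn_integral_cong) (simp add: indicator_inter_arith mult.commute)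
      finally have "emeasure M2 A = (\<integral>\<^sup>+x. indicator (A \<inter> {a<..<b}) x \<partial>lborel)" .
      then show ?thesis by simp
    qed
    finally show "emeasure (distr M1 borel \<psi>) A = emeasure M2 A" .
  qed
  then have "(\<integral>\<^sup>+v. H v \<partial>distr M1 borel \<psi>) = (\<integral>\<^sup>+v. H v \<partial>M2)" by simp
  then show ?thesis
    by (simp add: nn_integral_distr M1_def M2_def nn_integral_density mult.assoc)
qed

text \<open>Lagrange interpolation: up to a common sign both sides are monic of degree
  \<open>card I\<close> in \<open>t\<close>, so agreement at the \<open>card I\<close> points
  \<open>y i\<close> already forces equality. The coefficient at \<open>i\<close> is the quantity
  \<open>xi\<close> of the integrand.\<close>

lemma prod_interpolation:
  fixes x y :: "'i \<Rightarrow> real"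
  assumes "finite I" and inj: "inj_on y I"
  shows "(\<Prod>k\<in>I. x k - t) = (\<Prod>k\<in>I. y k - t) +
    (\<Sum>i\<in>I. (\<Prod>k\<in>I. x k - y i) / (\<Prod>k\<in>I - {i}. y k - y i) * (\<Prod>k\<in>I - {i}. y k - t))"
proof -
  define c where "c i = (\<Prod>k\<in>I. x k - y i) / (\<Prod>k\<in>I - {i}. y k - y i)" for i
  define p where "p = (\<Prod>k\<in>I. [:- x k, 1:])"
  define q where "q = (\<Prod>k\<in>I. [:- y k, 1:])"
  \<comment> \<open>The sign is -1 for every \<open>i \<in> I\<close>; written as a power with two
    cardinalities it cancels against the signs that turn each product of factors
    \<open>f k - s\<close> into one of factors \<open>s - f k\<close>.\<close>
  define r where "r = (\<Sum>i\<in>I. smult (c i * (- 1) ^ (card I + card (I - {i}))) (\<Prod>k\<in>I - {i}. [:- y k, 1:]))"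
  have deg: "degree (\<Prod>k\<in>J. [:- f k, 1:]) = card J" if "finite J" for f :: "'i \<Rightarrow> real" and J
    using that by (subst degree_prod_eq_sum_degree) auto
  have lc: "coeff (\<Prod>k\<in>J. [:- f k, 1:]) (card J) = 1" if "finite J" for f :: "'i \<Rightarrow> real" and J
  proof -
    have "lead_coeff (\<Prod>k\<in>J. [:- f k, 1:]) = 1" by (simp add: lead_coeff_prod)
    then show ?thesis using deg[OF that] by simp
  qed
  have sgn: "(\<Prod>k\<in>J. f k - s) = (- 1) ^ card J * poly (\<Prod>k\<in>J. [:- f k, 1:]) s"
    if "finite J" for f :: "'i \<Rightarrow> real" and J s
    using that by (induction J rule: finite_induct) (auto simp: algebra_simps)
  have degr: "degree r < card I" if "I \<noteq> {}"
    unfolding r_def using assms that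
    by (intro degree_sum_less) (auto intro!: le_less_trans[OF degree_smult_le] simp: deg card_gt_0_iff
      card_Diff_singleton_if)
  have main: "p = q + r"
  proof (cases "I = {}")
    case True
    then show ?thesis by (simp add: p_def q_def r_def)
  next
    case False
    show ?thesis
    proof (rule poly_eqI_degree_lead_coeff[of _ "card I" _ "y ` I"])
      show "coeff p (card I) = coeff (q + r) (card I)"
        using lc[OF assms(1)] degr[OF False] by (simp add: p_def q_def coeff_eq_0)
      show "card I \<le> card (y ` I)" using card_image[OF inj] by simp
      show "degree p \<le> card I" by (simp add: p_def deg assms)
      show "degree (q + r) \<le> card I"
        using degr[OF False] by (intro degree_add_le) (auto simp: q_def deg assms)
      fix z assume "z \<in> y ` I"
      then obtain j where j: "j \<in> I" "z = y j" by blast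
      have nz: "(\<Prod>k\<in>I - {j}. y k - y j) \<noteq> 0"
        using inj j assms by (auto simp: inj_on_def)
      have "poly r z = (\<Sum>i\<in>I. if i = j then c j * (- 1) ^ (card I + card (I - {j})) *
        poly (\<Prod>k\<in>I - {j}. [:- y k, 1:]) (y j) else 0)"
        unfolding r_def poly_sum using j assms
        by (intro sum.cong refl) (auto simp: poly_prod prod_zero_iff)
      also have "\<dots> = c j * (- 1) ^ (card I + card (I - {j})) * poly (\<Prod>k\<in>I - {j}. [:- y k, 1:]) (y j)"
        using j assms by simp
      also have "\<dots> = (- 1) ^ card I * (c j * (\<Prod>k\<in>I - {j}. y k - y j))"
        using sgn[of "I - {j}" y "y j"] assms by (simp add: power_add)
      also have "\<dots> = (- 1) ^ card I * (\<Prod>k\<in>I. x k - y j)"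
        using nz by (simp add: c_def)
      also have "\<dots> = poly p z"
        using sgn[of I x "y j"] assms j by (simp add: p_def power_mult_distrib[symmetric] mult.assoc[symmetric])
      moreover have "poly q z = 0" using j assms by (auto simp: q_def poly_prod prod_zero_iff)
      ultimately show "poly p z = poly (q + r) z" by simp
    qed
  qed
  have "(\<Prod>k\<in>I. x k - t) = (- 1) ^ card I * (poly q t + poly r t)"
    using sgn[of I x t] assms main by (simp add: p_def)
  also have "\<dots> = (\<Prod>k\<in>I. y k - t) + (- 1) ^ card I * poly r t"
    using sgn[of I y t] assms by (simp add: q_def algebra_simps)
  also have "(- 1) ^ card I * poly r t = (\<Sum>i\<in>I. c i * (\<Prod>k\<in>I - {i}. y k - t))"
    unfolding r_def poly_sum sum_distrib_left using assms
    by (intro sum.cong refl) (simp add: sgn power_add power_mult_distrib[symmetric] mult_ac)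
  finally show ?thesis by (simp add: c_def)
qed

section \<open>Diagonal scaling, and the one-dimensional substitution behind the peeling\<close>

abbreviation leb :: "'i set \<Rightarrow> ('i \<Rightarrow> real) measure" where
  "leb I \<equiv> Pi\<^sub>M I (\<lambda>_. lborel)"

text \<open>Induction splits off one coordinate and rescales it by the one-dimensional affine rule.
  In the change of variables it takes the coordinates of a smaller simplex to those of the larger
  one.\<close>

lemma nn_integral_PiM_scale:
  fixes r :: "'i \<Rightarrow> real" and f :: "('i \<Rightarrow> real) \<Rightarrow> ennreal"
  assumes "finite I" and "\<And>i. i \<in> I \<Longrightarrow> r i > 0"
    and [measurable]: "f \<in> borel_measurable (leb I)"
  shows "(\<integral>\<^sup>+u. f u \<partial>leb I) =
    ennreal (\<Prod>i\<in>I. r i) * (\<integral>\<^sup>+u. f (\<lambda>i\<in>I. r i * u i) \<partial>leb I)"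
  using assms
proof (induction I arbitrary: f rule: finite_induct)
  case empty
  have "f (\<lambda>i\<in>{}. r i * u i) = f (\<lambda>_. undefined)" for u by (simp add: restrict_def)
  then show ?case by (simp add: PiM_empty nn_integral_count_space_finite)
next
  case (insert j I)
  interpret product_sigma_finite "\<lambda>_. lborel :: real measure" ..
  note [measurable] = insert.prems(2)
  have [measurable]: "(\<lambda>y. f (x(j := y))) \<in> borel_measurable borel"
    if "x \<in> space (leb I)" for x
  proof -
    have "(\<lambda>y. f (x(j := y))) \<in> borel_measurable lborel"
      using that insert by measurable
    then show ?thesis by simp
  qed
  have [measurable]: "(\<lambda>x. f (x(j := y))) \<in> borel_measurable (leb I)" for y
    using insert by measurable
  have "(\<lambda>p. (fst p)(j := r j * snd p)) \<in> leb I \<Otimes>\<^sub>M lborel \<rightarrow>\<^sub>M leb (insert j I)"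
    by (rule measurable_fun_upd[where J = I]) auto
  then have [measurable]: "(\<lambda>p. f ((fst p)(j := r j * snd p))) \<in> borel_measurable (leb I \<Otimes>\<^sub>M lborel)"
    by (rule measurable_compose) measurable
  have S[measurable]: "(\<lambda>x. \<lambda>i\<in>I. r i * x i) \<in> leb I \<rightarrow>\<^sub>M leb I"
    by measurable
  have inner: "(\<lambda>x. \<integral>\<^sup>+y. f (x(j := r j * y)) \<partial>lborel) \<in> borel_measurable (leb I)"
    by (rule lborel.borel_measurable_nn_integral) (simp add: case_prod_beta')
  have "(\<integral>\<^sup>+u. f u \<partial>leb (insert j I)) =
      (\<integral>\<^sup>+x. (\<integral>\<^sup>+y. f (x(j := y)) \<partial>lborel) \<partial>leb I)"
    using insert by (intro product_nn_integral_insert) auto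
  also have "\<dots> = (\<integral>\<^sup>+x. ennreal (r j) * (\<integral>\<^sup>+y. f (x(j := r j * y)) \<partial>lborel) \<partial>leb I)"
    using insert.prems(1)[of j]
    by (intro nn_integral_cong) (subst nn_integral_real_affine[where c = "r j" and t = 0], auto)
  also have "\<dots> = ennreal (\<Prod>i\<in>I. r i) * (\<integral>\<^sup>+x. ennreal (r j) * (\<integral>\<^sup>+y. f ((\<lambda>i\<in>I. r i * x i)(j := r j *
    y)) \<partial>lborel) \<partial>leb I)"
  proof (rule insert.IH[of "\<lambda>x. ennreal (r j) * (\<integral>\<^sup>+y. f (x(j := r j * y)) \<partial>lborel)"])
    show "(\<lambda>x. ennreal (r j) * (\<integral>\<^sup>+y. f (x(j := r j * y)) \<partial>lborel)) \<in> borel_measurable (leb I)"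
      using inner by measurable
  qed (use insert.prems(1) in auto)
  also have "\<dots> = ennreal (\<Prod>i\<in>insert j I. r i) * (\<integral>\<^sup>+x. (\<integral>\<^sup>+y. f ((\<lambda>i\<in>I. r i * x i)(j := r j * y)) \<partial>lborel) \<partial>leb I)"
    using insert.prems(1) insert.hyps
    by (subst nn_integral_cmult[OF measurable_compose[OF S inner]])
       (simp add: ennreal_mult prod_nonneg less_imp_le mult_ac)
  also have "(\<integral>\<^sup>+x. (\<integral>\<^sup>+y. f ((\<lambda>i\<in>I. r i * x i)(j := r j * y)) \<partial>lborel) \<partial>leb I) =
    (\<integral>\<^sup>+x. (\<integral>\<^sup>+y. f (\<lambda>i\<in>insert j I. r i * (x(j := y)) i) \<partial>lborel) \<partial>leb I)"
    using insert.hyps by (intro nn_integral_cong arg_cong[where f = f]) auto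
  also have "\<dots> = (\<integral>\<^sup>+u. f (\<lambda>i\<in>insert j I. r i * u i) \<partial>leb (insert j I))"
  proof (rule product_nn_integral_insert[symmetric, OF insert.hyps])
    have "(\<lambda>x. \<lambda>i\<in>insert j I. r i * x i) \<in> leb (insert j I) \<rightarrow>\<^sub>M leb (insert j I)"
      by measurable
    then show "(\<lambda>x. f (\<lambda>i\<in>insert j I. r i * x i)) \<in> borel_measurable (leb (insert j I))"
      by (rule measurable_compose) measurable
  qed
  finally show ?case .
qed

text \<open>The middle coordinates \<open>t i\<close> are fixed and \<open>s\<close> is the peeled
  variable, ranging over the gap from \<open>a\<close> to \<open>b\<close>. Then
  \<open>\<Theta> s\<close> is the last coordinate of the smaller simplex, \<open>T s\<close> the
  last coordinate of the larger one, and \<open>K - T s\<close> the coordinate that replaces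
  \<open>s\<close>. Both factors of \<open>T\<close> decrease while \<open>\<Theta>\<close> is
  positive, so \<open>s \<mapsto> K - T s\<close> maps \<open>S\<close> bijectively onto the
  interval from 0 to \<open>K\<close>, and \<open>D\<close> is its derivative. Hypothesis
  \<open>bend\<close> says how the right end is reached: the factor \<open>yn - s\<close> vanishes
  there, or a term of the sum has a pole.\<close>

lemma nn_integral_peel:
  fixes I :: "nat set" and a b w yn :: real and t y :: "nat \<Rightarrow> real" and H :: "real \<Rightarrow> ennreal"
  defines "\<Theta> \<equiv> \<lambda>s. w * a / s - 1 - (\<Sum>i\<in>I. t i * (y i - a) / (y i - s))"
  defines "T \<equiv> \<lambda>s. (yn - s) / (yn - a) * \<Theta> s"
  defines "K \<equiv> w - 1 - (\<Sum>i\<in>I. t i)"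
  defines "D \<equiv> \<lambda>s. 1 / s * ((yn - s) / (yn - a)) *
    (1 + (\<Sum>i\<in>I. y i * (t i * (y i - a) / (y i - s)) / (y i - s)) + yn * \<Theta> s / (yn - s))"
  assumes fin: "finite I" and ab: "0 < a" "a < b" "b \<le> yn" and w: "w > 0"
    and t: "\<And>i. i \<in> I \<Longrightarrow> t i > 0" and y: "\<And>i. i \<in> I \<Longrightarrow> b \<le> y i"
    and bend: "(I = {} \<and> b = yn) \<or> (\<exists>i\<in>I. y i = b)"
    and [measurable]: "H \<in> borel_measurable borel"
  shows "(\<integral>\<^sup>+s. (if a < s \<and> s < b \<and> \<Theta> s > 0 then ennreal (D s) * H (K - T s) else 0) \<partial>lborel) =
    (\<integral>\<^sup>+v. (if 0 < v \<and> v < K then H v else 0) \<partial>lborel)"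
proof -
  define S where "S = {s. a < s \<and> s < b \<and> \<Theta> s > 0}"
  have Ta: "T a = K" "\<Theta> a = K"
  proof -
    have "(\<Sum>i\<in>I. t i * (y i - a) / (y i - a)) = (\<Sum>i\<in>I. t i)"
      using y ab by (intro sum.cong) (auto, force)
    then show "\<Theta> a = K" unfolding \<Theta>_def K_def using ab by simp
    then show "T a = K" unfolding T_def using ab by simp
  qed
  have anti: "\<Theta> s' < \<Theta> s" if "a \<le> s" "s < s'" "s' < b" for s s'
  proof -
    have "w * a / s' < w * a / s"
      using that ab w by (intro divide_strict_left_mono mult_pos_pos) auto
    moreover have "(\<Sum>i\<in>I. t i * (y i - a) / (y i - s)) \<le> (\<Sum>i\<in>I. t i * (y i - a) / (y i - s'))"
    proof (intro sum_mono divide_left_mono)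
      fix i assume i: "i \<in> I"
      show "y i - s' \<le> y i - s" using that by simp
      show "0 \<le> t i * (y i - a)" using t[OF i] y[OF i] ab by simp
      show "0 < (y i - s) * (y i - s')" using y[OF i] that by simp
    qed
    ultimately show ?thesis unfolding \<Theta>_def by linarith
  qed
  have antiT: "T s' < T s" if "a \<le> s" "s < s'" "s' < b" "\<Theta> s' > 0" for s s'
  proof -
    have "(yn - s') / (yn - a) * \<Theta> s' < (yn - s) / (yn - a) * \<Theta> s"
      using that ab anti[OF that(1-3)]
      by (intro mult_strict_mono divide_strict_right_mono) auto
    then show ?thesis by (simp add: T_def)
  qed
  have dT: "((\<lambda>s. K - T s) has_real_derivative D s) (at s)" if "s \<in> S" for s
  proof -
    have s: "a < s" "s < b" "0 < s" "s < yn" using that ab by (auto simp: S_def)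
    have ys: "y i - s \<noteq> 0" if "i \<in> I" for i using y[OF that] s by auto
    define Z where "Z = (\<Sum>i\<in>I. t i * (y i - a) / (y i - s) ^ 2)"
    have d\<Theta>: "(\<Theta> has_real_derivative (- (w * a / s ^ 2) - Z)) (at s)"
      unfolding \<Theta>_def Z_def using s ys
      by (auto intro!: derivative_eq_intros sum.cong simp: power2_eq_square)
    have "((\<lambda>s. K - T s) has_real_derivative
        - ((- 1 / (yn - a)) * \<Theta> s + (- (w * a / s ^ 2) - Z) * ((yn - s) / (yn - a)))) (at s)"
    proof -
      have "((\<lambda>s. (yn - s) / (yn - a)) has_real_derivative - 1 / (yn - a)) (at s)"
        unfolding divide_inverse by (auto intro!: derivative_eq_intros)
      from DERIV_diff[OF DERIV_const[of K] DERIV_mult[OF this d\<Theta>]] show ?thesis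
        unfolding T_def by simp
    qed
    moreover have "- ((- 1 / (yn - a)) * \<Theta> s + (- (w * a / s ^ 2) - Z) * ((yn - s) / (yn - a))) = D s"
    proof -
      \<comment> \<open>Eliminating \<open>w * a / s\<close> in favour of \<open>\<Theta> s\<close>
        brings the derivative into the form of \<open>D\<close>, the weight that the interpolation
        formula at \<open>s\<close> produces.\<close>
      have e1: "w * a / s = \<Theta> s + 1 + (\<Sum>i\<in>I. t i * (y i - a) / (y i - s))"
        by (simp add: \<Theta>_def)
      have e2: "(\<Sum>i\<in>I. t i * (y i - a) / (y i - s)) + s * Z =
          (\<Sum>i\<in>I. y i * (t i * (y i - a) / (y i - s)) / (y i - s))"
        unfolding Z_def sum_distrib_left sum.distrib[symmetric]
      proof (rule sum.cong)
        fix i assume "i \<in> I"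
        have "c / d + s * (c / d\<^sup>2) = (d + s) * (c / d) / d" if "d \<noteq> 0" for c d :: real
          using that by (simp add: divide_simps power2_eq_square) (simp add: algebra_simps)?
        from this[OF ys[OF \<open>i \<in> I\<close>], of "t i * (y i - a)"]
        show "t i * (y i - a) / (y i - s) + s * (t i * (y i - a) / (y i - s)\<^sup>2) =
          y i * (t i * (y i - a) / (y i - s)) / (y i - s)" by simp
      qed simp
      have "w * a / s ^ 2 = (w * a / s) / s" by (simp add: power2_eq_square)
      also have "\<dots> = (\<Theta> s + 1 + (\<Sum>i\<in>I. t i * (y i - a) / (y i - s))) / s" by (simp add: e1)
      finally have "w * a / s ^ 2 + Z =
        (\<Theta> s + 1 + ((\<Sum>i\<in>I. t i * (y i - a) / (y i - s)) + s * Z)) / s"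
        using s by (simp add: add_divide_distrib)
      then have e3: "w * a / s ^ 2 + Z = (\<Theta> s + 1 + (\<Sum>i\<in>I. y i * (t i * (y i - a) / (y i - s)) / (y i - s))) / s"
        unfolding e2 .
      have "- ((- 1 / (yn - a)) * \<Theta> s + (- (w * a / s ^ 2) - Z) * ((yn - s) / (yn - a))) =
         (\<Theta> s + (w * a / s ^ 2 + Z) * (yn - s)) / (yn - a)"
      proof -
        have "- ((- 1 / d) * e + (- p - q) * (r / d)) = (e + (p + q) * r) / d" for d e p q r :: real
          by (simp add: add_divide_distrib diff_divide_distrib algebra_simps)
        then show ?thesis .
      qed
      also have "\<dots> = D s"
      proof -
        have "(h + (h + 1 + X) / p * r) / d = 1 / p * (r / d) * (1 + X + (r + p) * h / r)"
          if "p \<noteq> 0" "r \<noteq> 0" for d h p r X :: real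
        proof -
          have "(r + p) * h / r = h + p * h / r" using that by (simp add: add_divide_distrib distrib_right)
          then have "1 / p * r * (1 + X + (r + p) * h / r) = (1 + X + h) / p * r + h"
            using that by (simp add: distrib_left distrib_right add_divide_distrib mult.commute)
          then have "1 / p * r * (1 + X + (r + p) * h / r) / d = ((1 + X + h) / p * r + h) / d"
            by (rule arg_cong)
          then show ?thesis by (simp add: add_ac)
        qed
        from this[of s "yn - s" "\<Theta> s" _ "yn - a"] show ?thesis
          unfolding e3 D_def using s by simp
      qed
      finally show ?thesis .
    qed
    ultimately show ?thesis by simp
  qed
  have Dpos: "D s \<ge> 0" if "s \<in> S" for s
  proof -
    have s: "a < s" "s < b" "\<Theta> s > 0" using that by (auto simp: S_def)
    have "(\<Sum>i\<in>I. y i * (t i * (y i - a) / (y i - s)) / (y i - s)) \<ge> 0"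
    proof (intro sum_nonneg divide_nonneg_nonneg mult_nonneg_nonneg)
      fix i assume "i \<in> I"
      show "0 \<le> y i" "0 \<le> t i" "0 \<le> y i - a" "0 \<le> y i - s" "0 \<le> y i - s"
        using y[OF \<open>i \<in> I\<close>] t[OF \<open>i \<in> I\<close>] s ab by auto
    qed
    then show ?thesis using s ab by (simp add: D_def)
  qed
  have inj: "inj_on (\<lambda>s. K - T s) S"
  proof (rule linorder_inj_onI)
    fix s s' assume "s < s'" "s \<in> S" "s' \<in> S"
    then show "K - T s \<noteq> K - T s'" using antiT[of s s'] by (auto simp: S_def)
  qed auto
  have img: "(\<lambda>s. K - T s) ` S = {0<..<K}"
  proof safe
    fix s assume s: "s \<in> S"
    have "T s < T a" using s antiT[of a s] ab by (auto simp: S_def)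
    moreover have "T s > 0" using s ab by (auto simp: S_def T_def)
    ultimately show "K - T s \<in> {0<..<K}" using Ta by simp
  next
    fix v assume v: "v \<in> {0<..<K}"
    have cont: "continuous_on {a..c} T" if "c < b \<or> I = {}" for c
      unfolding T_def \<Theta>_def using that ab y
      by (intro continuous_intros) (force+)
    obtain c where c: "a < c" "c \<le> b" "c < b \<or> I = {}" "T c < K - v"
      using bend
    proof (elim disjE conjE bexE)
      assume "I = {}" "b = yn"
      then show ?thesis using that[of b] ab v by (simp add: T_def)
    next
      fix i assume i: "i \<in> I" "y i = b"
      \<comment> \<open>The midpoint keeps \<open>c\<close> inside the interval; the second entry
        makes the term with the pole at \<open>b\<close> at least \<open>w\<close>, which outweighs
        \<open>w * a / c < w\<close> and gives \<open>\<Theta> c < 0\<close>.\<close>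
      define c where "c = max ((a + b) / 2) (b - t i * (b - a) / w)"
      have c: "a < c" "c < b" "b - c \<le> t i * (b - a) / w"
      proof -
        have "t i * (b - a) / w > 0" using ab t[OF i(1)] w by simp
        moreover have "a < (a + b) / 2" "(a + b) / 2 < b" using ab by simp_all
        ultimately show "a < c" "c < b" "b - c \<le> t i * (b - a) / w"
          unfolding c_def by linarith+
      qed
      have "w \<le> t i * (b - a) / (b - c)" using c w by (simp add: field_simps)
      also have "\<dots> \<le> (\<Sum>i\<in>I. t i * (y i - a) / (y i - c))"
      proof -
        have "0 \<le> t k * (y k - a) / (y k - c)" if "k \<in> I" for k
          using t[OF that] y[OF that] c ab by simp
        from member_le_sum[of i I "\<lambda>k. t k * (y k - a) / (y k - c)"] this fin i show ?thesis by auto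
      qed
      finally have "\<Theta> c \<le> w * a / c - 1 - w" by (simp add: \<Theta>_def)
      also have "w * a / c < w" using c ab w by (simp add: field_simps)
      finally have "\<Theta> c < 0" by simp
      then have "T c < 0" unfolding T_def using c ab by (intro mult_pos_neg) auto
      then show ?thesis using that[of c] c v by auto
    qed
    obtain s where s: "a \<le> s" "s \<le> c" "T s = K - v"
      using IVT2'[of T c "K - v" a] c cont[of c] Ta v by auto
    have "s \<noteq> a" "s \<noteq> c" using s Ta v c by auto
    then have "a < s" "s < b" using s c by auto
    moreover have "\<Theta> s > 0"
    proof (rule ccontr)
      assume "\<not> \<Theta> s > 0"
      then have "T s \<le> 0" unfolding T_def using \<open>a < s\<close> \<open>s < b\<close> ab by (intro mult_nonneg_nonpos) auto
      then show False using s v by auto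
    qed
    ultimately show "v \<in> (\<lambda>s. K - T s) ` S" using s by (intro image_eqI[of _ _ s]) (auto simp: S_def)
  qed
  have [measurable]: "\<Theta> \<in> borel_measurable borel" "T \<in> borel_measurable borel" "D \<in> borel_measurable borel"
    unfolding D_def T_def \<Theta>_def by measurable
  have [measurable]: "S \<in> sets borel" unfolding S_def by measurable
  have "(\<integral>\<^sup>+s. indicator S s * (ennreal (D s) * H (K - T s)) \<partial>lborel) =
    (\<integral>\<^sup>+v. indicator {0<..<K} v * H v \<partial>lborel)"
    by (rule nn_integral_substitution_inj[OF _ _ _ _ dT Dpos inj img]) measurable
  moreover have "(\<lambda>s. indicator S s * (ennreal (D s) * H (K - T s))) =
      (\<lambda>s. if a < s \<and> s < b \<and> \<Theta> s > 0 then ennreal (D s) * H (K - T s) else 0)"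
    by (auto simp: S_def indicator_def)
  moreover have "(\<lambda>v. indicator {0<..<K} v * H v) = (\<lambda>v. if 0 < v \<and> v < K then H v else 0)"
    by (auto simp: indicator_def)
  ultimately show ?thesis by simp
qed

section \<open>Interlacing variables and the simplex\<close>

text \<open>All data are indexed by the first variable \<open>j\<close>, since the induction removes
  the lowest index; \<open>j = 1\<close> gives back \<open>xi\<close>.\<close>

definition xi_from :: "nat \<Rightarrow> nat \<Rightarrow> (nat \<Rightarrow> real) \<Rightarrow> (nat \<Rightarrow> real) \<Rightarrow> nat \<Rightarrow> real" where
  "xi_from n j y x i = (\<Prod>k\<in>{j..n}. x k - y i) / (\<Prod>k\<in>{j..n} - {i}. y k - y i)"

text \<open>Restricted to \<open>{j..n}\<close> so that the values lie in the product space on which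
  \<open>F\<close> is measurable.\<close>

definition tau_from :: "nat \<Rightarrow> nat \<Rightarrow> (nat \<Rightarrow> real) \<Rightarrow> (nat \<Rightarrow> real) \<Rightarrow> nat \<Rightarrow> real" where
  "tau_from n j y x = (\<lambda>i\<in>{j..n}. xi_from n j y x i / y i)"

definition vandermonde_from :: "nat \<Rightarrow> nat \<Rightarrow> (nat \<Rightarrow> real) \<Rightarrow> real" where
  "vandermonde_from n j x = (\<Prod>l\<in>{j..n}. \<Prod>i\<in>{j..<l}. x l - x i)"

text \<open>The divisor is the derivative of \<open>x j * ... * x n\<close> with respect to
  \<open>x n\<close>, the contribution of the delta function; hence it stops before
  \<open>x n\<close>.\<close>

definition jac_from :: "nat \<Rightarrow> nat \<Rightarrow> (nat \<Rightarrow> real) \<Rightarrow> (nat \<Rightarrow> real) \<Rightarrow> real" where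
  "jac_from n j y x = vandermonde_from n j x / vandermonde_from n j y / (\<Prod>i\<in>{j..<n}. x i)"

definition interlace_from :: "nat \<Rightarrow> nat \<Rightarrow> (nat \<Rightarrow> real) \<Rightarrow> (nat \<Rightarrow> real) \<Rightarrow> bool" where
  "interlace_from n j y x \<longleftrightarrow> (\<forall>i\<in>{j..n}. y i < x i \<and> (i < n \<longrightarrow> x i < y (i + 1)))"

definition graph_from :: "nat \<Rightarrow> nat \<Rightarrow> (nat \<Rightarrow> real) \<Rightarrow> real \<Rightarrow> (nat \<Rightarrow> real) \<Rightarrow> nat \<Rightarrow> real" where
  "graph_from n j y w u = u(n := w * (\<Prod>i\<in>{j..n}. y i) / (\<Prod>i\<in>{j..<n}. u i))"

definition simplex_from :: "nat \<Rightarrow> nat \<Rightarrow> real \<Rightarrow> (nat \<Rightarrow> real) \<Rightarrow> nat \<Rightarrow> real" where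
  "simplex_from n j w t = t(n := w - (\<Sum>i\<in>{j..<n}. t i))"

abbreviation jacobian_integrand ::
    "nat \<Rightarrow> nat \<Rightarrow> (nat \<Rightarrow> real) \<Rightarrow> real \<Rightarrow> ((nat \<Rightarrow> real) \<Rightarrow> ennreal) \<Rightarrow> (nat \<Rightarrow> real) \<Rightarrow> ennreal" where
  "jacobian_integrand n j y w F u \<equiv> (let x = graph_from n j y w u in
    if interlace_from n j y x then ennreal (jac_from n j y x) * F (tau_from n j y x) else 0)"

abbreviation simplex_integrand ::
    "nat \<Rightarrow> nat \<Rightarrow> real \<Rightarrow> ((nat \<Rightarrow> real) \<Rightarrow> 'a::zero) \<Rightarrow> (nat \<Rightarrow> real) \<Rightarrow> 'a" where
  "simplex_integrand n j w F t \<equiv> (let t' = simplex_from n j w t in if \<forall>i\<in>{j..n}. t' i > 0 then F t' else 0)"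

lemma vandermonde_from_Suc:
  assumes "j \<le> n"
  shows "vandermonde_from n j x = (\<Prod>l\<in>{Suc j..n}. x l - x j) * vandermonde_from n (Suc j) x"
proof -
  have "vandermonde_from n j x = (\<Prod>l\<in>{Suc j..n}. \<Prod>i\<in>{j..<l}. x l - x i)"
    unfolding vandermonde_from_def using assms
    by (subst atLeastAtMost_insertL[symmetric]) auto
  also have "\<dots> = (\<Prod>l\<in>{Suc j..n}. (x l - x j) * (\<Prod>i\<in>{Suc j..<l}. x l - x i))"
    by (intro prod.cong refl) (simp add: prod.atLeast_Suc_lessThan)
  finally show ?thesis by (simp add: vandermonde_from_def prod.distrib)
qed

lemma measurable_graph_from [measurable]:
  assumes "j \<le> n"
  shows "graph_from n j y w \<in> leb {j..<n} \<rightarrow>\<^sub>M leb {j..n}"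
proof -
  have "(\<lambda>u. u(n := w * (\<Prod>i\<in>{j..n}. y i) / (\<Prod>i\<in>{j..<n}. u i))) \<in> leb {j..<n} \<rightarrow>\<^sub>M leb {j..n}"
    by (rule measurable_fun_upd[where J = "{j..<n}"]) (use assms in auto)
  then show ?thesis by (simp add: graph_from_def[abs_def])
qed

lemma measurable_simplex_from [measurable]:
  assumes "j \<le> n"
  shows "simplex_from n j w \<in> leb {j..<n} \<rightarrow>\<^sub>M leb {j..n}"
proof -
  have "(\<lambda>u. u(n := w - (\<Sum>i\<in>{j..<n}. u i))) \<in> leb {j..<n} \<rightarrow>\<^sub>M leb {j..n}"
    by (rule measurable_fun_upd[where J = "{j..<n}"]) (use assms in auto)
  then show ?thesis by (simp add: simplex_from_def[abs_def])
qed

lemma measurable_tau_from [measurable]: "tau_from n j y \<in> leb {j..n} \<rightarrow>\<^sub>M leb {j..n}"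
  unfolding tau_from_def[abs_def] xi_from_def by measurable

lemma measurable_jac_from [measurable]: "jac_from n j y \<in> borel_measurable (leb {j..n})"
  unfolding jac_from_def[abs_def] vandermonde_from_def by measurable

lemma measurable_interlace_from [measurable]:
  "Measurable.pred (leb {j..n}) (interlace_from n j y)"
  unfolding interlace_from_def[abs_def] by measurable

lemma measurable_pos [measurable]:
  fixes j n :: nat
  shows "Measurable.pred (leb {j..n}) (\<lambda>t. \<forall>i\<in>{j..n}. t i > 0)"
  by measurable

lemma measurable_graph_integrand:
  assumes "j \<le> n" and "F \<in> borel_measurable (leb {j..n})"
  shows "(\<lambda>u. jacobian_integrand n j y w F u)
    \<in> borel_measurable (leb {j..<n})"
proof -
  have "(\<lambda>x. F (tau_from n j y x)) \<in> borel_measurable (leb {j..n})"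
    by (rule measurable_compose[OF measurable_tau_from assms(2)])
  then have "(\<lambda>x. if interlace_from n j y x then ennreal (jac_from n j y x) * F (tau_from n j y x) else 0)
    \<in> borel_measurable (leb {j..n})" by measurable
  from measurable_compose[OF measurable_graph_from[OF assms(1)] this] show ?thesis
    by (simp add: Let_def)
qed

lemma measurable_simplex_integrand:
  assumes "j \<le> n" and "F \<in> borel_measurable (leb {j..n})"
  shows "(\<lambda>t. simplex_integrand n j w F t)
    \<in> borel_measurable (leb {j..<n})"
proof -
  have "(\<lambda>t. if \<forall>i\<in>{j..n}. t i > 0 then F t else 0) \<in> borel_measurable (leb {j..n})"
    using assms(2) by measurable
  from measurable_compose[OF measurable_simplex_from[OF assms(1)] this] show ?thesis
    by (simp add: Let_def)
qed

text \<open>Taken at two values of \<open>s\<close>: 0 turns the product constraint into a sum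
  constraint, and \<open>s = x j\<close> yields the weight by which the Jacobian changes when
  \<open>x j\<close> is removed.\<close>

lemma interpolation_quotient:
  assumes inj: "inj_on y {j..n}" and s: "\<And>i. i \<in> {j..n} \<Longrightarrow> y i \<noteq> s"
  shows "(\<Prod>k\<in>{j..n}. x k - s) = (\<Prod>k\<in>{j..n}. y k - s) * (1 + (\<Sum>i\<in>{j..n}. xi_from n j y x i / (y i - s)))"
proof -
  have "(\<Sum>i\<in>{j..n}. xi_from n j y x i * (\<Prod>k\<in>{j..n} - {i}. y k - s)) =
    (\<Prod>k\<in>{j..n}. y k - s) * (\<Sum>i\<in>{j..n}. xi_from n j y x i / (y i - s))"
    unfolding sum_distrib_left
  proof (rule sum.cong)
    fix i assume i: "i \<in> {j..n}"
    have "(\<Prod>k\<in>{j..n}. y k - s) = (y i - s) * (\<Prod>k\<in>{j..n} - {i}. y k - s)"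
      using i by (subst prod.remove[of _ i]) auto
    then show "xi_from n j y x i * (\<Prod>k\<in>{j..n} - {i}. y k - s) =
        (\<Prod>k\<in>{j..n}. y k - s) * (xi_from n j y x i / (y i - s))"
      using s[OF i] by simp
  qed simp
  then show ?thesis
    using prod_interpolation[OF _ inj, of x s] by (simp add: xi_from_def algebra_simps)
qed

lemma nn_integral_PiM_empty:
  fixes f :: "('i \<Rightarrow> real) \<Rightarrow> ennreal"
  shows "(\<integral>\<^sup>+u. f u \<partial>leb {}) = f (\<lambda>_. undefined)"
  by (simp add: PiM_empty nn_integral_count_space_finite)

text \<open>Over the empty product both integrals are values at a single point, and the \<tau>
  belonging to \<open>x n = w * y n\<close> is \<open>w - 1\<close>.\<close>

lemma change_of_variables_base:
  assumes "y n > (0::real)"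
  shows "(\<integral>\<^sup>+u. jacobian_integrand n n y w F u \<partial>leb {n..<n}) =
    (\<integral>\<^sup>+t. simplex_integrand n n (w - 1) F t \<partial>leb {n..<n})"
proof -
  have "(w * y n - y n) / y n = w - 1" using assms by (simp add: field_simps)
  moreover have "(w - 1 > 0) = (y n < w * y n)" using assms by simp
  moreover have "(\<lambda>i\<in>{n}. if i = n then v else undefined) = (\<lambda>_. undefined)(n := v)" for v :: real
    by auto
  ultimately show ?thesis
    by (auto simp: nn_integral_PiM_empty graph_from_def simplex_from_def interlace_from_def jac_from_def
        vandermonde_from_def tau_from_def xi_from_def Let_def restrict_def fun_upd_def
        intro!: arg_cong[where f = F])
qed

lemma interlace_from_Suc:
  assumes "j < n"
  shows "interlace_from n j y x \<longleftrightarrow> y j < x j \<and> x j < y (Suc j) \<and> interlace_from n (Suc j) y x"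
  unfolding interlace_from_def using assms
  by (subst atLeastAtMost_insertL[symmetric]) auto

lemma graph_from_Suc:
  assumes "j < n" "y j \<noteq> 0"
  shows "graph_from n j y w (u(j := s)) = (graph_from n (Suc j) y (w * y j / s) u)(j := s)"
proof -
  have "(\<Prod>i\<in>{j..n}. y i) = y j * (\<Prod>i\<in>{Suc j..n}. y i)"
    using assms by (simp add: prod.atLeast_Suc_atMost)
  moreover have "(\<Prod>i\<in>{j..<n}. (u(j := s)) i) = s * (\<Prod>i\<in>{Suc j..<n}. u i)"
    using assms by (simp add: prod.atLeast_Suc_lessThan)
  ultimately show ?thesis
    using assms by (auto simp: graph_from_def)
qed

lemma xi_from_Suc:
  assumes "j < n" "i \<in> {Suc j..n}"
  shows "xi_from n j y x i = xi_from n (Suc j) y x i * ((y i - x j) / (y i - y j))"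
proof -
  have "(\<Prod>k\<in>{j..n}. x k - y i) = (x j - y i) * (\<Prod>k\<in>{Suc j..n}. x k - y i)"
    using assms by (simp add: prod.atLeast_Suc_atMost)
  moreover have "(\<Prod>k\<in>{j..n} - {i}. y k - y i) = (y j - y i) * (\<Prod>k\<in>{Suc j..n} - {i}. y k - y i)"
  proof -
    have "{j..n} - {i} = insert j ({Suc j..n} - {i})" using assms by auto
    then show ?thesis by simp
  qed
  moreover have "(x j - y i) / (y j - y i) = (y i - x j) / (y i - y j)"
    by (metis minus_diff_eq minus_divide_divide)
  ultimately have "xi_from n j y x i = (y i - x j) / (y i - y j) * xi_from n (Suc j) y x i"
    unfolding xi_from_def by (metis times_divide_times_eq)
  then show ?thesis by simp
qed

lemma jac_from_Suc:
  assumes "j < n"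
  shows "jac_from n j y x = (1 / x j) * ((\<Prod>l\<in>{Suc j..n}. x l - x j) / (\<Prod>l\<in>{Suc j..n}. y l - y j)) *
    jac_from n (Suc j) y x"
  using assms by (simp add: jac_from_def vandermonde_from_Suc prod.atLeast_Suc_lessThan)

lemma sum_tau_from:
  assumes "inj_on y {j..n}" and y: "\<And>i. i \<in> {j..n} \<Longrightarrow> y i > 0" and x: "\<And>i. i \<in> {j..n} \<Longrightarrow> x i > 0"
    and "j \<le> n" and "x n = w * (\<Prod>i\<in>{j..n}. y i) / (\<Prod>i\<in>{j..<n}. x i)"
  shows "(\<Sum>i\<in>{j..n}. tau_from n j y x i) = w - 1"
proof -
  have "(\<Prod>k\<in>{j..n}. x k) = (\<Prod>i\<in>{j..n}. y i) * (1 + (\<Sum>i\<in>{j..n}. tau_from n j y x i))"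
    using interpolation_quotient[OF assms(1), of 0 x] y by (force simp: tau_from_def)
  moreover have "(\<Prod>k\<in>{j..n}. x k) = w * (\<Prod>i\<in>{j..n}. y i)"
  proof -
    have "(\<Prod>i\<in>{j..<n}. x i) \<noteq> 0" using x by (simp add: prod_zero_iff) force
    moreover have "{j..n} = insert n {j..<n}" using assms(4) by auto
    ultimately show ?thesis using assms(5) by simp
  qed
  moreover have "(\<Prod>i\<in>{j..n}. y i) \<noteq> 0" using y by (simp add: prod_zero_iff) force
  ultimately show ?thesis by simp
qed

section \<open>The inductive step: \<open>x j\<close> is exchanged for the simplex coordinate at
  \<open>j\<close>\<close>

context
  fixes n j :: nat and y :: "nat \<Rightarrow> real" and w :: real and F :: "(nat \<Rightarrow> real) \<Rightarrow> ennreal"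
  assumes jn: "j < n" and ypos: "0 < y j" and ymono: "strict_mono_on {j..n} y" and w: "w > 0"
    and F[measurable]: "F \<in> borel_measurable (leb {j..n})"
begin

lemma y_less: "j \<le> i \<Longrightarrow> i < k \<Longrightarrow> k \<le> n \<Longrightarrow> y i < y k"
  using ymono by (auto simp: strict_mono_on_def)

text \<open>By \<open>xi_from_Suc\<close>, the ratio at index \<open>i\<close> between the \<tau> of
  the problem starting at \<open>j\<close> and the \<tau> of the problem starting at
  \<open>Suc j\<close>, when \<open>x j = s\<close>.\<close>

definition rho :: "real \<Rightarrow> nat \<Rightarrow> real" where "rho s i = (y i - s) / (y i - y j)"

abbreviation J :: "nat set" where "J \<equiv> {Suc j..<n}"

abbreviation J' :: "nat set" where "J' \<equiv> {Suc j..n}"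

text \<open>The dependent coordinate of the simplex of size \<open>w * y j / s - 1\<close> in the
  problem from \<open>Suc j\<close>, once its free coordinates are written as
  \<open>t i / rho s i\<close>.\<close>

definition last_coord :: "real \<Rightarrow> (nat \<Rightarrow> real) \<Rightarrow> real" where
  "last_coord s t = w * y j / s - 1 - (\<Sum>i\<in>J. t i * (y i - y j) / (y i - s))"

definition jac_weight :: "real \<Rightarrow> (nat \<Rightarrow> real) \<Rightarrow> real" where
  "jac_weight s t = 1 / s * rho s n * (1 + (\<Sum>i\<in>J. y i * (t i * (y i - y j) / (y i - s)) / (y i - s)) +
     y n * last_coord s t / (y n - s))"

definition simplex_coords :: "real \<Rightarrow> (nat \<Rightarrow> real) \<Rightarrow> nat \<Rightarrow> real" where
  "simplex_coords s t = t(j := w - 1 - (\<Sum>i\<in>J. t i) - rho s n * last_coord s t, n := rho s n * last_coord s t)"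

text \<open>The integrand in mixed coordinates: \<open>s\<close> is still the variable
  \<open>x j\<close>, while the \<open>t i\<close> with \<open>i \<in> J\<close> are already
  coordinates of the final simplex.\<close>

definition mixed :: "real \<Rightarrow> (nat \<Rightarrow> real) \<Rightarrow> ennreal" where
  "mixed s t = (if y j < s \<and> s < y (Suc j) \<and> (\<forall>i\<in>J. t i > 0) \<and> last_coord s t > 0
     then ennreal (jac_weight s t) * F (simplex_coords s t) else 0)"

text \<open>The function fed to the induction hypothesis: \<open>F\<close> expressed in the
  coordinates \<theta> of the smaller simplex, with the part of the Jacobian due to
  \<open>x j\<close>. The entry at \<open>j\<close> is forced by the total \<open>w - 1\<close> of
  all coordinates.\<close>

definition Fstep :: "real \<Rightarrow> (nat \<Rightarrow> real) \<Rightarrow> ennreal" where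
  "Fstep s \<theta> = ennreal (1 / s * (\<Prod>k\<in>J'. rho s k) * (1 + (\<Sum>i\<in>J'. y i * \<theta> i / (y i - s)))) *
     F (\<lambda>i\<in>{j..n}. if i = j then w - 1 - (\<Sum>k\<in>J'. \<theta> k * rho s k) else \<theta> i * rho s i)"

lemma Fstep_measurable [measurable]: "Fstep s \<in> borel_measurable (leb J')"
proof -
  have "(\<lambda>\<theta>. \<lambda>i\<in>{j..n}. if i = j then w - 1 - (\<Sum>k\<in>J'. \<theta> k * rho s k) else \<theta> i * rho s i) \<in> leb J' \<rightarrow>\<^sub>M leb {j..n}"
  proof (rule measurable_restrict)
    fix i assume i: "i \<in> {j..n}"
    show "(\<lambda>\<theta>. if i = j then w - 1 - (\<Sum>k\<in>J'. \<theta> k * rho s k) else \<theta> i * rho s i) \<in> leb J' \<rightarrow>\<^sub>M lborel"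
    proof (cases "i = j")
      case False
      with i have "i \<in> J'" by auto
      then show ?thesis using False by simp
    qed simp
  qed
  from measurable_compose[OF this F] show ?thesis
    unfolding Fstep_def[abs_def] by measurable
qed

lemma mixed_measurable: "(\<lambda>v. mixed (v j) v) \<in> borel_measurable (leb {j..<n})"
proof -
  have j[measurable]: "(\<lambda>v. v j) \<in> borel_measurable (leb {j..<n})"
    using jn measurable_component_singleton[of j "{j..<n}" "\<lambda>_. lborel :: real measure"] by simp
  have c[measurable]: "(\<lambda>v. v i) \<in> borel_measurable (leb {j..<n})" if "i \<in> J" for i
    using that measurable_component_singleton[of i "{j..<n}" "\<lambda>_. lborel :: real measure"] by simp
  have [measurable]: "(\<lambda>v. last_coord (v j) v) \<in> borel_measurable (leb {j..<n})"
    unfolding last_coord_def by measurable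
  have [measurable]: "(\<lambda>v. jac_weight (v j) v) \<in> borel_measurable (leb {j..<n})"
    unfolding jac_weight_def rho_def by measurable
  have "(\<lambda>v. simplex_coords (v j) v) \<in> leb {j..<n} \<rightarrow>\<^sub>M leb {j..n}"
    unfolding simplex_coords_def rho_def using jn
    by (intro measurable_fun_upd[where J = "{j..<n}" and I = "{j..n}"] measurable_fun_upd[where J =
      "{j..<n}" and I = "{j..<n}"])
       auto
  from measurable_compose[OF this F] have [measurable]: "(\<lambda>v. F (simplex_coords (v j) v)) \<in>
    borel_measurable (leb {j..<n})" .
  have [measurable]: "Measurable.pred (leb {j..<n}) (\<lambda>v. \<forall>i\<in>J. v i > 0)"
    by measurable
  show ?thesis unfolding mixed_def by measurable
qed

text \<open>Coordinate \<open>j\<close> of the vector is free to carry \<open>s\<close>, which makes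
  \<open>mixed\<close> one function on the product over \<open>{j..<n}\<close> and permits
  exchanging the order of integration.\<close>

lemma mixed_upd: "mixed s (t(j := v)) = mixed s t"
  by (simp add: mixed_def jac_weight_def last_coord_def simplex_coords_def)

text \<open>For \<open>x j = s\<close> in its gap, interlacing from \<open>j\<close> reduces to
  interlacing from \<open>Suc j\<close>, and interpolation over \<open>J'\<close> at
  \<open>s\<close> supplies the extra factor of the Jacobian.\<close>

lemma integrand_peel:
  assumes "y j < s" "s < y (Suc j)"
  shows "jacobian_integrand n j y w F (u(j := s)) =
    jacobian_integrand n (Suc j) y (w * y j / s) (Fstep s) u"
proof -
  define x where "x = graph_from n (Suc j) y (w * y j / s) u"
  define x' where "x' = x(j := s)"
  have gx: "graph_from n j y w (u(j := s)) = x'"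
    using graph_from_Suc[OF jn, of y w u s] ypos by (simp add: x_def x'_def)
  have same: "xi_from n (Suc j) y x' i = xi_from n (Suc j) y x i" for i
    unfolding xi_from_def x'_def by (intro arg_cong2[where f = "(/)"] prod.cong) auto
  have int': "interlace_from n (Suc j) y x' = interlace_from n (Suc j) y x"
    by (auto simp: interlace_from_def x'_def)
  have inter: "interlace_from n j y x' \<longleftrightarrow> interlace_from n (Suc j) y x"
    using interlace_from_Suc[OF jn, of y x'] assms int' by (simp add: x'_def)
  have jac': "jac_from n (Suc j) y x' = jac_from n (Suc j) y x"
    unfolding jac_from_def vandermonde_from_def x'_def
    by (intro arg_cong2[where f = "(/)"] prod.cong) auto
  show ?thesis
  proof (cases "interlace_from n (Suc j) y x")
    case False
    then show ?thesis using inter by (simp add: gx x_def[symmetric])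
  next
    case True
    have ypos': "y i > 0" if "i \<in> {j..n}" for i
      using that ypos y_less[of j i] by (cases "i = j") auto
    have ys: "y i > s" if "i \<in> J'" for i
      using that assms y_less[of "Suc j" i] by (cases "i = Suc j") auto
    have xpos: "x' i > 0" if "i \<in> {j..n}" for i
      using True inter ypos'[OF that] that unfolding interlace_from_def by fastforce
    have inj: "inj_on y {j..n}" using ymono by (rule strict_mono_on_imp_inj_on)
    then have inj': "inj_on y J'" by (rule inj_on_subset) auto
    define \<theta> where "\<theta> = tau_from n (Suc j) y x"
    have \<theta>: "y i * \<theta> i = xi_from n (Suc j) y x i" if "i \<in> J'" for i
      using that ypos'[of i] by (simp add: \<theta>_def tau_from_def)
    have tau: "tau_from n j y x' i = \<theta> i * rho s i" if "i \<in> J'" for i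
      using that xi_from_Suc[OF jn that, of y x'] by (simp add: tau_from_def \<theta>_def same rho_def) (simp add: x'_def)
    have sum: "(\<Sum>i\<in>{j..n}. tau_from n j y x' i) = w - 1"
    proof (rule sum_tau_from[OF inj ypos' xpos])
      show "x' n = w * prod y {j..n} / prod x' {j..<n}"
      proof -
        have "x' n = w * prod y {j..n} / (\<Prod>i\<in>{j..<n}. (u(j := s)) i)"
          unfolding gx[symmetric] graph_from_def by simp
        moreover have "(\<Prod>i\<in>{j..<n}. (u(j := s)) i) = prod x' {j..<n}"
          unfolding gx[symmetric] graph_from_def by (intro prod.cong) auto
        ultimately show ?thesis by simp
      qed
    qed (use jn in auto)
    have "(\<Sum>i\<in>{j..n}. tau_from n j y x' i) = tau_from n j y x' j + (\<Sum>i\<in>J'. \<theta> i * rho s i)"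
      using jn tau by (simp add: sum.atLeast_Suc_atMost)
    then have tauj: "tau_from n j y x' j = w - 1 - (\<Sum>i\<in>J'. \<theta> i * rho s i)"
      using sum by simp
    have tau_eq: "tau_from n j y x' = (\<lambda>i\<in>{j..n}. if i = j then w - 1 - (\<Sum>k\<in>J'. \<theta> k * rho s k) else \<theta> i * rho s i)"
    proof
      fix i
      show "tau_from n j y x' i = (\<lambda>i\<in>{j..n}. if i = j then w - 1 - (\<Sum>k\<in>J'. \<theta> k * rho s k) else \<theta> i * rho s i) i"
      proof (cases "i \<in> J'")
        case True
        then show ?thesis using tau[of i] by simp
      next
        case False
        then show ?thesis using tauj jn by (cases "i = j") (auto simp: tau_from_def[of n j])
      qed
    qed
    have "(\<Prod>l\<in>J'. x' l - x' j) = (\<Prod>l\<in>J'. x l - s)"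
      by (intro prod.cong) (auto simp: x'_def)
    also have "\<dots> = (\<Prod>k\<in>J'. y k - s) * (1 + (\<Sum>i\<in>J'. xi_from n (Suc j) y x i / (y i - s)))"
      using ys by (intro interpolation_quotient[OF inj']) fastforce
    also have "(\<Sum>i\<in>J'. xi_from n (Suc j) y x i / (y i - s)) = (\<Sum>i\<in>J'. y i * \<theta> i / (y i - s))"
      by (intro sum.cong) (auto simp: \<theta>)
    finally have "(\<Prod>l\<in>J'. x' l - x' j) / (\<Prod>l\<in>J'. y l - y j) =
        (\<Prod>k\<in>J'. rho s k) * (1 + (\<Sum>i\<in>J'. y i * \<theta> i / (y i - s)))"
      by (simp add: rho_def prod_dividef)
    then have jac: "jac_from n j y x' = 1 / s * (\<Prod>k\<in>J'. rho s k) * (1 + (\<Sum>i\<in>J'. y i * \<theta> i / (y i - s))) *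
      jac_from n (Suc j) y x"
      using jac_from_Suc[OF jn, of y x'] jac' by (simp add: x'_def)
    have vpos: "vandermonde_from n (Suc j) z > 0" if "\<And>i l. Suc j \<le> i \<Longrightarrow> i < l \<Longrightarrow> l \<le> n \<Longrightarrow> z i < z l" for z
      unfolding vandermonde_from_def by (intro prod_pos ballI) (use that in auto)
    have xmono: "x i < x l" if "Suc j \<le> i" "i < l" "l \<le> n" for i l
    proof -
      have "x i < y (Suc i)" "y l < x l" using True that by (auto simp: interlace_from_def)
      moreover have "y (Suc i) \<le> y l" using that y_less[of "Suc i" l] by (cases "Suc i = l") auto
      ultimately show ?thesis by simp
    qed
    have "prod x J > 0"
      using xpos by (intro prod_pos ballI) (auto simp: x'_def, metis Suc_n_not_le_n less_imp_le_nat Suc_leD)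
    then have jnn: "jac_from n (Suc j) y x \<ge> 0"
      unfolding jac_from_def using vpos[OF xmono] vpos[of y] y_less by (simp add: less_imp_le)
    have "ennreal (jac_from n j y x') = ennreal (jac_from n (Suc j) y x) *
       ennreal (1 / s * (\<Prod>k\<in>J'. rho s k) * (1 + (\<Sum>i\<in>J'. y i * \<theta> i / (y i - s))))"
      unfolding jac ennreal_mult''[OF jnn] by (rule mult.commute)
    then show ?thesis
      using inter True by (simp add: gx x_def[symmetric] tau_eq Fstep_def \<theta>_def[symmetric] mult.assoc)
  qed
qed

text \<open>The substitution is \<open>\<theta> i = t i / rho s i\<close> for
  \<open>i \<in> J\<close>. Its factors cancel every \<open>rho\<close> of \<open>Fstep\<close>
  except \<open>rho s n\<close>, since the last coordinate is dependent and not an integration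
  variable. Extensionality of \<open>t\<close> makes both coordinate vectors
  \<open>undefined\<close> outside \<open>{j..n}\<close>.\<close>

lemma integrand_scale:
  assumes s: "y j < s" "s < y (Suc j)" and ext: "t \<in> extensional J"
  shows "ennreal (\<Prod>i\<in>J. 1 / rho s i) *
     simplex_integrand n (Suc j) (w * y j / s - 1) (Fstep s) (\<lambda>i\<in>J. 1 / rho s i * t i) = mixed s t"
proof -
  define t' where "t' = simplex_from n (Suc j) (w * y j / s - 1) (\<lambda>i\<in>J. 1 / rho s i * t i)"
  have ys: "y i > s" if "i \<in> J'" for i
    using that s y_less[of "Suc j" i] by (cases "i = Suc j") auto
  have rpos: "rho s i > 0" if "i \<in> J'" for i
    using ys[OF that] s by (simp add: rho_def)
  have t'i: "t' i = t i * (y i - y j) / (y i - s)" if "i \<in> J" for i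
    using that by (simp add: t'_def simplex_from_def rho_def)
  have t'n: "t' n = last_coord s t"
    unfolding t'_def simplex_from_def last_coord_def fun_upd_same
    by (intro arg_cong2[where f = "(-)"] sum.cong refl) (simp add: rho_def)
  have split: "J' = insert n J" using jn by auto
  have pos: "(\<forall>i\<in>J'. t' i > 0) \<longleftrightarrow> (\<forall>i\<in>J. t i > 0) \<and> last_coord s t > 0"
  proof -
    have "t' i > 0 \<longleftrightarrow> t i > 0" if "i \<in> J" for i
      using rpos[of i] that by (simp add: t'_def simplex_from_def zero_less_divide_iff)
    then show ?thesis unfolding split using t'n by auto
  qed
  have prod: "(\<Prod>i\<in>J. 1 / rho s i) * (1 / s * (\<Prod>k\<in>J'. rho s k) * c) = 1 / s * rho s n * c" for c
  proof -
    have "(\<Prod>i\<in>J. 1 / rho s i) * (\<Prod>i\<in>J. rho s i) = 1"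
      unfolding prod.distrib[symmetric] using rpos by (intro prod.neutral) force
    then show ?thesis unfolding split by (simp add: mult_ac)
  qed
  have wt: "(\<Sum>i\<in>J'. y i * t' i / (y i - s)) =
      (\<Sum>i\<in>J. y i * (t i * (y i - y j) / (y i - s)) / (y i - s)) + y n * last_coord s t / (y n - s)"
    unfolding split using t'n by (simp add: t'i)
  have tr: "t' k * rho s k = t k" if "k \<in> J" for k
    using that rpos[of k] by (simp add: t'_def simplex_from_def)
  have sum: "(\<Sum>k\<in>J'. t' k * rho s k) = rho s n * last_coord s t + (\<Sum>k\<in>J. t k)"
    unfolding split using t'n by (simp add: tr mult.commute)
  have simplex_coords: "(\<lambda>i\<in>{j..n}. if i = j then w - 1 - (\<Sum>k\<in>J'. t' k * rho s k) else t' i * rho s i) =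
    simplex_coords s t"
  proof
    fix i
    consider "i = j" | "i = n" "i \<noteq> j" | "i \<in> J" "i \<noteq> j" "i \<noteq> n" | "i \<notin> {j..n}" "i \<noteq> j" "i \<noteq> n" by fastforce
    then show "(\<lambda>i\<in>{j..n}. if i = j then w - 1 - (\<Sum>k\<in>J'. t' k * rho s k) else t' i * rho s i) i =
      simplex_coords s t i"
      using jn
    proof cases
      case 4
      then have "t i = undefined" by (intro extensional_arb[OF ext]) auto
      then show ?thesis using 4 by (auto simp: simplex_coords_def)
    qed (auto simp: simplex_coords_def sum t'n tr)
  qed
  have nn: "(\<Prod>i\<in>J. 1 / rho s i) \<ge> 0"
    using rpos by (intro prod_nonneg) (auto simp: less_imp_le)
  show ?thesis
  proof (cases "\<forall>i\<in>J'. t' i > 0")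
    case True
    then have "ennreal (\<Prod>i\<in>J. 1 / rho s i) * Fstep s t' = ennreal (jac_weight s t) * F (simplex_coords s t)"
      unfolding Fstep_def simplex_coords mult.assoc[symmetric] ennreal_mult'[OF nn, symmetric]
      by (simp only: mult.assoc prod[unfolded mult.assoc] wt jac_weight_def add.assoc)
    then show ?thesis unfolding Let_def t'_def[symmetric] mixed_def using True pos s by simp
  next
    case False
    then show ?thesis unfolding Let_def t'_def[symmetric] mixed_def using pos by auto
  qed
qed

text \<open>With the middle coordinates fixed, \<open>nn_integral_peel\<close> trades
  \<open>s\<close> for \<open>v\<close>, the simplex coordinate at \<open>j\<close>; the coordinate
  at \<open>n\<close> is then \<open>K - v\<close>.\<close>

lemma integral_over_last:
  assumes t: "t \<in> space (leb J)"
  shows "(\<integral>\<^sup>+s. mixed s t \<partial>lborel) =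
    (\<integral>\<^sup>+v. simplex_integrand n j (w - 1) F (t(j := v)) \<partial>lborel)"
proof -
  define K where "K = w - 1 - (\<Sum>i\<in>J. t i)"
  define H where "H v = F (t(j := v, n := K - v))" for v
  have simp: "simplex_from n j (w - 1) (t(j := v)) = t(j := v, n := K - v)" for v
    using jn by (auto simp: simplex_from_def K_def sum.atLeast_Suc_lessThan intro!: sum.cong)
  have split: "{j..n} = insert j (insert n J)" using jn by auto
  show ?thesis
  proof (cases "\<forall>i\<in>J. t i > 0")
    case False
    then show ?thesis
      using jn by (auto simp: mixed_def simp split Let_def intro!: nn_integral_cong)
  next
    case True
    have ypos': "y i > 0" if "i \<in> {j..n}" for i
      using that ypos y_less[of j i] by (cases "i = j") auto
    have H[measurable]: "H \<in> borel_measurable borel"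
    proof -
      have "(\<lambda>v. t(j := v, n := K - v)) \<in> borel \<rightarrow>\<^sub>M leb {j..n}"
      proof (rule measurable_fun_upd[where J = "{j..<n}"])
        show "(\<lambda>v. t(j := v)) \<in> borel \<rightarrow>\<^sub>M leb {j..<n}"
          by (rule measurable_fun_upd[where J = "J"]) (use t jn in auto)
      qed (use jn in auto)
      from measurable_compose[OF this F] show ?thesis by (simp add: H_def[abs_def])
    qed
    have "(\<integral>\<^sup>+s. (if y j < s \<and> s < y (Suc j) \<and> last_coord s t > 0 then
        ennreal (jac_weight s t) * H (K - rho s n * last_coord s t) else 0) \<partial>lborel) =
      (\<integral>\<^sup>+v. (if 0 < v \<and> v < K then H v else 0) \<partial>lborel)"
      unfolding jac_weight_def rho_def last_coord_def K_def
    proof (rule nn_integral_peel)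
      show "(J = {} \<and> y (Suc j) = y n) \<or> (\<exists>i\<in>J. y i = y (Suc j))"
        using jn by (cases "Suc j = n") auto
      show "y (Suc j) \<le> y i" if "i \<in> J" for i
        using that y_less[of "Suc j" i] by (cases "i = Suc j") auto
      show "y (Suc j) \<le> y n" using y_less[of "Suc j" n] jn by (cases "n = Suc j") auto
      show "y j < y (Suc j)" using y_less[of j "Suc j"] jn by auto
    qed (use True ypos w in auto)
    also have "(\<lambda>s. if y j < s \<and> s < y (Suc j) \<and> last_coord s t > 0 then
        ennreal (jac_weight s t) * H (K - rho s n * last_coord s t) else 0) = (\<lambda>s. mixed s t)"
      using True by (auto simp: mixed_def H_def simplex_coords_def K_def fun_eq_iff)
    also have "(\<lambda>v. if 0 < v \<and> v < K then H v else 0) =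
      (\<lambda>v. simplex_integrand n j (w - 1) F (t(j := v)))"
      using True jn by (auto simp: simp split H_def Let_def fun_eq_iff)
    finally show ?thesis .
  qed
qed

text \<open>Tonelli twice: with \<open>x j = s\<close> outermost, the induction hypothesis and a
  scaling lead to the mixed form; then \<open>s\<close> is moved innermost and replaced by the
  simplex coordinate at \<open>j\<close>.\<close>

lemma change_of_variables_step:
  assumes IH: "\<And>w F. w > 0 \<Longrightarrow> F \<in> borel_measurable (leb J') \<Longrightarrow>
    (\<integral>\<^sup>+u. jacobian_integrand n (Suc j) y w F u \<partial>leb J) =
    (\<integral>\<^sup>+t. simplex_integrand n (Suc j) (w - 1) F t \<partial>leb J)"
  shows "(\<integral>\<^sup>+u. jacobian_integrand n j y w F u \<partial>leb {j..<n}) =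
    (\<integral>\<^sup>+t. simplex_integrand n j (w - 1) F t \<partial>leb {j..<n})"
proof -
  interpret product_sigma_finite "\<lambda>_. lborel :: real measure" ..
  have ins: "{j..<n} = insert j J" using jn by auto
  let ?L = "\<lambda>u. jacobian_integrand n j y w F u"
  let ?R = "\<lambda>t. simplex_integrand n j (w - 1) F t"
  have L: "?L \<in> borel_measurable (leb {j..<n})" using jn F by (intro measurable_graph_integrand) auto
  have R: "?R \<in> borel_measurable (leb {j..<n})" using jn F by (intro measurable_simplex_integrand) auto
  have inner: "(\<integral>\<^sup>+u. ?L (u(j := s)) \<partial>leb J) = (\<integral>\<^sup>+t. mixed s t \<partial>leb J)" for s
  proof (cases "y j < s \<and> s < y (Suc j)")
    case False
    have "\<not> interlace_from n j y (graph_from n j y w (u(j := s)))" for u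
      using False jn by (subst interlace_from_Suc[OF jn]) (auto simp: graph_from_def)
    then show ?thesis using False by (auto simp: mixed_def Let_def intro!: nn_integral_cong)
  next
    case True
    then have s: "y j < s" "s < y (Suc j)" by auto
    have "s > 0" using s ypos by simp
    have rpos: "rho s i > 0" if "i \<in> J" for i
      using that s y_less[of "Suc j" i] by (cases "i = Suc j") (auto simp: rho_def)
    have "(\<integral>\<^sup>+u. ?L (u(j := s)) \<partial>leb J) = (\<integral>\<^sup>+t. simplex_integrand n (Suc j) (w * y j / s - 1) (Fstep s) t \<partial>leb J)"
      unfolding integrand_peel[OF s] using w ypos \<open>s > 0\<close> by (intro IH) auto
    also have "\<dots> = ennreal (\<Prod>i\<in>J. 1 / rho s i) * (\<integral>\<^sup>+t. simplex_integrand n (Suc j) (w * y j /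
      s - 1) (Fstep s) (\<lambda>i\<in>J. 1 / rho s i * t i) \<partial>leb J)"
      using rpos jn by (intro nn_integral_PiM_scale measurable_simplex_integrand) auto
    also have "\<dots> = (\<integral>\<^sup>+t. ennreal (\<Prod>i\<in>J. 1 / rho s i) * simplex_integrand n (Suc j) (w * y j /
      s - 1) (Fstep s) (\<lambda>i\<in>J. 1 / rho s i * t i) \<partial>leb J)"
    proof (rule nn_integral_cmult[symmetric])
      have "(\<lambda>t. \<lambda>i\<in>J. 1 / rho s i * t i) \<in> leb J \<rightarrow>\<^sub>M leb J"
        by measurable
      then show "(\<lambda>t. simplex_integrand n (Suc j) (w * y j / s - 1) (Fstep s) (\<lambda>i\<in>J. 1 / rho s i * t i)) \<in>
        borel_measurable (leb J)"
        by (rule measurable_compose) (use jn in \<open>intro measurable_simplex_integrand, auto\<close>)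
    qed
    also have "\<dots> = (\<integral>\<^sup>+t. mixed s t \<partial>leb J)"
      by (intro nn_integral_cong integrand_scale s) (auto simp: space_PiM PiE_def)
    finally show ?thesis .
  qed
  have "(\<integral>\<^sup>+u. ?L u \<partial>leb {j..<n}) = (\<integral>\<^sup>+s. (\<integral>\<^sup>+u. ?L (u(j := s)) \<partial>leb J) \<partial>lborel)"
    unfolding ins by (rule product_nn_integral_insert_rev) (use L ins in auto)
  also have "\<dots> = (\<integral>\<^sup>+s. (\<integral>\<^sup>+t. mixed ((t(j := s)) j) (t(j := s)) \<partial>leb J) \<partial>lborel)"
    unfolding inner by (simp add: mixed_upd)
  also have "\<dots> = (\<integral>\<^sup>+v. mixed (v j) v \<partial>leb {j..<n})"
    unfolding ins by (rule product_nn_integral_insert_rev[symmetric]) (use mixed_measurable ins in auto)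
  also have "\<dots> = (\<integral>\<^sup>+t. (\<integral>\<^sup>+s. mixed ((t(j := s)) j) (t(j := s)) \<partial>lborel) \<partial>leb J)"
    unfolding ins by (rule product_nn_integral_insert) (use mixed_measurable ins in auto)
  also have "\<dots> = (\<integral>\<^sup>+t. (\<integral>\<^sup>+v. ?R (t(j := v)) \<partial>lborel) \<partial>leb J)"
    unfolding mixed_upd fun_upd_same by (rule nn_integral_cong) (rule integral_over_last)
  also have "\<dots> = (\<integral>\<^sup>+t. ?R t \<partial>leb {j..<n})"
    unfolding ins by (rule product_nn_integral_insert[symmetric]) (use R ins in auto)
  finally show ?thesis .
qed

end

text \<open>Downward induction on \<open>j\<close>; \<open>w\<close> and \<open>F\<close> are
  generalised because the step calls the hypothesis with \<open>w * y j / s\<close> and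
  \<open>Fstep s\<close>.\<close>

theorem change_of_variables:
  assumes "j \<le> n" and "0 < y j" and "strict_mono_on {j..n} y" and "w > 0"
    and "F \<in> borel_measurable (leb {j..n})"
  shows "(\<integral>\<^sup>+u. jacobian_integrand n j y w F u \<partial>leb {j..<n}) =
    (\<integral>\<^sup>+t. simplex_integrand n j (w - 1) F t \<partial>leb {j..<n})"
  using assms
proof (induction j arbitrary: w F rule: inc_induct)
  case base
  then show ?case by (intro change_of_variables_base) auto
next
  case (step j)
  have "y j < y (Suc j)" using step by (intro strict_mono_onD[OF step.prems(2)]) auto
  then have "0 < y (Suc j)" "strict_mono_on {Suc j..n} y"
    using step.prems by (auto simp: strict_mono_on_def)
  note y = this
  show ?case
  proof (rule change_of_variables_step)
    fix w' :: real and F' :: "(nat \<Rightarrow> real) \<Rightarrow> ennreal" assume "w' > 0" "F' \<in> borel_measurable (leb {Suc j..n})"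
    then show "(\<integral>\<^sup>+u. jacobian_integrand n (Suc j) y w' F' u \<partial>leb {Suc j..<n}) =
      (\<integral>\<^sup>+t. simplex_integrand n (Suc j) (w' - 1) F' t \<partial>leb {Suc j..<n})"
      by (rule step.IH[OF y])
  qed (use step in auto)
qed

section \<open>Dirichlet integrals\<close>

lemma nn_integral_Beta_scaled:
  fixes a b w :: real
  assumes "a > 0" "b > 0" "w > 0"
  shows "(\<integral>\<^sup>+v. (if 0 < v \<and> v < w then ennreal (v powr (a - 1) * (w - v) powr (b - 1)) else 0) \<partial>lborel) =
    ennreal (w powr (a + b - 1) * Beta a b)"
proof -
  have "((\<lambda>t. t powr (a - 1) * (1 - t) powr (b - 1)) has_integral Beta a b) {0<..<1}"
    using has_integral_Beta_real[of a b] assms by (simp add: has_integral_Icc_iff_Ioo)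
  from nn_integral_has_integral_lebesgue[OF _ this]
  have 1: "(\<integral>\<^sup>+t. ennreal (indicator {0<..<1} t * (t powr (a - 1) * (1 - t) powr (b - 1))) \<partial>lborel) =
    ennreal (Beta a b)"
    by simp
  have "(\<integral>\<^sup>+v. (if 0 < v \<and> v < w then ennreal (v powr (a - 1) * (w - v) powr (b - 1)) else 0) \<partial>lborel) =
    ennreal w * (\<integral>\<^sup>+t. (if 0 < 0 + w * t \<and> 0 + w * t < w then
       ennreal ((0 + w * t) powr (a - 1) * (w - (0 + w * t)) powr (b - 1)) else 0) \<partial>lborel)"
    using assms by (subst nn_integral_real_affine[where c = w and t = 0]) auto
  also have "\<dots> = ennreal w * (\<integral>\<^sup>+t. ennreal (w powr (a + b - 2)) *
      ennreal (indicator {0<..<1} t * (t powr (a - 1) * (1 - t) powr (b - 1))) \<partial>lborel)"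
  proof (intro arg_cong2[where f = "(*)"] refl nn_integral_cong)
    fix t :: real
    have 2: "(w * t) powr (a - 1) * (w - w * t) powr (b - 1) =
        w powr (a + b - 2) * (t powr (a - 1) * (1 - t) powr (b - 1))" if "0 < t" "t < 1"
    proof -
      have "w - w * t = w * (1 - t)" by (simp add: algebra_simps)
      moreover have "w powr (a + b - 2) = w powr (a - 1) * w powr (b - 1)"
        by (simp add: powr_add[symmetric])
      ultimately show ?thesis using that assms by (simp add: powr_mult)
    qed
    show "(if 0 < 0 + w * t \<and> 0 + w * t < w then
       ennreal ((0 + w * t) powr (a - 1) * (w - (0 + w * t)) powr (b - 1)) else 0) =
       ennreal (w powr (a + b - 2)) * ennreal (indicator {0<..<1} t * (t powr (a - 1) * (1 - t) powr (b - 1)))"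
      using assms 2 by (auto simp: indicator_def zero_less_mult_iff ennreal_mult'[symmetric])
  qed
  also have "\<dots> = ennreal (w * w powr (a + b - 2) * Beta a b)"
  proof -
    have "Beta a b \<ge> 0" using assms by (simp add: Beta_def Gamma_real_pos less_imp_le)
    then show ?thesis using assms
      by (subst nn_integral_cmult) (simp_all only: 1 borel_measurable_indicator, auto simp: ennreal_mult' mult.assoc)
  qed
  also have "w * w powr (a + b - 2) = w powr (a + b - 1)"
    using assms powr_mult_base[of w "a + b - 2"] by simp
  finally show ?thesis .
qed

text \<open>The powers of partial sums are what the binomial expansion of the leading coefficient
  produces. They are built in from the start because a partial sum is the size of a
  lower-dimensional simplex, so its powers pass through the induction on the dimension.\<close>

definition dirichlet_weight :: "nat \<Rightarrow> (nat \<Rightarrow> real) \<Rightarrow> (nat \<Rightarrow> nat) \<Rightarrow> (nat \<Rightarrow> real) \<Rightarrow> real" where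
  "dirichlet_weight n s m t = (\<Prod>i\<in>{1..n}. t i powr (s i - 1)) * (\<Prod>k\<in>{1..<n}. (\<Sum>i\<in>{1..k}. t i) ^ m k)"

text \<open>One Beta factor for each partial sum: its first argument is one more than the power of
  \<open>t 1 + ... + t k\<close> left by the inner integrals. With \<open>m = 0\<close> the product
  telescopes to the Dirichlet normalisation.\<close>

definition dirichlet_value :: "nat \<Rightarrow> (nat \<Rightarrow> real) \<Rightarrow> (nat \<Rightarrow> nat) \<Rightarrow> real" where
  "dirichlet_value n s m = (\<Prod>k\<in>{1..<n}. Beta ((\<Sum>i\<in>{1..k}. s i) + (\<Sum>i\<in>{1..k}. real (m i))) (s (Suc k)))"

lemma dirichlet_weight_measurable [measurable]:
  "dirichlet_weight n s m \<in> borel_measurable (leb {1..n})"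
proof -
  have "(\<lambda>t. \<Sum>i\<in>{1..k}. t i) \<in> borel_measurable (leb {1..n})" if "k \<in> {1..<n}" for k
    using that by (intro borel_measurable_sum measurable_component_singleton[of _ "{1..n}" "\<lambda>_. lborel",
      simplified]) auto
  then show ?thesis unfolding dirichlet_weight_def[abs_def] by measurable
qed

lemma dirichlet_value_nonneg:
  assumes "\<And>i. s i > 0"
  shows "dirichlet_value n s m \<ge> 0"
  unfolding dirichlet_value_def
proof (intro prod_nonneg ballI)
  fix k assume "k \<in> {1..<n}"
  then have "(\<Sum>i\<in>{1..k}. s i) + (\<Sum>i\<in>{1..k}. real (m i)) > 0"
    using assms by (intro add_pos_nonneg sum_pos sum_nonneg) auto
  then show "0 \<le> Beta ((\<Sum>i\<in>{1..k}. s i) + (\<Sum>i\<in>{1..k}. real (m i))) (s (Suc k))"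
    using assms by (simp add: Beta_def Gamma_real_pos less_imp_le add_pos_pos)
qed

text \<open>The last free coordinate is replaced by the partial sum
  \<open>v = t 1 + ... + t n\<close>. At fixed \<open>v\<close> the others range over a simplex of
  size \<open>v\<close>, handled by the induction hypothesis, and what remains in \<open>v\<close>
  is a single Beta integral.\<close>

lemma dirichlet_nn_integral:
  assumes "n \<ge> 1" "w > 0" and s: "\<And>i. s i > 0"
  shows "(\<integral>\<^sup>+t. simplex_integrand n 1 w (\<lambda>t. ennreal (dirichlet_weight n s m t)) t \<partial>leb {1..<n}) =
    ennreal (w powr ((\<Sum>i\<in>{1..n}. s i) + (\<Sum>i\<in>{1..<n}. real (m i)) - 1) * dirichlet_value n s m)"
  using assms(1,2)
proof (induction n arbitrary: w rule: dec_induct)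
  case base
  have "{1..<1 :: nat} = {}" by simp
  then show ?case
    unfolding nn_integral_PiM_empty \<open>{1..<1 :: nat} = {}\<close> using base
    by (simp add: Let_def simplex_from_def dirichlet_weight_def dirichlet_value_def)
next
  case (step n)
  interpret product_sigma_finite "\<lambda>_. lborel :: real measure" ..
  have ins: "{1..<Suc n} = insert n {1..<n}" using step by auto
  have ins': "{1..n} = {1..<Suc n}" by auto
  define f where "f u = (let t' = simplex_from (Suc n) 1 w u in
      if \<forall>i\<in>{1..Suc n}. t' i > 0 then ennreal (dirichlet_weight (Suc n) s m t') else 0)" for u
  \<comment> \<open>In \<open>h\<close> slot \<open>n\<close> holds the partial sum \<open>v\<close>
    instead of \<open>t n\<close>; the passage is a translation, hence measure preserving.\<close>
  define h where "h u = f (u(n := u n - (\<Sum>i\<in>{1..<n}. u i)))" for u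
  have fm: "f \<in> borel_measurable (leb {1..<Suc n})"
    unfolding f_def[abs_def]
    by (rule measurable_simplex_integrand) (simp_all del: One_nat_def add: measurable_compose[OF
      dirichlet_weight_measurable])
  have hm: "h \<in> borel_measurable (leb {1..<Suc n})"
  proof -
    have c: "(\<lambda>v. v i) \<in> borel_measurable (leb {1..<Suc n})" if "i \<in> {1..<Suc n}" for i
      using that measurable_component_singleton[of i "{1..<Suc n}" "\<lambda>_. lborel :: real measure"] by simp
    have "(\<lambda>u. u(n := u n - (\<Sum>i\<in>{1..<n}. u i))) \<in> leb {1..<Suc n} \<rightarrow>\<^sub>M leb {1..<Suc n}"
      by (rule measurable_fun_upd[where J = "{1..<Suc n}"])
         (use step in \<open>auto intro!: borel_measurable_diff borel_measurable_sum c\<close>)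
    from measurable_compose[OF this fm] show ?thesis by (simp add: h_def[abs_def])
  qed
  define A where "A = (\<Sum>i\<in>{1..n}. s i) + (\<Sum>i\<in>{1..n}. real (m i))"
  have A: "A > 0" unfolding A_def using s step by (intro add_pos_nonneg sum_pos sum_nonneg) auto
  have inner: "(\<integral>\<^sup>+t. h (t(n := v)) \<partial>leb {1..<n}) =
     (if 0 < v \<and> v < w then ennreal (v powr (A - 1) * (w - v) powr (s (Suc n) - 1)) else 0) *
     ennreal (dirichlet_value n s m)" for v
  proof -
    have eq: "h (t(n := v)) = (if v < w then ennreal ((w - v) powr (s (Suc n) - 1) * v ^ m n) else 0) *
      simplex_integrand n 1 v (\<lambda>t. ennreal (dirichlet_weight n s m t)) t" for t
    proof -
      define t' where "t' = simplex_from n 1 v t"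
      have 1: "(t(n := v))(n := (t(n := v)) n - (\<Sum>i\<in>{1..<n}. (t(n := v)) i)) = t'"
        by (auto simp: t'_def simplex_from_def intro!: sum.cong)
      have sv: "(\<Sum>i\<in>{1..n}. t' i) = v"
        unfolding ins' ins by (simp add: t'_def simplex_from_def)
      have 2: "simplex_from (Suc n) 1 w t' = t'(Suc n := w - v)"
        unfolding simplex_from_def ins'[symmetric] sv ..
      have 3: "dirichlet_weight (Suc n) s m (t'(Suc n := w - v)) =
         ((w - v) powr (s (Suc n) - 1) * v ^ m n) * dirichlet_weight n s m t'"
      proof -
        have "(\<Prod>k\<in>{1..<Suc n}. (\<Sum>i\<in>{1..k}. (t'(Suc n := w - v)) i) ^ m k) =
            (\<Prod>k\<in>{1..<Suc n}. (\<Sum>i\<in>{1..k}. t' i) ^ m k)"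
          by (intro prod.cong refl arg_cong2[where f = power] sum.cong) auto
        also have "\<dots> = v ^ m n * (\<Prod>k\<in>{1..<n}. (\<Sum>i\<in>{1..k}. t' i) ^ m k)"
          unfolding ins using sv by simp
        finally show ?thesis
          by (simp add: dirichlet_weight_def)
      qed
      have 4: "(\<forall>i\<in>{1..Suc n}. (t'(Suc n := w - v)) i > 0) \<longleftrightarrow> v < w \<and> (\<forall>i\<in>{1..n}. t' i > 0)"
        by (auto simp: atLeastAtMostSuc_conv)
      have 5: "v \<ge> 0" if "\<forall>i\<in>{1..n}. t' i > 0"
        using that sv by (metis less_imp_le sum_nonneg)
      show ?thesis
        unfolding h_def f_def 1 2 3 Let_def t'_def[symmetric] 4 using 5
        by (auto simp: ennreal_mult')
    qed
    show ?thesis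
    proof (cases "0 < v")
      case True
      have "(\<integral>\<^sup>+t. h (t(n := v)) \<partial>leb {1..<n}) =
        (if v < w then ennreal ((w - v) powr (s (Suc n) - 1) * v ^ m n) else 0) *
         ennreal (v powr ((\<Sum>i\<in>{1..n}. s i) + (\<Sum>i\<in>{1..<n}. real (m i)) - 1) * dirichlet_value n s m)"
        unfolding eq using step.hyps
      proof (subst nn_integral_cmult)
        show "(\<lambda>t. simplex_integrand n 1 v (\<lambda>t. ennreal (dirichlet_weight n s m t)) t) \<in>
          borel_measurable (leb {1..<n})"
          using step.hyps by (intro measurable_simplex_integrand)
            (simp_all del: One_nat_def add: measurable_compose[OF dirichlet_weight_measurable])
      qed (simp only: step.IH[OF True])
      also have "\<dots> = (if 0 < v \<and> v < w then ennreal (v powr (A - 1) * (w - v) powr (s (Suc n) - 1)) else 0) *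
          ennreal (dirichlet_value n s m)"
      proof -
        have "(\<Sum>i\<in>{1..n}. real (m i)) = real (m n) + (\<Sum>i\<in>{1..<n}. real (m i))"
          unfolding ins' ins by simp
        then have "v powr (A - 1) = v ^ m n * v powr ((\<Sum>i\<in>{1..n}. s i) + (\<Sum>i\<in>{1..<n}. real (m i)) - 1)"
          using True by (simp add: A_def powr_realpow[symmetric] powr_add[symmetric] add_ac add_diff_eq)
        then show ?thesis using True dirichlet_value_nonneg[of s n m, OF s]
          by (simp add: ennreal_mult[symmetric] mult_ac)
      qed
      finally show ?thesis .
    next
      case False
      \<comment> \<open>For \<open>v \<le> 0\<close> the region is empty, since positive coordinates
        cannot sum to \<open>v\<close>.\<close>
      have neg: "(\<forall>i\<in>{1..n}. simplex_from n 1 v t i > 0) = False" for t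
      unfolding eq_False
      proof
        assume *: "\<forall>i\<in>{1..n}. simplex_from n 1 v t i > 0"
        have "(\<Sum>i\<in>{1..n}. simplex_from n 1 v t i) = v"
          unfolding ins' ins by (simp add: simplex_from_def)
        moreover have "(\<Sum>i\<in>{1..n}. simplex_from n 1 v t i) > 0"
          using * step.hyps by (intro sum_pos) auto
        ultimately show False using False by simp
      qed
      show ?thesis unfolding eq Let_def neg using False by simp
    qed
  qed
  have "(\<integral>\<^sup>+u. f u \<partial>leb {1..<Suc n}) = (\<integral>\<^sup>+t. (\<integral>\<^sup>+r. f (t(n := r)) \<partial>lborel) \<partial>leb {1..<n})"
    unfolding ins by (rule product_nn_integral_insert) (use fm ins in auto)
  also have "\<dots> = (\<integral>\<^sup>+t. (\<integral>\<^sup>+v. h (t(n := v)) \<partial>lborel) \<partial>leb {1..<n})"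
  proof (rule nn_integral_cong)
    fix t assume t: "t \<in> space (leb {1..<n})"
    have "(\<lambda>r. t(n := r)) \<in> borel \<rightarrow>\<^sub>M leb {1..<Suc n}"
      by (rule measurable_fun_upd[where J = "{1..<n}"]) (use t ins in auto)
    from measurable_compose[OF this fm] have "(\<lambda>r. f (t(n := r))) \<in> borel_measurable borel" .
    then have "(\<integral>\<^sup>+r. f (t(n := r)) \<partial>lborel) =
       ennreal \<bar>1\<bar> * (\<integral>\<^sup>+v. f (t(n := - (\<Sum>i\<in>{1..<n}. t i) + 1 * v)) \<partial>lborel)"
      by (rule nn_integral_real_affine) simp
    also have "\<dots> = (\<integral>\<^sup>+v. h (t(n := v)) \<partial>lborel)"
      by (simp add: h_def)
    finally show "(\<integral>\<^sup>+r. f (t(n := r)) \<partial>lborel) = (\<integral>\<^sup>+v. h (t(n := v)) \<partial>lborel)" .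
  qed
  also have "\<dots> = (\<integral>\<^sup>+u. h u \<partial>leb {1..<Suc n})"
    unfolding ins by (rule product_nn_integral_insert[symmetric]) (use hm ins in auto)
  also have "\<dots> = (\<integral>\<^sup>+v. (\<integral>\<^sup>+t. h (t(n := v)) \<partial>leb {1..<n}) \<partial>lborel)"
    unfolding ins by (rule product_nn_integral_insert_rev) (use hm ins in auto)
  also have "\<dots> = ennreal (w powr (A + s (Suc n) - 1) * Beta A (s (Suc n))) * ennreal (dirichlet_value n s m)"
    unfolding inner using nn_integral_Beta_scaled[OF A s step.prems] by (subst nn_integral_multc) auto
  also have "\<dots> = ennreal (w powr ((\<Sum>i\<in>{1..Suc n}. s i) + (\<Sum>i\<in>{1..<Suc n}. real (m i)) - 1) *
    dirichlet_value (Suc n) s m)"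
  proof -
    have e1: "dirichlet_value (Suc n) s m = Beta A (s (Suc n)) * dirichlet_value n s m"
      unfolding dirichlet_value_def ins by (simp add: A_def)
    have e2: "Beta A (s (Suc n)) > 0" using A s[of "Suc n"] by (simp add: Beta_def Gamma_real_pos add_pos_pos)
    have e3: "(\<Sum>i\<in>{1..Suc n}. s i) + (\<Sum>i\<in>{1..<Suc n}. real (m i)) = A + s (Suc n)"
      unfolding A_def ins'[symmetric] by simp
    show ?thesis
      unfolding e1 e3 using e2 dirichlet_value_nonneg[of s n m, OF s]
      by (simp add: ennreal_mult''[symmetric] mult.assoc)
  qed
  finally show ?case by (simp add: f_def)
qed

lemma dirichlet_value_powers:
  assumes s: "\<And>i. s i > 0" and "n \<ge> 1"
  shows "dirichlet_value n s (\<lambda>_. 0) = (\<Prod>i\<in>{1..n}. Gamma (s i)) / Gamma (\<Sum>i\<in>{1..n}. s i)"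
  using assms(2)
proof (induction n rule: dec_induct)
  case base
  have "Gamma (s 1) \<noteq> 0" using s[of 1] Gamma_real_pos by (metis less_irrefl)
  then show ?case by (simp add: dirichlet_value_def)
next
  case (step n)
  have "(\<Sum>i\<in>{1..n}. s i) > 0" using s step by (intro sum_pos) auto
  then have "Gamma (\<Sum>i\<in>{1..n}. s i) \<noteq> 0" using Gamma_real_pos by (metis less_irrefl)
  moreover have "dirichlet_value (Suc n) s (\<lambda>_. 0) = Beta (\<Sum>i\<in>{1..n}. s i) (s (Suc n)) * dirichlet_value n s (\<lambda>_. 0)"
    using step.hyps by (simp add: dirichlet_value_def prod.atLeastLessThan_Suc mult.commute)
  ultimately show ?case using step by (simp add: Beta_def)
qed

lemma dirichlet_has_integral:
  assumes "n \<ge> 1" "w > 0" and s: "\<And>i. s i > 0"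
  shows "has_bochner_integral (leb {1..<n}) (\<lambda>t. simplex_integrand n 1 w (dirichlet_weight n s m) t)
    (w powr ((\<Sum>i\<in>{1..n}. s i) + (\<Sum>i\<in>{1..<n}. real (m i)) - 1) * dirichlet_value n s m)"
proof (rule has_bochner_integral_nn_integral)
  let ?f = "\<lambda>t. simplex_integrand n 1 w (dirichlet_weight n s m) t"
  have "(\<lambda>t. if \<forall>i\<in>{1..n}. t i > 0 then dirichlet_weight n s m t else 0) \<in> borel_measurable (leb {1..n})"
    by measurable
  from measurable_compose[OF measurable_simplex_from[OF assms(1)] this]
  show "?f \<in> borel_measurable (leb {1..<n})" by (simp add: Let_def del: One_nat_def)
  have nn: "dirichlet_weight n s m t \<ge> 0" if "\<forall>i\<in>{1..n}. t i > 0" for t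
    unfolding dirichlet_weight_def using that
    by (intro mult_nonneg_nonneg prod_nonneg ballI zero_le_power sum_nonneg) (auto simp: less_imp_le)
  then show "AE t in leb {1..<n}. 0 \<le> ?f t" by (simp add: Let_def)
  have "(\<integral>\<^sup>+t. ennreal (?f t) \<partial>leb {1..<n}) = (\<integral>\<^sup>+t. simplex_integrand n 1 w (\<lambda>t. ennreal (dirichlet_weight n s
    m t)) t \<partial>leb {1..<n})"
    by (intro nn_integral_cong) (simp add: Let_def)
  then show "(\<integral>\<^sup>+t. ennreal (?f t) \<partial>leb {1..<n}) =
      ennreal (w powr ((\<Sum>i\<in>{1..n}. s i) + (\<Sum>i\<in>{1..<n}. real (m i)) - 1) * dirichlet_value n s m)"
    using dirichlet_nn_integral[OF assms] by simp
  show "0 \<le> w powr ((\<Sum>i\<in>{1..n}. s i) + (\<Sum>i\<in>{1..<n}. real (m i)) - 1) * dirichlet_value n s m"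
    using dirichlet_value_nonneg[OF s] by simp
qed

section \<open>Polynomials in several variables\<close>

abbreviation "lk \<equiv> Poly_Mapping.lookup"
abbreviation "ks \<equiv> Poly_Mapping.keys"
abbreviation "permuted \<equiv> Poly_Mapping.map_key"
abbreviation "sng \<equiv> Poly_Mapping.single"

definition monom_eval :: "(nat \<Rightarrow>\<^sub>0 nat) \<Rightarrow> (nat \<Rightarrow> 'a::comm_semiring_1) \<Rightarrow> 'a" where
  "monom_eval m x = (\<Prod>i\<in>ks m. x i ^ lk m i)"

lemma monom_eval_superset:
  assumes "finite S" "ks m \<subseteq> S"
  shows "monom_eval m x = (\<Prod>i\<in>S. x i ^ lk m i)"
  unfolding monom_eval_def using assms
  by (intro prod.mono_neutral_left) (auto simp: in_keys_iff)

lemma eval_mpoly_superset: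
  assumes "finite S" "ks p \<subseteq> S"
  shows "eval_mpoly p x = (\<Sum>m\<in>S. lk p m * monom_eval m x)"
  unfolding eval_mpoly_def monom_eval_def using assms
  by (intro sum.mono_neutral_left) (auto simp: in_keys_iff)

lemma eval_mpoly_single: "eval_mpoly (sng m c) x = c * monom_eval m x"
  using eval_mpoly_superset[of "{m}" "sng m c" x] by (simp split: if_splits)

lemma eval_mpoly_zero [simp]: "eval_mpoly 0 x = 0"
  by (simp add: eval_mpoly_def)

lemma eval_mpoly_add: "eval_mpoly (p + q) x = eval_mpoly p x + eval_mpoly q x"
proof -
  have "ks (p + q) \<subseteq> ks p \<union> ks q" by (rule keys_add)
  then show ?thesis
    by (simp add: eval_mpoly_superset[of "ks p \<union> ks q"] lookup_add sum.distrib algebra_simps)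
qed

lemma eval_mpoly_sum: "eval_mpoly (\<Sum>a\<in>A. f a) x = (\<Sum>a\<in>A. eval_mpoly (f a) x)"
  by (induction A rule: infinite_finite_induct) (auto simp: eval_mpoly_add)

lemma lookup_Const_mult:
  fixes c :: "'a::comm_ring_1"
  shows "lk (Const c * p) m = c * lk p m"
  unfolding Const_def mult_map_scale_conv_mult[symmetric] by (simp add: map.rep_eq when_def)

lemma eval_mpoly_Const_mult:
  fixes c :: "'a::comm_ring_1"
  shows "eval_mpoly (Const c * p) x = c * eval_mpoly p x"
proof -
  have "ks (Const c * p) \<subseteq> ks p" by (auto simp: in_keys_iff lookup_Const_mult)
  then show ?thesis
    by (simp add: eval_mpoly_superset[of "ks p"] lookup_Const_mult sum_distrib_left mult.assoc)
qed

lemma lookup_map_key_permutes: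
  assumes "s permutes A"
  shows "lk (permuted s m) i = lk m (s i)"
  using permutes_inj[OF assms] by (simp add: map_key.rep_eq)

lemma lookup_outside:
  assumes "ks m \<subseteq> S" "i \<notin> S"
  shows "lk m i = 0"
  using assms by (meson in_keys_iff subsetD)

lemma map_key_permutes_inv:
  assumes "s permutes A"
  shows "permuted s (permuted (inv s) m) = m"
    and "permuted (inv s) (permuted s m) = m"
  using assms permutes_inv[OF assms]
  by (auto intro!: poly_mapping_eqI simp: lookup_map_key_permutes permutes_inverses)

section \<open>Polynomials vanishing at ordered points\<close>

text \<open>Remainders modulo \<open>B\<close> give the lowest digit. This separates exponent
  vectors in the Kronecker substitution below.\<close>

lemma digits_inj:
  fixes a b :: "nat \<Rightarrow> nat"
  assumes "\<And>i. i < n \<Longrightarrow> a i < B" "\<And>i. i < n \<Longrightarrow> b i < B"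
    and "(\<Sum>i<n. a i * B ^ i) = (\<Sum>i<n. b i * B ^ i)" and "i < n"
  shows "a i = b i"
  using assms
proof (induction n arbitrary: a b i)
  case (Suc n)
  have *: "(\<Sum>i<Suc n. c i * B ^ i) = c 0 + B * (\<Sum>i<n. c (Suc i) * B ^ i)" for c
    by (subst sum.lessThan_Suc_shift) (simp add: sum_distrib_left mult_ac)
  have eq: "a 0 + B * (\<Sum>i<n. a (Suc i) * B ^ i) = b 0 + B * (\<Sum>i<n. b (Suc i) * B ^ i)"
    using Suc.prems(3) unfolding * .
  have a0: "a 0 < B" "b 0 < B" using Suc.prems by auto
  then have 0: "a 0 = b 0" using eq by (metis mod_mult_self2 mod_less)
  then have "(\<Sum>i<n. a (Suc i) * B ^ i) = (\<Sum>i<n. b (Suc i) * B ^ i)" using eq a0 by simp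
  then have "a (Suc i) = b (Suc i)" if "i < n" for i
    using Suc.prems(1,2) that Suc.IH[of "\<lambda>i. a (Suc i)" "\<lambda>i. b (Suc i)" i] by simp
  then show ?case using 0 Suc.prems(4) by (cases i) auto
qed simp

text \<open>Kronecker substitution: along \<open>y i = \<tau> ^ (D ^ (i - 1))\<close> distinct
  exponent vectors become distinct powers of \<tau>, and each \<tau> > 1 gives an ordered point, so
  a polynomial in one variable has infinitely many zeros.\<close>

lemma eval_mpoly_ordered_eq_0:
  fixes p :: "complex mpoly"
  assumes keys: "\<And>m. m \<in> ks p \<Longrightarrow> ks m \<subseteq> {1..n}"
    and zero: "\<And>y. ordered_point n y \<Longrightarrow> eval_mpoly p (\<lambda>i. of_real (y i)) = 0"
  shows "p = 0"
proof -
  define D where "D = Suc (Max (insert 1 ((\<lambda>(m, i). lk m i) ` (ks p \<times> {1..n}))))"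
  have D: "lk m i < D" if "m \<in> ks p" for m i
  proof (cases "i \<in> {1..n}")
    case True
    have "lk m i \<le> Max (insert 1 ((\<lambda>(m, i). lk m i) ` (ks p \<times> {1..n})))"
      using that True by (intro Max_ge) (auto intro!: image_eqI[of _ _ "(m, i)"])
    then show ?thesis by (simp add: D_def)
  next
    case False
    then have "lk m i = 0" by (rule lookup_outside[OF keys[OF that]])
    then show ?thesis by (simp add: D_def)
  qed
  have "D \<ge> 2"
  proof -
    have "1 \<le> Max (insert 1 ((\<lambda>(m, i). lk m i) ` (ks p \<times> {1..n})))" by (intro Max_ge) auto
    then show ?thesis by (simp add: D_def)
  qed
  define e where "e m = (\<Sum>i<n. lk m (Suc i) * D ^ i)" for m
  have inj: "inj_on e (ks p)"
  proof (rule inj_onI, rule poly_mapping_eqI)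
    fix m m' i assume m: "m \<in> ks p" "m' \<in> ks p" "e m = e m'"
    show "lk m i = lk m' i"
    proof (cases "i \<in> {1..n}")
      case True
      then show ?thesis
        using digits_inj[of n "\<lambda>i. lk m (Suc i)" D "\<lambda>i. lk m' (Suc i)" "i - 1"] m D by (auto simp: e_def)
    next
      case False
      then show ?thesis using lookup_outside[OF keys[OF m(1)] False] lookup_outside[OF keys[OF m(2)] False] by simp
    qed
  qed
  define f where "f = (\<Sum>m\<in>ks p. monom (lk p m) (e m))"
  have "poly f (of_real \<tau>) = 0" if "\<tau> > 1" for \<tau> :: real
  proof -
    define y where "y i = \<tau> ^ (D ^ (i - 1))" for i
    have "ordered_point n y"
      unfolding ordered_point_def
    proof (intro conjI ballI)
      show "0 < y 1" using that by (simp add: y_def)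
      fix i assume "i \<in> {1..<n}"
      then have "D ^ (i - 1) < D ^ i" using \<open>D \<ge> 2\<close> by (intro power_strict_increasing) auto
      then show "y i < y (i + 1)" using that by (simp add: y_def)
    qed
    then have "0 = eval_mpoly p (\<lambda>i. of_real (y i))" using zero by simp
    also have "\<dots> = (\<Sum>m\<in>ks p. lk p m * monom_eval m (\<lambda>i. of_real (y i)))"
      by (intro eval_mpoly_superset) auto
    also have "\<dots> = (\<Sum>m\<in>ks p. lk p m * of_real \<tau> ^ e m)"
    proof (intro sum.cong refl)
      fix m assume m: "m \<in> ks p"
      have "monom_eval m (\<lambda>i. complex_of_real (y i)) = (\<Prod>i\<in>{1..n}. of_real (y i) ^ lk m i)"
        using keys[OF m] by (intro monom_eval_superset) auto
      also have "\<dots> = (\<Prod>i<n. of_real (y (Suc i)) ^ lk m (Suc i))"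
        by (rule prod.reindex_bij_witness[of _ Suc "\<lambda>i. i - 1"]) auto
      also have "\<dots> = of_real \<tau> ^ e m"
        unfolding e_def y_def by (simp add: power_sum power_mult mult.commute)
      finally show "lk p m * monom_eval m (\<lambda>i. complex_of_real (y i)) = lk p m * of_real \<tau> ^ e m" by simp
    qed
    finally show ?thesis by (simp add: f_def poly_sum poly_monom)
  qed
  then have "of_real ` {1<..} \<subseteq> {x. poly f x = 0}" by auto
  moreover have "infinite (complex_of_real ` {1<..})"
    using finite_imageD[of complex_of_real "{1<..}"] infinite_Ioi by (auto simp: inj_on_def)
  ultimately have "f = 0" using poly_roots_finite finite_subset by blast
  have "lk p m = 0" for m
  proof (cases "m \<in> ks p")
    case True
    have "coeff f (e m) = (\<Sum>m'\<in>ks p. if m' = m then lk p m else 0)"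
      unfolding f_def coeff_sum using inj True by (intro sum.cong) (auto simp: inj_on_def)
    then show ?thesis using True \<open>f = 0\<close> by simp
  qed (simp add: in_keys_iff)
  then show ?thesis by (intro poly_mapping_eqI) simp
qed

section \<open>Dominance and products of elementary symmetric polynomials\<close>

text \<open>A numerical rank that strictly increases along the dominance order. Maximising it picks
  dominance-maximal elements without a recursion on that partial order.\<close>

definition partial_sums :: "nat \<Rightarrow> (nat \<Rightarrow>\<^sub>0 nat) \<Rightarrow> nat" where
  "partial_sums n m = (\<Sum>k\<in>{1..n}. \<Sum>j\<in>{1..k}. lk m j)"

lemma dominated_le:
  assumes "dominated n mu nu" "k \<in> {1..n}"
  shows "(\<Sum>j=1..k. lk mu j) \<le> (\<Sum>j=1..k. lk nu j)"
proof (cases "k = n")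
  case True
  then show ?thesis using assms(1) unfolding dominated_def by simp
next
  case False
  then have "k \<in> {1..<n}" using assms(2) by auto
  then show ?thesis using assms(1) unfolding dominated_def by blast
qed

text \<open>A single strict inequality among the partial sums would order the ranks strictly; equal
  partial sums determine the entries by differences.\<close>

lemma partial_sums_unique:
  assumes le: "\<And>k. k \<in> {1..n} \<Longrightarrow> (\<Sum>j=1..k. lk mu j) \<le> (\<Sum>j=1..k. lk nu j)"
    and ge: "partial_sums n nu \<le> partial_sums n mu" and keys: "ks mu \<subseteq> {1..n}" "ks nu \<subseteq> {1..n}"
  shows "mu = nu"
proof -
  have eq: "(\<Sum>j=1..k. lk mu j) = (\<Sum>j=1..k. lk nu j)" if k: "k \<in> {1..n}" for k
  proof (rule ccontr)
    assume "(\<Sum>j=1..k. lk mu j) \<noteq> (\<Sum>j=1..k. lk nu j)"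
    then have "(\<Sum>j=1..k. lk mu j) < (\<Sum>j=1..k. lk nu j)" using le[OF k] by simp
    then have "partial_sums n mu < partial_sums n nu"
      unfolding partial_sums_def using le k by (intro sum_strict_mono_ex1) auto
    then show False using ge by simp
  qed
  have "lk mu i = lk nu i" for i
  proof (cases "i \<in> {1..n}")
    case True
    have "(\<Sum>j=1..i - 1. lk mu j) = (\<Sum>j=1..i - 1. lk nu j)"
    proof (cases "i = 1")
      case False
      then have "i - 1 \<in> {1..n}" using True by auto
      then show ?thesis by (rule eq)
    qed simp
    moreover have "(\<Sum>j=1..i. lk m j) = (\<Sum>j=1..i - 1. lk m j) + lk m i" for m :: "nat \<Rightarrow>\<^sub>0 nat"
      using True by (cases i) auto
    ultimately show ?thesis using eq[OF True] by simp
  next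
    case False
    then show ?thesis using lookup_outside[OF keys(1) False] lookup_outside[OF keys(2) False] by simp
  qed
  then show ?thesis by (rule poly_mapping_eqI)
qed

section \<open>Columns of a Young diagram, and the monomials of a product of elementary
  polynomials\<close>

lemma partition_antimono:
  assumes "is_partition n mu" "1 \<le> i" "i \<le> j" "j \<le> n"
  shows "lk mu j \<le> lk mu i"
  using assms(3,4)
proof (induction j rule: dec_induct)
  case (step k)
  then have "lk mu (k + 1) \<le> lk mu k" using assms by (auto simp: is_partition_def)
  then show ?case using step by simp
qed simp

text \<open>Column \<open>r\<close> of the Young diagram as a set of rows; its cardinality is the
  \<open>r\<close>-th part of the conjugate partition.\<close>

definition rows_ge :: "nat \<Rightarrow> (nat \<Rightarrow>\<^sub>0 nat) \<Rightarrow> nat \<Rightarrow> nat set" where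
  "rows_ge n mu r = {i \<in> {1..n}. r \<le> lk mu i}"

lemma column_eq:
  assumes "is_partition n mu"
  shows "rows_ge n mu r = {1..card (rows_ge n mu r)}"
proof -
  define k where "k = Max (insert 0 (rows_ge n mu r))"
  have fin: "finite (rows_ge n mu r)" by (simp add: rows_ge_def)
  have "rows_ge n mu r = {1..k}"
  proof (intro subset_antisym subsetI)
    fix i assume "i \<in> rows_ge n mu r"
    then show "i \<in> {1..k}" using fin by (auto simp: k_def rows_ge_def intro!: Max_ge)
  next
    fix i assume i: "i \<in> {1..k}"
    have "k \<in> insert 0 (rows_ge n mu r)" unfolding k_def using fin by (intro Max_in) auto
    then have "k \<in> rows_ge n mu r" using i by auto
    then show "i \<in> rows_ge n mu r"
      using i partition_antimono[OF assms, of i k] by (auto simp: rows_ge_def)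
  qed
  then show ?thesis by simp
qed

abbreviation columns :: "nat \<Rightarrow> (nat \<Rightarrow>\<^sub>0 nat) \<Rightarrow> nat \<Rightarrow> nat set" where
  "columns n mu \<equiv> (\<lambda>r\<in>{1..lk mu 1}. rows_ge n mu r)"

text \<open>A tuple chooses one squarefree monomial from each factor \<open>e_c\<close>, where
  \<open>c\<close> runs over the column lengths.\<close>

definition tuples :: "nat \<Rightarrow> (nat \<Rightarrow>\<^sub>0 nat) \<Rightarrow> (nat \<Rightarrow> nat set) set" where
  "tuples n mu = (\<Pi>\<^sub>E r\<in>{1..lk mu 1}. {S. S \<subseteq> {1..n} \<and> card S = card (rows_ge n mu r)})"

definition tuple_content :: "nat \<Rightarrow> (nat \<Rightarrow> nat set) \<Rightarrow> nat \<Rightarrow>\<^sub>0 nat" where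
  "tuple_content N B = (\<Sum>r\<in>{1..N}. \<Sum>i\<in>B r. sng i 1)"

abbreviation exponents :: "(nat \<Rightarrow>\<^sub>0 nat) \<Rightarrow> (nat \<Rightarrow> nat set) \<Rightarrow> nat \<Rightarrow>\<^sub>0 nat" where
  "exponents mu B \<equiv> tuple_content (lk mu 1) B"

text \<open>The product of the elementary symmetric polynomials of the column lengths, multiplied
  out. The sum over tuples is kept because \<open>Q_z\<close> attaches to each tuple its own
  expectation.\<close>

definition elementary_product :: "nat \<Rightarrow> (nat \<Rightarrow>\<^sub>0 nat) \<Rightarrow> ('a::comm_semiring_1) mpoly" where
  "elementary_product n mu = (\<Sum>B\<in>tuples n mu. sng (exponents mu B) 1)"

lemma finite_tuples [simp]: "finite (tuples n mu)"
  unfolding tuples_def by (intro finite_PiE) (auto intro: finite_subset[of _ "Pow {1..n}"])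

lemma tuplesD:
  assumes "B \<in> tuples n mu" "r \<in> {1..lk mu 1}"
  shows "B r \<subseteq> {1..n}" "card (B r) = card (rows_ge n mu r)" "finite (B r)"
  using assms finite_subset[of "B r" "{1..n}"] by (auto simp: tuples_def PiE_def Pi_def)

lemma lookup_content:
  assumes "\<forall>r\<in>{1..N}. finite (B r)"
  shows "lk (tuple_content N B) j = card {r \<in> {1..N}. j \<in> B r}"
proof -
  have "lk (tuple_content N B) j = (\<Sum>r\<in>{1..N}. if j \<in> B r then 1 else 0)"
    unfolding tuple_content_def lookup_sum using assms
    by (intro sum.cong refl) (auto simp: lookup_single when_def)
  then show ?thesis by (simp add: sum.If_cases Int_def)
qed

lemma sum_lookup_content:
  assumes "\<forall>r\<in>{1..N}. finite (B r)" "finite S"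
  shows "(\<Sum>j\<in>S. lk (tuple_content N B) j) = (\<Sum>r\<in>{1..N}. card (B r \<inter> S))"
proof -
  have "(\<Sum>j\<in>S. lk (tuple_content N B) j) = (\<Sum>j\<in>S. \<Sum>r\<in>{1..N}. if j \<in> B r then 1 else 0)"
    unfolding lookup_content[OF assms(1)] by (intro sum.cong refl) (simp add: sum.If_cases Int_def)
  also have "\<dots> = (\<Sum>r\<in>{1..N}. \<Sum>j\<in>S. if j \<in> B r then 1 else 0)" by (rule sum.swap)
  also have "\<dots> = (\<Sum>r\<in>{1..N}. card (B r \<inter> S))"
    using assms(2) by (intro sum.cong refl) (simp add: sum.If_cases Int_def conj_commute)
  finally show ?thesis .
qed

lemma keys_content:
  assumes "\<And>r. r \<in> {1..N} \<Longrightarrow> B r \<subseteq> S" "finite S"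
  shows "ks (tuple_content N B) \<subseteq> S"
proof
  fix j assume j: "j \<in> ks (tuple_content N B)"
  have fin: "\<forall>r\<in>{1..N}. finite (B r)" using assms finite_subset by blast
  have "card {r \<in> {1..N}. j \<in> B r} \<noteq> 0"
    using j unfolding in_keys_iff lookup_content[OF fin] .
  then have "{r \<in> {1..N}. j \<in> B r} \<noteq> {}" by (metis card.empty)
  then show "j \<in> S" using assms(1) by auto
qed

lemma content_column:
  assumes "is_partition n mu" "n \<ge> 1"
  shows "exponents mu (columns n mu) = mu"
proof (rule poly_mapping_eqI)
  fix j
  have "lk (exponents mu (columns n mu)) j =
      card {r \<in> {1..lk mu 1}. j \<in> rows_ge n mu r}"
    by (subst lookup_content) (auto simp: rows_ge_def intro!: arg_cong[where f = card])
  also have "\<dots> = lk mu j"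
  proof (cases "j \<in> {1..n}")
    case True
    then have "{r \<in> {1..lk mu 1}. j \<in> rows_ge n mu r} = {1..lk mu j}"
      using partition_antimono[OF assms(1), of 1 j] by (auto simp: rows_ge_def)
    then show ?thesis by simp
  next
    case False
    then have "lk mu j = 0" using assms by (auto simp: is_partition_def in_keys_iff subset_eq)
    moreover have "{r \<in> {1..lk mu 1}. j \<in> rows_ge n mu r} = {}" using False by (auto simp: rows_ge_def)
    ultimately show ?thesis by simp
  qed
  finally show "lk (exponents mu (columns n mu)) j = lk mu j" .
qed

lemma column_in_tuples: "columns n mu \<in> tuples n mu"
  unfolding tuples_def by (auto simp: rows_ge_def)

text \<open>No set of the same size meets \<open>{1..k}\<close> in more points than an initial
  segment does.\<close>

lemma card_Int_le_column:
  assumes "is_partition n mu" "B \<in> tuples n mu" "r \<in> {1..lk mu 1}"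
  shows "card (B r \<inter> {1..k}) \<le> card (rows_ge n mu r \<inter> {1..k})"
proof -
  define c where "c = card (rows_ge n mu r)"
  have "rows_ge n mu r \<inter> {1..k} = {1..min c k}" by (subst column_eq[OF assms(1)]) (auto simp: c_def)
  moreover have "card (B r \<inter> {1..k}) \<le> c"
    using tuplesD[OF assms(2,3)] card_mono[of "B r" "B r \<inter> {1..k}"] by (simp add: c_def)
  moreover have "card (B r \<inter> {1..k}) \<le> k"
    using card_mono[of "{1..k}" "B r \<inter> {1..k}"] by simp
  ultimately show ?thesis by simp
qed

lemma sum_content_column:
  assumes "is_partition n mu" "n \<ge> 1"
  shows "(\<Sum>j=1..k. lk mu j) = (\<Sum>r\<in>{1..lk mu 1}. card (rows_ge n mu r \<inter> {1..k}))"
proof -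
  have "(\<Sum>j=1..k. lk mu j) = (\<Sum>j\<in>{1..k}. lk (exponents mu (columns n mu)) j)"
    using content_column[OF assms] by simp
  also have "\<dots> = (\<Sum>r\<in>{1..lk mu 1}. card (columns n mu r \<inter> {1..k}))"
    by (rule sum_lookup_content) (auto simp: rows_ge_def)
  finally show ?thesis by simp
qed

text \<open>Partial sums of the exponents count the intersections of the chosen sets with
  \<open>{1..k}\<close>, and each column maximises its own intersection. For \<open>k = n\<close>
  all intersections are full, hence the equality of totals.\<close>

lemma content_dominated:
  assumes "is_partition n mu" "n \<ge> 1" "B \<in> tuples n mu"
  shows "dominated n (exponents mu B) mu"
proof -
  have s: "(\<Sum>j=1..k. lk (exponents mu B) j) = (\<Sum>r\<in>{1..lk mu 1}. card (B r \<inter> {1..k}))" for k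
    using tuplesD(3)[OF assms(3)] by (intro sum_lookup_content) auto
  have "(\<Sum>r\<in>{1..lk mu 1}. card (B r \<inter> {1..n})) = (\<Sum>r\<in>{1..lk mu 1}. card (rows_ge n mu r \<inter> {1..n}))"
  proof (rule sum.cong)
    fix r assume r: "r \<in> {1..lk mu 1}"
    have "B r \<inter> {1..n} = B r" "rows_ge n mu r \<inter> {1..n} = rows_ge n mu r"
      using tuplesD(1)[OF assms(3) r] by (auto simp: rows_ge_def)
    then show "card (B r \<inter> {1..n}) = card (rows_ge n mu r \<inter> {1..n})"
      using tuplesD(2)[OF assms(3) r] by simp
  qed simp
  moreover have "(\<Sum>r\<in>{1..lk mu 1}. card (B r \<inter> {1..k})) \<le> (\<Sum>r\<in>{1..lk mu 1}. card (rows_ge n mu r \<inter> {1..k}))" for k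
    using card_Int_le_column[OF assms(1,3)] by (intro sum_mono)
  ultimately show ?thesis
    unfolding dominated_def s sum_content_column[OF assms(1,2)] by blast
qed

text \<open>Equality of exponents leaves no slack in any column. Taking \<open>k\<close> to be the
  length of column \<open>r\<close> then forces \<open>B r\<close> to be that column.\<close>

lemma content_eq_imp_column:
  assumes "is_partition n mu" "n \<ge> 1" "B \<in> tuples n mu" and eq: "exponents mu B = mu"
  shows "B = columns n mu"
proof
  fix r
  show "B r = columns n mu r"
  proof (cases "r \<in> {1..lk mu 1}")
    case True
    define c where "c = card (rows_ge n mu r)"
    have col: "rows_ge n mu r = {1..c}" unfolding c_def by (rule column_eq[OF assms(1)])
    have s: "(\<Sum>r\<in>{1..lk mu 1}. card (B r \<inter> {1..c})) = (\<Sum>r\<in>{1..lk mu 1}. card (rows_ge n mu r \<inter> {1..c}))"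
      using sum_lookup_content[of "lk mu 1" B "{1..c}"] tuplesD(3)[OF assms(3)] eq sum_content_column[OF
        assms(1,2), of c]
      by simp
    have "card (B r \<inter> {1..c}) = card (rows_ge n mu r \<inter> {1..c})"
    proof (rule ccontr)
      assume "card (B r \<inter> {1..c}) \<noteq> card (rows_ge n mu r \<inter> {1..c})"
      then have "card (B r \<inter> {1..c}) < card (rows_ge n mu r \<inter> {1..c})"
        using card_Int_le_column[OF assms(1,3) True, of c] by simp
      then have "(\<Sum>r\<in>{1..lk mu 1}. card (B r \<inter> {1..c})) < (\<Sum>r\<in>{1..lk mu 1}. card (rows_ge n mu r \<inter> {1..c}))"
        using card_Int_le_column[OF assms(1,3)] True by (intro sum_strict_mono_ex1) auto
      then show False using s by simp
    qed
    then have cc: "card (B r \<inter> {1..c}) = c" using col by simp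
    have "card (B r) = c" using tuplesD(2)[OF assms(3) True] by (simp add: c_def)
    then have "B r \<inter> {1..c} = B r" using tuplesD(3)[OF assms(3) True] cc by (intro card_subset_eq) auto
    moreover have "B r \<inter> {1..c} = {1..c}" using cc by (intro card_subset_eq) auto
    ultimately show ?thesis using col True by auto
  next
    case False
    then show ?thesis using assms(3) by (auto simp: tuples_def PiE_def extensional_def)
  qed
qed

text \<open>Permuting entries preserves the cardinality of each \<open>rows_ge\<close> set, and for
  a partition that cardinality determines the set.\<close>

lemma partition_perm_unique:
  assumes "is_partition n mu" "is_partition n nu" "s permutes {1..n}" "nu = permuted s mu"
  shows "nu = mu"
proof -
  have "rows_ge n nu r = inv s ` rows_ge n mu r" for r
  proof -
    have "rows_ge n nu r = {i \<in> {1..n}. r \<le> lk mu (s i)}"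
      by (simp add: rows_ge_def assms(4) lookup_map_key_permutes[OF assms(3)])
    also have "\<dots> = inv s ` rows_ge n mu r"
      unfolding rows_ge_def
    proof (intro subset_antisym subsetI)
      fix i assume "i \<in> {i \<in> {1..n}. r \<le> lk mu (s i)}"
      then show "i \<in> inv s ` {i \<in> {1..n}. r \<le> lk mu i}"
        using permutes_in_image[OF assms(3)] permutes_inverses(2)[OF assms(3)]
        by (intro image_eqI[of _ _ "s i"]) auto
    next
      fix i assume "i \<in> inv s ` {i \<in> {1..n}. r \<le> lk mu i}"
      then show "i \<in> {i \<in> {1..n}. r \<le> lk mu (s i)}"
        using permutes_in_image[OF permutes_inv[OF assms(3)]] permutes_inverses(1)[OF assms(3)] by auto
    qed
    finally show ?thesis .
  qed
  then have "card (rows_ge n nu r) = card (rows_ge n mu r)" for r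
    using permutes_inj[OF permutes_inv[OF assms(3)]] by (simp add: card_image inj_on_subset)
  then have col: "rows_ge n nu r = rows_ge n mu r" for r
    using column_eq[OF assms(1)] column_eq[OF assms(2)] by metis
  show ?thesis
  proof (rule poly_mapping_eqI)
    fix i
    show "lk nu i = lk mu i"
    proof (cases "i \<in> {1..n}")
      case True
      then have "r \<le> lk nu i \<longleftrightarrow> r \<le> lk mu i" for r using col[of r] by (auto simp: rows_ge_def set_eq_iff)
      then show ?thesis by (metis order_antisym order_refl)
    next
      case False
      then show ?thesis using lookup_outside[of mu "{1..n}" i] lookup_outside[of nu "{1..n}" i] assms(1,2)
        by (simp add: is_partition_def)
    qed
  qed
qed

section \<open>Symmetric polynomials in terms of elementary ones\<close>

lemma lookup_elementary_product:
  "lk (elementary_product n mu :: 'a::comm_semiring_1 mpoly) m =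
    (\<Sum>B\<in>tuples n mu. if exponents mu B = m then 1 else 0)"
  unfolding elementary_product_def lookup_sum by (intro sum.cong refl) (simp add: lookup_single when_def)

lemma sum_tuples_leading:
  fixes f :: "(nat \<Rightarrow> nat set) \<Rightarrow> 'a::comm_semiring_1"
  assumes "is_partition n mu" "n \<ge> 1"
  shows "(\<Sum>B\<in>tuples n mu. if exponents mu B = mu then f B else 0) = f (columns n mu)"
proof -
  have "(\<Sum>B\<in>tuples n mu. if exponents mu B = mu then f B else 0) =
     (\<Sum>B\<in>tuples n mu. if B = columns n mu then f B else 0)"
  proof (intro sum.cong refl)
    fix B assume "B \<in> tuples n mu"
    then have "exponents mu B = mu \<longleftrightarrow> B = columns n mu"
      using content_eq_imp_column[OF assms] content_column[OF assms] by metis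
    then show "(if exponents mu B = mu then f B else 0) = (if B = columns n mu then f B else 0)"
      by (simp only:)
  qed
  then show ?thesis using column_in_tuples[of n mu] by simp
qed

lemma lookup_elementary_product_self:
  assumes "is_partition n mu" "n \<ge> 1"
  shows "lk (elementary_product n mu :: 'a::comm_semiring_1 mpoly) mu = 1"
  by (simp only: lookup_elementary_product sum_tuples_leading[OF assms])

section \<open>The symmetric group acting on tuples\<close>

definition perm_tuple :: "(nat \<Rightarrow> nat) \<Rightarrow> nat \<Rightarrow> (nat \<Rightarrow> nat set) \<Rightarrow> nat \<Rightarrow> nat set" where
  "perm_tuple s N B = (\<lambda>r\<in>{1..N}. s ` B r)"

lemma perm_tuple_in_tuples:
  assumes "s permutes {1..n}" "B \<in> tuples n mu"
  shows "perm_tuple s (lk mu 1) B \<in> tuples n mu"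
  unfolding tuples_def
proof (rule PiE_I)
  fix r assume r: "r \<in> {1..lk mu 1}"
  have "card (s ` B r) = card (B r)"
    using permutes_inj[OF assms(1)] by (intro card_image) (auto intro: inj_on_subset)
  then show "perm_tuple s (lk mu 1) B r \<in> {S. S \<subseteq> {1..n} \<and> card S = card (rows_ge n mu r)}"
    using r tuplesD[OF assms(2) r] permutes_image[OF assms(1)] by (auto simp: perm_tuple_def)
qed (auto simp: perm_tuple_def)

lemma perm_tuple_inv:
  assumes "s permutes {1..n}" "B \<in> tuples n mu"
  shows "perm_tuple (inv s) (lk mu 1) (perm_tuple s (lk mu 1) B) = B"
    and "perm_tuple s (lk mu 1) (perm_tuple (inv s) (lk mu 1) B) = B"
proof -
  have "B r = undefined" if "r \<notin> {1..lk mu 1}" for r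
    using that assms(2) by (auto simp: tuples_def PiE_def extensional_def)
  then show "perm_tuple (inv s) (lk mu 1) (perm_tuple s (lk mu 1) B) = B"
    and "perm_tuple s (lk mu 1) (perm_tuple (inv s) (lk mu 1) B) = B"
    by (auto simp: perm_tuple_def fun_eq_iff image_image permutes_inverses[OF assms(1)])
qed

text \<open>The inverse appears because \<open>permuted s m\<close> has the entry
  \<open>lk m (s i)\<close> at \<open>i\<close>, whereas \<open>perm_tuple s\<close> moves the
  elements of the sets forward.\<close>

lemma content_perm_tuple:
  assumes "s permutes {1..n}" "B \<in> tuples n mu"
  shows "exponents mu (perm_tuple s (lk mu 1) B) = permuted (inv s) (exponents mu B)"
proof (rule poly_mapping_eqI)
  fix j
  have fin: "\<forall>r\<in>{1..lk mu 1}. finite (B r)" using tuplesD(3)[OF assms(2)] by auto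
  then have fin': "\<forall>r\<in>{1..lk mu 1}. finite (perm_tuple s (lk mu 1) B r)" by (simp add: perm_tuple_def)
  have "j \<in> s ` B r \<longleftrightarrow> inv s j \<in> B r" for r
    using permutes_inverses[OF assms(1)] by (metis image_iff)
  then show "lk (exponents mu (perm_tuple s (lk mu 1) B)) j = lk (permuted (inv s) (exponents mu B)) j"
    unfolding lookup_map_key_permutes[OF permutes_inv[OF assms(1)]] lookup_content[OF fin] lookup_content[OF fin']
    by (intro arg_cong[where f = card]) (auto simp: perm_tuple_def)
qed

text \<open>An invariant weight on tuples yields symmetric coefficients. Used with a constant weight
  for \<open>elementary_product\<close> and with expectations for the coefficients of
  \<open>Q_expansion\<close>.\<close>

lemma sum_tuples_perm:
  assumes s: "s permutes {1..n}" and f: "\<And>B. B \<in> tuples n mu \<Longrightarrow> f (perm_tuple s (lk mu 1) B) = f B"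
  shows "(\<Sum>B\<in>tuples n mu. if exponents mu B = permuted s m then f B else 0) =
    (\<Sum>B\<in>tuples n mu. if exponents mu B = m then f B else 0)"
proof (rule sum.reindex_bij_witness[of _ "perm_tuple (inv s) (lk mu 1)" "perm_tuple s (lk mu 1)"])
  fix B assume B: "B \<in> tuples n mu"
  show "perm_tuple (inv s) (lk mu 1) (perm_tuple s (lk mu 1) B) =
    B" "perm_tuple s (lk mu 1) (perm_tuple (inv s) (lk mu 1) B) = B"
    by (rule perm_tuple_inv[OF s B])+
  show "perm_tuple s (lk mu 1) B \<in> tuples n mu" "perm_tuple (inv s) (lk mu 1) B \<in> tuples n mu"
    by (rule perm_tuple_in_tuples[OF s B], rule perm_tuple_in_tuples[OF permutes_inv[OF s] B])
  have "exponents mu B = permuted s m \<longleftrightarrow> permuted (inv s) (exponents mu B) = m"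
    using map_key_permutes_inv[OF s] by metis
  then show "(if exponents mu (perm_tuple s (lk mu 1) B) = m then f (perm_tuple s (lk mu 1) B) else 0) =
     (if exponents mu B = permuted s m then f B else 0)"
    using f[OF B] content_perm_tuple[OF s B] by simp
qed

lemma symmetric_elementary_product:
  "symmetric_mpoly n (elementary_product n mu :: 'a::comm_semiring_1 mpoly)"
  unfolding symmetric_mpoly_def
proof (intro conjI ballI allI impI)
  fix m assume "m \<in> ks (elementary_product n mu :: 'a mpoly)"
  then have "(\<Sum>B\<in>tuples n mu. if exponents mu B = m then 1 else 0 :: 'a) \<noteq> 0"
    by (simp add: in_keys_iff lookup_elementary_product)
  then obtain B where "B \<in> tuples n mu" "(if exponents mu B = m then 1 else 0 :: 'a) \<noteq> 0"
    by (rule sum.not_neutral_contains_not_neutral)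
  then have "B \<in> tuples n mu" "exponents mu B = m" by (auto split: if_splits)
  then show "ks m \<subseteq> {1..n}" using keys_content[of "lk mu 1" B "{1..n}"] tuplesD(1) by blast
next
  fix s m assume "s permutes {1..n}"
  then show "lk (elementary_product n mu :: 'a mpoly) (permuted s m) = lk (elementary_product n mu) m"
    unfolding lookup_elementary_product using sum_tuples_perm[of s n mu "\<lambda>_. 1"] by simp
qed

lemma symmetric_mpoly_diff_Const_mult:
  fixes p :: "'a::comm_ring_1 mpoly"
  assumes "symmetric_mpoly n p" "symmetric_mpoly n q"
  shows "symmetric_mpoly n (p - Const c * q)"
proof -
  have "ks m \<subseteq> {1..n}" if "m \<in> ks (p - Const c * q)" for m
  proof -
    have "m \<in> ks p \<or> m \<in> ks q" using that by (auto simp: in_keys_iff lookup_minus lookup_Const_mult)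
    then show ?thesis using assms by (auto simp: symmetric_mpoly_def)
  qed
  then show ?thesis using assms by (auto simp: symmetric_mpoly_def lookup_minus lookup_Const_mult)
qed

text \<open>
  An exponent vector of \<open>p\<close> that maximises the sum of all partial sums is a partition, since exchanging
  an ascent would increase that sum.
\<close>

lemma symmetric_partition_key:
  fixes p :: "'a::zero mpoly"
  assumes "symmetric_mpoly n p" "p \<noteq> 0"
  shows "\<exists>m\<in>ks p. is_partition n m"
proof -
  have "ks p \<noteq> {}" using assms(2) by simp
  obtain m where m: "m \<in> ks p" "\<And>m'. m' \<in> ks p \<Longrightarrow> partial_sums n m' \<le> partial_sums n m"
  proof -
    have "Max (partial_sums n ` ks p) \<in> partial_sums n ` ks p" using \<open>ks p \<noteq> {}\<close> by (intro Max_in) auto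
    then obtain m where "m \<in> ks p" "partial_sums n m = Max (partial_sums n ` ks p)" by force
    then show ?thesis by (intro that[of m]) simp_all
  qed
  have "is_partition n m"
    unfolding is_partition_def
  proof (intro conjI ballI)
    show "ks m \<subseteq> {1..n}" using assms(1) m(1) by (auto simp: symmetric_mpoly_def)
    fix i assume i: "i \<in> {1..<n}"
    show "lk m (i + 1) \<le> lk m i"
    proof (rule ccontr)
      assume lt: "\<not> lk m (i + 1) \<le> lk m i"
      define s where "s = Transposition.transpose i (i + 1)"
      have s: "s permutes {1..n}" unfolding s_def using i by (intro permutes_swap_id) auto
      define m' where "m' = permuted s m"
      have m'i: "lk m' j = lk m (s j)" for j by (simp add: m'_def lookup_map_key_permutes[OF s])
      have "m' \<in> ks p" using assms(1) s m(1) by (simp add: symmetric_mpoly_def m'_def in_keys_iff)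
      moreover have "partial_sums n m < partial_sums n m'"
        unfolding partial_sums_def
      proof (rule sum_strict_mono_ex1)
        have low: "(\<Sum>j\<in>{1..k}. lk m' j) = (\<Sum>j\<in>{1..k}. lk m j)" if "k < i" for k
          using that by (intro sum.cong refl) (auto simp: m'i s_def transpose_def)
        have spl: "(\<Sum>j\<in>{1..i}. f j) = f i + (\<Sum>j\<in>{1..i - 1}. f j)" for f :: "nat \<Rightarrow> nat"
          using i by (cases i) auto
        have at: "(\<Sum>j\<in>{1..i}. lk m j) < (\<Sum>j\<in>{1..i}. lk m' j)"
          using low[of "i - 1"] i lt unfolding spl m'i[of i] by (simp add: s_def)
        have high: "(\<Sum>j\<in>{1..k}. lk m j) = (\<Sum>j\<in>{1..k}. lk m' j)" if "i < k" for k
        proof -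
          have "s permutes {1..k}" unfolding s_def using i that by (intro permutes_swap_id) auto
          then show ?thesis unfolding m'i by (rule sum.permute[of s "{1..k}" "lk m", unfolded o_def])
        qed
        show "\<forall>k\<in>{1..n}. (\<Sum>j\<in>{1..k}. lk m j) \<le> (\<Sum>j\<in>{1..k}. lk m' j)"
          using low at high by (metis linorder_neqE_nat order_refl less_imp_le)
        show "\<exists>k\<in>{1..n}. (\<Sum>j\<in>{1..k}. lk m j) < (\<Sum>j\<in>{1..k}. lk m' j)"
          using at i by (intro bexI[of _ i]) auto
      qed simp
      ultimately show False using m(2)[of m'] by simp
    qed
  qed
  then show ?thesis using m(1) by blast
qed

text \<open>Triangular elimination: the element \<open>mu\<close> of \<open>D\<close> of largest
  rank is maximal, so subtracting a multiple of its product clears the coefficient at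
  \<open>mu\<close> and creates partition exponents only in \<open>D\<close>, while
  \<open>D - {mu}\<close> stays closed downwards. With \<open>D\<close> empty no partition exponent
  is left, so the polynomial is zero.\<close>

lemma symmetric_elementary_expansion:
  fixes p :: "'a::comm_ring_1 mpoly"
  assumes "n \<ge> 1" "finite D" "\<And>mu. mu \<in> D \<Longrightarrow> is_partition n mu"
    and "\<And>mu \<kappa>. mu \<in> D \<Longrightarrow> is_partition n \<kappa> \<Longrightarrow> dominated n \<kappa> mu \<Longrightarrow> \<kappa> \<in> D"
    and "symmetric_mpoly n p" "\<And>m. m \<in> ks p \<Longrightarrow> is_partition n m \<Longrightarrow> m \<in> D"
  shows "\<exists>d. p = (\<Sum>mu\<in>D. Const (d mu) * elementary_product n mu)"
  using assms(2-)
proof (induction "card D" arbitrary: D p)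
  case 0
  then have "p = 0" using symmetric_partition_key[of n p] by auto
  then show ?case using 0 by simp
next
  case (Suc N)
  have "D \<noteq> {}" using Suc.hyps(2) by auto
  obtain mu where mu: "mu \<in> D" "\<And>\<kappa>. \<kappa> \<in> D \<Longrightarrow> partial_sums n \<kappa> \<le> partial_sums n mu"
  proof -
    have "Max (partial_sums n ` D) \<in> partial_sums n ` D" using \<open>D \<noteq> {}\<close> Suc.prems(1) by (intro Max_in) auto
    then obtain mu where "mu \<in> D" "partial_sums n mu = Max (partial_sums n ` D)" by force
    then show ?thesis using Suc.prems(1) by (intro that[of mu]) simp_all
  qed
  define p' where "p' = p - Const (lk p mu) * elementary_product n mu"
  have "\<exists>d. p' = (\<Sum>mu\<in>D - {mu}. Const (d mu) * elementary_product n mu)"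
  proof (rule Suc.hyps(1))
    show "N = card (D - {mu})" using Suc.hyps(2) mu(1) Suc.prems(1) by simp
    show "symmetric_mpoly n p'"
      unfolding p'_def by (intro symmetric_mpoly_diff_Const_mult Suc.prems symmetric_elementary_product)
    fix \<kappa>' \<kappa> assume k: "\<kappa>' \<in> D - {mu}" "is_partition n \<kappa>" "dominated n \<kappa> \<kappa>'"
    have "\<kappa> \<noteq> mu"
    proof
      assume "\<kappa> = mu"
      then have "mu = \<kappa>'"
        using k mu Suc.prems(2)[of \<kappa>'] Suc.prems(2)[of mu] dominated_le[of n mu \<kappa>']
        by (intro partial_sums_unique[of n]) (auto simp: is_partition_def)
      then show False using k by simp
    qed
    then show "\<kappa> \<in> D - {mu}" using k Suc.prems(3)[of \<kappa>' \<kappa>] by auto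
  next
    fix m assume m: "m \<in> ks p'" "is_partition n m"
    have "m \<noteq> mu"
      using m Suc.prems(2)[OF mu(1)] assms(1)
      by (auto simp: p'_def in_keys_iff lookup_minus lookup_Const_mult lookup_elementary_product_self)
    moreover have "m \<in> D"
    proof (cases "m \<in> ks p")
      case True
      then show ?thesis using Suc.prems(5) m(2) by blast
    next
      case False
      then have "lk (elementary_product n mu :: 'a mpoly) m \<noteq> 0"
        using m by (auto simp: p'_def in_keys_iff lookup_minus lookup_Const_mult)
      then obtain B where "B \<in> tuples n mu" "(if exponents mu B = m then 1 else 0 :: 'a) \<noteq> 0"
        unfolding lookup_elementary_product by (rule sum.not_neutral_contains_not_neutral)
      then have "B \<in> tuples n mu" "exponents mu B = m" by (auto split: if_splits)
      then have "dominated n m mu" using content_dominated[OF Suc.prems(2)[OF mu(1)] assms(1)] by blast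
      then show ?thesis using Suc.prems(3) mu(1) m(2) by blast
    qed
    ultimately show "m \<in> D - {mu}" by simp
  qed (use Suc.prems in auto)
  then obtain d where d: "p' = (\<Sum>mu\<in>D - {mu}. Const (d mu) * elementary_product n mu)" by blast
  have "p = Const (lk p mu) * elementary_product n mu + (\<Sum>mu\<in>D - {mu}. Const (d mu) * elementary_product n mu)"
    using d by (simp add: p'_def algebra_simps)
  also have "\<dots> = (\<Sum>\<kappa>\<in>D. Const ((d(mu := lk p mu)) \<kappa>) * elementary_product n \<kappa>)"
    using mu(1) Suc.prems(1) by (subst sum.remove[of D mu]) (auto intro!: sum.cong)
  finally show ?case by blast
qed

section \<open>Dirichlet expectations\<close>

lemma Gamma_real_nonzero: "x > 0 \<Longrightarrow> Gamma (x :: real) \<noteq> 0"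
  using Gamma_real_pos[of x] by linarith

definition dirichlet_density :: "nat \<Rightarrow> real \<Rightarrow> real \<Rightarrow> ((nat \<Rightarrow> real) \<Rightarrow> complex) \<Rightarrow> (nat \<Rightarrow> real) \<Rightarrow> complex" where
  "dirichlet_density n g w f t = (let t' = simplex_from n 1 w t in
     if \<forall>i\<in>{1..n}. t' i > 0 then of_real (\<Prod>i\<in>{1..n}. t' i powr (g - 1)) * f t' else 0)"

text \<open>The integral of the unnormalised density over the simplex of size
  \<open>w\<close>.\<close>

definition dirichlet_total :: "nat \<Rightarrow> real \<Rightarrow> real \<Rightarrow> real" where
  "dirichlet_total n g w = w powr (real n * g - 1) * (Gamma g ^ n / Gamma (real n * g))"

text \<open>The normalised moment of order \<open>a\<close> on the simplex of size 1; on size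
  \<open>w\<close> it is multiplied by \<open>w\<close> to the total order.\<close>

definition dirichlet_moment :: "nat \<Rightarrow> real \<Rightarrow> (nat \<Rightarrow> nat) \<Rightarrow> real" where
  "dirichlet_moment n g a = Gamma (real n * g) / Gamma g ^ n *
     ((\<Prod>i\<in>{1..n}. Gamma (g + real (a i))) / Gamma (\<Sum>i\<in>{1..n}. g + real (a i)))"

text \<open>The expectation of the product over \<open>r \<in> R\<close> of
  \<open>1 + (\<Sum>i\<in>B r. t i)\<close> for a Dirichlet vector \<open>t\<close> of total
  \<open>z - 1\<close>, as a polynomial in \<open>z\<close>. \<open>A\<close> collects the factors
  from which a coordinate is taken, \<open>c\<close> says which one, and the total enters as the
  polynomial \<open>[:- 1, 1:]\<close>.\<close>

definition expect_poly :: "nat \<Rightarrow> real \<Rightarrow> nat set \<Rightarrow> (nat \<Rightarrow> nat set) \<Rightarrow> complex poly" where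
  "expect_poly n g R B = (\<Sum>A\<in>Pow R. \<Sum>c\<in>PiE A B.
     smult (of_real (dirichlet_moment n g (\<lambda>i. card {r\<in>A. c r = i}))) ([:- 1, 1:] ^ card A))"

abbreviation has_dirichlet_integral ::
    "nat \<Rightarrow> real \<Rightarrow> real \<Rightarrow> ((nat \<Rightarrow> real) \<Rightarrow> complex) \<Rightarrow> complex \<Rightarrow> bool" where
  "has_dirichlet_integral n g w f v \<equiv> has_bochner_integral (leb {1..<n}) (dirichlet_density n g w f) v"

lemma dirichlet_density_sum:
  "dirichlet_density n g w (\<lambda>t. \<Sum>a\<in>A. f a t) t = (\<Sum>a\<in>A. dirichlet_density n g w (f a) t)"
proof -
  have "(if C then c * (\<Sum>a\<in>A. h a) else 0) = (\<Sum>a\<in>A. if C then c * h a else 0)"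
    for C and c :: complex and h
    by (cases C) (simp_all add: sum_distrib_left)
  then show ?thesis unfolding dirichlet_density_def Let_def .
qed

lemma dirichlet_density_cmult:
  "dirichlet_density n g w (\<lambda>t. c * f t) t = c * dirichlet_density n g w f t"
  by (simp add: dirichlet_density_def Let_def)

lemma has_bochner_integral_density_sum:
  assumes "finite A" "\<And>a. a \<in> A \<Longrightarrow> has_bochner_integral M (dirichlet_density n g w (f a)) (v a)"
  shows "has_bochner_integral M (dirichlet_density n g w (\<lambda>t. \<Sum>a\<in>A. f a t)) (\<Sum>a\<in>A. v a)"
  unfolding dirichlet_density_sum[abs_def] using assms(2) by (rule has_bochner_integral_sum)

lemma has_bochner_integral_density_cmult:
  assumes "has_bochner_integral M (dirichlet_density n g w f) v"
  shows "has_bochner_integral M (dirichlet_density n g w (\<lambda>t. c * f t)) (c * v)"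
  unfolding dirichlet_density_cmult[abs_def] using assms by (intro has_bochner_integral_mult_right) auto

lemma has_bochner_integral_dirichlet:
  assumes "n \<ge> 1" "w > 0" and s: "\<And>i. s i > 0"
    and eq: "\<And>t. \<forall>i\<in>{1..n}. t i > 0 \<Longrightarrow> (\<Sum>i\<in>{1..n}. t i) = w \<Longrightarrow>
       of_real (dirichlet_weight n s m t) = of_real (\<Prod>i\<in>{1..n}. t i powr (g - 1)) * f t"
  shows "has_dirichlet_integral n g w f
    (of_real (w powr ((\<Sum>i\<in>{1..n}. s i) + (\<Sum>i\<in>{1..<n}. real (m i)) - 1) * dirichlet_value n s m))"
proof -
  have "dirichlet_density n g w f t = of_real (simplex_integrand n 1 w (dirichlet_weight n s m) t)" for t
  proof -
    have "{1..n} = insert n {1..<n}" using assms(1) by auto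
    then have "(\<Sum>i\<in>{1..n}. simplex_from n 1 w t i) = w" by (simp add: simplex_from_def)
    then show ?thesis using eq[of "simplex_from n 1 w t"] unfolding dirichlet_density_def Let_def by auto
  qed
  then have *: "dirichlet_density n g w f = (\<lambda>t. of_real (simplex_integrand n 1 w (dirichlet_weight n s m) t))"
    by (rule ext)
  show ?thesis
    unfolding * by (rule has_bochner_integral_bounded_linear[OF bounded_linear_of_real dirichlet_has_integral[OF
      assms(1-3)]])
qed

lemma prod_fibers:
  fixes t :: "nat \<Rightarrow> 'a::comm_semiring_1"
  assumes "finite A" "\<And>r. r \<in> A \<Longrightarrow> c r \<in> S" "finite S"
  shows "(\<Prod>r\<in>A. t (c r)) = (\<Prod>i\<in>S. t i ^ card {r\<in>A. c r = i})"
proof -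
  have "(\<Prod>r\<in>A. t (c r)) = (\<Prod>i\<in>S. \<Prod>r\<in>{r\<in>A. c r = i}. t (c r))"
    using assms by (intro prod.group[symmetric]) auto
  also have "\<dots> = (\<Prod>i\<in>S. t i ^ card {r\<in>A. c r = i})"
    by (intro prod.cong refl) simp
  finally show ?thesis .
qed

lemma sum_fibers:
  assumes "finite A" "\<And>r. r \<in> A \<Longrightarrow> c r \<in> S" "finite S"
  shows "(\<Sum>i\<in>S. card {r\<in>A. c r = i}) = card A"
proof -
  have "(\<Sum>i\<in>S. \<Sum>r\<in>{r\<in>A. c r = i}. 1) = (\<Sum>r\<in>A. 1 :: nat)"
    using assms by (intro sum.group) auto
  then show ?thesis by simp
qed

lemma has_bochner_integral_density_monomial:
  assumes "n \<ge> 1" "w > 0" "g > 0" "finite A" "\<And>r. r \<in> A \<Longrightarrow> c r \<in> {1..n}"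
  shows "has_dirichlet_integral n g w (\<lambda>t. of_real (\<Prod>r\<in>A. t (c r)))
    (of_real (dirichlet_total n g w) * of_real (dirichlet_moment n g (\<lambda>i. card {r\<in>A. c r = i}) * w ^ card A))"
proof -
  define a where "a i = card {r\<in>A. c r = i}" for i
  define s where "s i = g + real (a i)" for i
  have s: "s i > 0" for i using assms(3) by (simp add: s_def add_pos_nonneg)
  have sum: "(\<Sum>i\<in>{1..n}. s i) = real n * g + real (card A)"
  proof -
    have "(\<Sum>i\<in>{1..n}. real (a i)) = real (\<Sum>i\<in>{1..n}. a i)" by simp
    also have "(\<Sum>i\<in>{1..n}. a i) = card A" unfolding a_def using assms by (intro sum_fibers) auto
    finally show ?thesis by (simp add: s_def sum.distrib)
  qed
  have h1: "has_dirichlet_integral n g w (\<lambda>t. of_real (\<Prod>r\<in>A. t (c r)))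
    (of_real (w powr ((\<Sum>i\<in>{1..n}. s i) + (\<Sum>i\<in>{1..<n}. real 0) - 1) * dirichlet_value n s (\<lambda>_. 0)))"
  proof (rule has_bochner_integral_dirichlet[OF assms(1,2) s])
    fix t assume t: "\<forall>i\<in>{1..n}. t i > (0::real)"
    have "dirichlet_weight n s (\<lambda>_. 0) t = (\<Prod>i\<in>{1..n}. t i powr (g - 1) * t i ^ a i)"
      unfolding dirichlet_weight_def using t
      by (auto intro!: prod.cong simp: s_def powr_realpow[symmetric] powr_add[symmetric] algebra_simps)
    also have "\<dots> = (\<Prod>i\<in>{1..n}. t i powr (g - 1)) * (\<Prod>r\<in>A. t (c r))"
      unfolding prod.distrib a_def using assms by (subst prod_fibers[of A c "{1..n}" t]) auto
    finally show "complex_of_real (dirichlet_weight n s (\<lambda>_. 0) t) =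
      of_real (\<Prod>i\<in>{1..n}. t i powr (g - 1)) * of_real (\<Prod>r\<in>A. t (c r))" by simp
  qed
  have E: "w powr ((\<Sum>i\<in>{1..n}. s i) + (\<Sum>i\<in>{1..<n}. real 0) - 1) * dirichlet_value n s (\<lambda>_. 0) =
     dirichlet_total n g w * (dirichlet_moment n g a * w ^ card A)"
  proof -
    have "w powr (real n * g + real (card A) - 1) = w powr (real n * g - 1) * w ^ card A"
      using assms(2) by (simp add: powr_realpow[symmetric] powr_add[symmetric] algebra_simps)
    moreover have "Gamma (real n * g) \<noteq> 0" "Gamma g \<noteq> 0"
      using assms by (simp_all add: Gamma_real_nonzero)
    ultimately show ?thesis
      unfolding sum dirichlet_value_powers[of s n, OF s assms(1)] dirichlet_total_def dirichlet_moment_def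
      using sum by (simp add: s_def)
  qed
  show ?thesis using h1 unfolding E of_real_mult[symmetric] a_def[abs_def] .
qed

lemma prod_one_plus_sum:
  fixes t :: "nat \<Rightarrow> 'a::comm_semiring_1"
  assumes "finite R" "\<And>r. r \<in> R \<Longrightarrow> finite (B r)"
  shows "(\<Prod>r\<in>R. 1 + (\<Sum>i\<in>B r. t i)) = (\<Sum>A\<in>Pow R. \<Sum>c\<in>PiE A B. \<Prod>r\<in>A. t (c r))"
proof -
  have "(\<Prod>r\<in>R. 1 + (\<Sum>i\<in>B r. t i)) = (\<Sum>A\<in>Pow R. \<Prod>r\<in>A. \<Sum>i\<in>B r. t i)"
    using prod_add[OF assms(1), of "\<lambda>r. \<Sum>i\<in>B r. t i" "\<lambda>_. 1"] by (simp add: add.commute)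
  also have "\<dots> = (\<Sum>A\<in>Pow R. \<Sum>c\<in>PiE A B. \<Prod>r\<in>A. t (c r))"
    using assms by (intro sum.cong refl prod_sum_PiE) (auto dest: finite_subset)
  finally show ?thesis .
qed

lemma has_bochner_integral_density_expect:
  assumes "n \<ge> 1" "w > 0" "g > 0" "finite R" "\<And>r. r \<in> R \<Longrightarrow> B r \<subseteq> {1..n}"
  shows "has_dirichlet_integral n g w (\<lambda>t. of_real (\<Prod>r\<in>R. 1 + (\<Sum>i\<in>B r. t i)))
    (of_real (dirichlet_total n g w) * poly (expect_poly n g R B) (of_real (1 + w)))"
proof -
  have fin: "finite (B r)" if "r \<in> R" for r using assms(5)[OF that] by (rule finite_subset) simp
  have finA: "finite A" if "A \<in> Pow R" for A using that assms(4) finite_subset by auto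
  have finP: "finite (PiE A B)" if "A \<in> Pow R" for A
    using that fin finA[OF that] by (intro finite_PiE) auto
  have 1: "(\<lambda>t. complex_of_real (\<Prod>r\<in>R. 1 + (\<Sum>i\<in>B r. t i))) =
      (\<lambda>t. \<Sum>A\<in>Pow R. \<Sum>c\<in>PiE A B. of_real (\<Prod>r\<in>A. t (c r)))"
  proof
    fix t
    have "(\<Prod>r\<in>R. 1 + (\<Sum>i\<in>B r. t i)) = (\<Sum>A\<in>Pow R. \<Sum>c\<in>PiE A B. \<Prod>r\<in>A. t (c r))" for t :: "nat \<Rightarrow> real"
      by (rule prod_one_plus_sum[OF assms(4) fin])
    then show "complex_of_real (\<Prod>r\<in>R. 1 + (\<Sum>i\<in>B r. t i)) = (\<Sum>A\<in>Pow R. \<Sum>c\<in>PiE A B. of_real (\<Prod>r\<in>A. t (c r)))"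
      by (simp only: of_real_sum)
  qed
  have 2: "of_real (dirichlet_total n g w) * poly (expect_poly n g R B) (of_real (1 + w)) =
     (\<Sum>A\<in>Pow R. \<Sum>c\<in>PiE A B. of_real (dirichlet_total n g w) *
        of_real (dirichlet_moment n g (\<lambda>i. card {r\<in>A. c r = i}) * w ^ card A))"
    unfolding expect_poly_def poly_sum sum_distrib_left by (simp add: poly_power)
  show ?thesis
    unfolding 1 2
  proof (rule has_bochner_integral_density_sum)
    show "finite (Pow R)" using assms(4) by simp
    fix A assume A: "A \<in> Pow R"
    show "has_dirichlet_integral n g w (\<lambda>t. \<Sum>c\<in>PiE A B. of_real (\<Prod>r\<in>A. t (c r)))
      (\<Sum>c\<in>PiE A B. of_real (dirichlet_total n g w) *
        of_real (dirichlet_moment n g (\<lambda>i. card {r\<in>A. c r = i}) * w ^ card A))"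
    proof (rule has_bochner_integral_density_sum[OF finP[OF A]])
      fix c assume c: "c \<in> PiE A B"
      have "c r \<in> {1..n}" if "r \<in> A" for r
        using c that A assms(5)[of r] PiE_mem[OF c that] by blast
      then show "has_dirichlet_integral n g w (\<lambda>t. of_real (\<Prod>r\<in>A. t (c r)))
        (of_real (dirichlet_total n g w) * of_real (dirichlet_moment n g (\<lambda>i. card {r\<in>A. c r = i}) * w ^ card A))"
        by (rule has_bochner_integral_density_monomial[OF assms(1-3) finA[OF A]])
    qed
  qed
qed

text \<open>Origin of the Pochhammer ratios: raising the first argument of
  \<open>Beta (i * g) g\<close> by \<open>K\<close> multiplies it by
  \<open>pochhammer (i * g) K / pochhammer ((i + 1) * g) K\<close>.\<close>

lemma dirichlet_value_const:
  assumes "g > 0" "n \<ge> 1"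
  shows "dirichlet_value n (\<lambda>_. g) k = Gamma g ^ n / Gamma (real n * g) *
    (\<Prod>i\<in>{1..<n}. pochhammer (real i * g) (\<Sum>j=1..i. k j) / pochhammer (real (i + 1) * g) (\<Sum>j=1..i. k j))"
proof -
  have pos: "real i * g \<notin> \<int>\<^sub>\<le>\<^sub>0" if "i \<ge> 1" for i
  proof -
    have "real i * g > 0" using that assms by simp
    then show ?thesis using nonpos_Ints_nonpos[of "real i * g"] by auto
  qed
  have "dirichlet_value n (\<lambda>_. g) k = (\<Prod>i\<in>{1..<n}. Beta (real i * g) g *
     (pochhammer (real i * g) (\<Sum>j=1..i. k j) / pochhammer (real (i + 1) * g) (\<Sum>j=1..i. k j)))"
    unfolding dirichlet_value_def
  proof (intro prod.cong refl)
    fix i assume i: "i \<in> {1..<n}"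
    define K where "K = (\<Sum>j=1..i. k j)"
    have p: "pochhammer (real i * g) K = Gamma (real i * g + real K) / Gamma (real i * g)"
      using pos[of i] i by (intro pochhammer_Gamma) auto
    have p': "pochhammer (real (i + 1) * g) K = Gamma (real (i + 1) * g + real K) / Gamma (real (i + 1) * g)"
      using pos[of "i + 1"] by (intro pochhammer_Gamma) auto
    have nz: "Gamma (real i * g) \<noteq> 0" "Gamma (real (i + 1) * g) \<noteq> 0" "Gamma (real (i + 1) * g + real K) \<noteq> 0"
      using i assms by (auto intro!: Gamma_real_nonzero add_pos_nonneg)
    have 1: "real i * g + real K + g = real (i + 1) * g + real K" and 2: "real i * g + g = real (i + 1) * g"
      by (simp_all add: algebra_simps)
    have "Beta (real i * g + real K) g = Beta (real i * g) g *
        (pochhammer (real i * g) K / pochhammer (real (i + 1) * g) K)"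
      unfolding p p' Beta_def 1 2 using nz by simp
    then show "Beta ((\<Sum>i\<in>{1..i}. g) + (\<Sum>i\<in>{1..i}. real (k i))) g = Beta (real i * g) g *
     (pochhammer (real i * g) (\<Sum>j=1..i. k j) / pochhammer (real (i + 1) * g) (\<Sum>j=1..i. k j))"
      by (simp add: K_def)
  qed
  also have "\<dots> = (\<Prod>i\<in>{1..<n}. Beta (real i * g) g) *
    (\<Prod>i\<in>{1..<n}. pochhammer (real i * g) (\<Sum>j=1..i. k j) / pochhammer (real (i + 1) * g) (\<Sum>j=1..i. k j))"
    by (rule prod.distrib)
  also have "(\<Prod>i\<in>{1..<n}. Beta (real i * g) g) = Gamma g ^ n / Gamma (real n * g)"
    using dirichlet_value_powers[of "\<lambda>_. g" n] assms by (simp add: dirichlet_value_def)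
  finally show ?thesis .
qed

section \<open>Powers of partial sums, and the expectation attached to the columns of a
  partition\<close>

lemma power_one_plus_expand:
  fixes t :: "nat \<Rightarrow> 'a::comm_semiring_1"
  shows "(\<Prod>i\<in>{1..<n}. (1 + t i) ^ e i) =
    (\<Sum>k\<in>(\<Pi>\<^sub>E i\<in>{1..<n}. {0..e i}). (\<Prod>i\<in>{1..<n}. of_nat (e i choose k i)) * (\<Prod>i\<in>{1..<n}. t i ^ k i))"
proof -
  have "(1 + t i) ^ e i = (\<Sum>k\<in>{0..e i}. of_nat (e i choose k) * t i ^ k)" for i
    using binomial_ring[of "t i" 1 "e i"] by (simp add: add.commute atLeast0AtMost)
  then show ?thesis by (simp add: prod_sum_PiE prod.distrib)
qed

lemma has_bochner_integral_density_partial_sums: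
  assumes "n \<ge> 1" "w > 0" "g > 0"
  shows "has_dirichlet_integral n g w (\<lambda>t. of_real (\<Prod>k\<in>{1..<n}. (1 + (\<Sum>i\<in>{1..k}. t i)) ^ e k))
    (of_real (dirichlet_total n g w) * of_real (\<Sum>k\<in>(\<Pi>\<^sub>E i\<in>{1..<n}. {0..e i}). \<Prod>i\<in>{1..<n}.
       w ^ k i * real (e i choose k i) *
       (pochhammer (real i * g) (\<Sum>j=1..i. k j) / pochhammer (real (i + 1) * g) (\<Sum>j=1..i. k j))))"
proof -
  let ?h = "\<lambda>k i. pochhammer (real i * g) (\<Sum>j=1..i. k j) / pochhammer (real (i + 1) * g) (\<Sum>j=1..i. k j)"
  let ?v = "\<lambda>k. w powr ((\<Sum>i\<in>{1..n}. g) + (\<Sum>i\<in>{1..<n}. real (k i)) - 1) * dirichlet_value n (\<lambda>_. g) k"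
  have 1: "(\<lambda>t. complex_of_real (\<Prod>k\<in>{1..<n}. (1 + (\<Sum>i\<in>{1..k}. t i)) ^ e k)) =
     (\<lambda>t. \<Sum>k\<in>(\<Pi>\<^sub>E i\<in>{1..<n}. {0..e i}). of_real (\<Prod>i\<in>{1..<n}. real (e i choose k i)) *
        of_real (\<Prod>i\<in>{1..<n}. (\<Sum>j\<in>{1..i}. t j) ^ k i))"
    unfolding power_one_plus_expand by simp
  have 2: "of_real (dirichlet_total n g w) * complex_of_real (\<Sum>k\<in>(\<Pi>\<^sub>E i\<in>{1..<n}. {0..e i}). \<Prod>i\<in>{1..<n}.
       w ^ k i * real (e i choose k i) *
       ?h k i) =
    (\<Sum>k\<in>(\<Pi>\<^sub>E i\<in>{1..<n}. {0..e i}). of_real (\<Prod>i\<in>{1..<n}. real (e i choose k i)) *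
      of_real (?v k))"
    unfolding of_real_sum sum_distrib_left
  proof (intro sum.cong refl)
    fix k
    have "w powr ((\<Sum>i\<in>{1..n}. g) + (\<Sum>i\<in>{1..<n}. real (k i)) - 1) =
        w powr (real n * g - 1) * (\<Prod>i\<in>{1..<n}. w ^ k i)"
    proof -
      have "w powr (real n * g + real (\<Sum>i\<in>{1..<n}. k i) - 1) = w powr (real n * g - 1) * w ^ (\<Sum>i\<in>{1..<n}. k i)"
        using assms(2) by (simp add: powr_realpow[symmetric] powr_add[symmetric] algebra_simps del: of_nat_sum)
      then show ?thesis by (simp add: power_sum)
    qed
    then have "(\<Prod>i\<in>{1..<n}. real (e i choose k i)) *
        (?v k) =
       dirichlet_total n g w * (\<Prod>i\<in>{1..<n}. w ^ k i * real (e i choose k i) *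
       ?h k i)"
      unfolding dirichlet_value_const[OF assms(3,1)] dirichlet_total_def prod.distrib by (simp add: mult_ac)
    then show "of_real (dirichlet_total n g w) * complex_of_real (\<Prod>i\<in>{1..<n}. w ^ k i * real (e i choose k i) *
       ?h k i) =
      of_real (\<Prod>i\<in>{1..<n}. real (e i choose k i)) *
      of_real (?v k)"
      unfolding of_real_mult[symmetric] by (simp only:)
  qed
  have 3: "has_dirichlet_integral n g w (\<lambda>t. of_real (\<Prod>i\<in>{1..<n}. (\<Sum>j\<in>{1..i}. t j) ^ k i))
      (of_real (?v k))" for k
    using assms by (intro has_bochner_integral_dirichlet) (auto simp: dirichlet_weight_def)
  show ?thesis
    unfolding 1 2 by (intro has_bochner_integral_density_sum has_bochner_integral_density_cmult 3) (auto intro!: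
      finite_PiE)
qed

text \<open>Factors are grouped by column length: exactly \<open>lk mu k - lk mu (k + 1)\<close>
  columns have length \<open>k\<close>. Length \<open>n\<close> is split off, since on the simplex
  its factor is constant and becomes the power of \<open>z\<close>.\<close>

lemma prod_columns:
  fixes t :: "nat \<Rightarrow> 'a::comm_semiring_1"
  assumes mu: "is_partition n mu" and "n \<ge> 1"
  shows "(\<Prod>r\<in>{1..lk mu 1}. 1 + (\<Sum>i\<in>rows_ge n mu r. t i)) =
    (1 + (\<Sum>i\<in>{1..n}. t i)) ^ lk mu n * (\<Prod>k\<in>{1..<n}. (1 + (\<Sum>i\<in>{1..k}. t i)) ^ (lk mu k - lk mu (k + 1)))"
proof -
  define c where "c r = card (rows_ge n mu r)" for r
  have col: "rows_ge n mu r = {1..c r}" for r unfolding c_def by (rule column_eq[OF mu])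
  have c: "c r \<in> {1..n}" if "r \<in> {1..lk mu 1}" for r
  proof -
    have "1 \<in> rows_ge n mu r" using that assms(2) by (simp add: rows_ge_def)
    then have "c r \<ge> 1" unfolding col by simp
    moreover have "c r \<le> n"
    proof -
      have "rows_ge n mu r \<subseteq> {1..n}" by (auto simp: rows_ge_def)
      then have "card (rows_ge n mu r) \<le> card {1..n}" by (intro card_mono) auto
      then show ?thesis by (simp add: c_def)
    qed
    ultimately show ?thesis by simp
  qed
  have fib: "{r \<in> {1..lk mu 1}. c r = k} = {Suc (lk mu (k + 1))..lk mu k}" if k: "k \<in> {1..n}" for k
  proof -
    \<comment> \<open>This value lets \<open>k = n\<close> follow the same rule as the smaller
      lengths.\<close>
    have 0: "lk mu (n + 1) = 0" using mu by (intro lookup_outside[of _ "{1..n}"]) (auto simp: is_partition_def)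
    have "c r = k \<longleftrightarrow> k \<in> rows_ge n mu r \<and> k + 1 \<notin> rows_ge n mu r" for r
      unfolding col using k by auto
    moreover have "k + 1 \<notin> rows_ge n mu r \<longleftrightarrow> lk mu (k + 1) < r" if "r \<ge> 1" for r
      using k 0 that by (cases "k = n") (auto simp: rows_ge_def)
    moreover have "k \<in> rows_ge n mu r \<longleftrightarrow> r \<le> lk mu k" for r
      using k by (simp add: rows_ge_def)
    ultimately have "c r = k \<longleftrightarrow> Suc (lk mu (k + 1)) \<le> r \<and> r \<le> lk mu k" if "r \<ge> 1" for r
      using that by (metis Suc_le_eq)
    moreover have "lk mu k \<le> lk mu 1" using k partition_antimono[OF mu, of 1 k] by simp
    ultimately show ?thesis by (intro set_eqI) (smt (verit) One_nat_def Suc_le_eq atLeastAtMost_iff le_trans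
      less_Suc_eq_le mem_Collect_eq not_less_eq_eq zero_le)
  qed
  have "(\<Prod>r\<in>{1..lk mu 1}. 1 + (\<Sum>i\<in>rows_ge n mu r. t i)) = (\<Prod>r\<in>{1..lk mu 1}. (\<lambda>k. 1 + (\<Sum>i\<in>{1..k}. t i)) (c r))"
    unfolding col ..
  also have "\<dots> = (\<Prod>k\<in>{1..n}. (1 + (\<Sum>i\<in>{1..k}. t i)) ^ card {r \<in> {1..lk mu 1}. c r = k})"
    using c by (intro prod_fibers) auto
  also have "\<dots> = (\<Prod>k\<in>{1..n}. (1 + (\<Sum>i\<in>{1..k}. t i)) ^ (lk mu k - lk mu (k + 1)))"
    by (intro prod.cong refl) (simp only: fib card_atLeastAtMost diff_Suc_Suc)
  also have "{1..n} = insert n {1..<n}" using assms(2) by auto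
  also have "(\<Prod>k\<in>insert n {1..<n}. (1 + (\<Sum>i\<in>{1..k}. t i)) ^ (lk mu k - lk mu (k + 1))) =
     (1 + (\<Sum>i\<in>{1..n}. t i)) ^ lk mu n * (\<Prod>k\<in>{1..<n}. (1 + (\<Sum>i\<in>{1..k}. t i)) ^ (lk mu k - lk mu (k + 1)))"
  proof -
    have "lk mu (n + 1) = 0" using mu by (intro lookup_outside[of _ "{1..n}"]) (auto simp: is_partition_def)
    then show ?thesis by simp
  qed
  finally show ?thesis .
qed

lemma poly_eq_on_reals:
  fixes p q :: "complex poly"
  assumes "\<And>x::real. x > 1 \<Longrightarrow> poly p (of_real x) = poly q (of_real x)"
  shows "p = q"
proof (rule ccontr)
  assume "p \<noteq> q"
  then have "finite {x. poly (p - q) x = 0}" by (intro poly_roots_finite) simp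
  moreover have "complex_of_real ` {1<..} \<subseteq> {x. poly (p - q) x = 0}" using assms by auto
  ultimately have "finite (complex_of_real ` {1<..})" using finite_subset by blast
  then show False using finite_imageD[of complex_of_real "{1<..}"] infinite_Ioi by (auto simp: inj_on_def)
qed

lemma choose_pochhammer:
  fixes z :: "'a::field_char_0"
  shows "(z - 1) ^ k * of_nat (e choose k) = (1 - z) ^ k * (pochhammer (- of_nat e) k / fact k)"
proof -
  have "of_nat (e choose k) = (- 1) ^ k * pochhammer (- of_nat e) k / (fact k :: 'a)"
    by (simp add: binomial_gbinomial gbinomial_pochhammer)
  moreover have "(z - 1) ^ k * (- 1) ^ k = (1 - z) ^ k"
    unfolding power_mult_distrib[symmetric] by simp
  ultimately show ?thesis by (simp add: mult.assoc[symmetric])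
qed

text \<open>The same Dirichlet integral is evaluated twice: by multiplying out factor by factor, and
  after grouping the columns by length. Agreement for real \<open>z > 1\<close> is an identity of
  polynomials, hence holds for every complex \<open>z\<close>.\<close>

lemma poly_expect_columns:
  fixes z :: complex
  assumes mu: "is_partition n mu" and n: "n \<ge> 1" and g: "g > 0"
  shows "poly (expect_poly n g {1..lk mu 1} (columns n mu)) z = z ^ lk mu n *
    (\<Sum>k\<in>(\<Pi>\<^sub>E i\<in>{1..<n}. {0..lk mu i - lk mu (i + 1)}).
      \<Prod>i\<in>{1..<n}. (1 - z) ^ k i *
        (pochhammer (- of_nat (lk mu i - lk mu (i + 1))) (k i) / fact (k i)) *
        (pochhammer (of_nat i * of_real g) (\<Sum>j=1..i. k j)
          / pochhammer (of_nat (i + 1) * of_real g) (\<Sum>j=1..i. k j)))"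
proof -
  define e where "e i = lk mu i - lk mu (i + 1)" for i
  define h where "h k i = pochhammer (real i * g) (\<Sum>j=1..i. k j) / pochhammer (real (i + 1) * g) (\<Sum>j=1..i. k j)"
    for k :: "nat \<Rightarrow> nat" and i
  define p where "p = expect_poly n g {1..lk mu 1} (columns n mu)"
  define q where "q = [:0, 1:] ^ lk mu n * (\<Sum>k\<in>(\<Pi>\<^sub>E i\<in>{1..<n}. {0..e i}). \<Prod>i\<in>{1..<n}.
     [:- 1, 1:] ^ k i * [:of_nat (e i choose k i):] * [:complex_of_real (h k i):])"
  let ?E = "\<lambda>w. \<Sum>k\<in>(\<Pi>\<^sub>E i\<in>{1..<n}. {0..e i}).
    \<Prod>i\<in>{1..<n}. w ^ k i * real (e i choose k i) * h k i"
  let ?X = "\<lambda>t. complex_of_real (\<Prod>r\<in>{1..lk mu 1}. 1 + (\<Sum>i\<in>columns n mu r. t i))"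
  let ?Y = "\<lambda>w t. complex_of_real ((1 + w) ^ lk mu n) * of_real (\<Prod>k\<in>{1..<n}. (1 + (\<Sum>i\<in>{1..k}. t i)) ^ e k)"
  have "p = q"
  proof (rule poly_eq_on_reals)
    fix x :: real assume "x > 1"
    define w where "w = x - 1"
    have w: "w > 0" using \<open>x > 1\<close> by (simp add: w_def)
    have x: "x = 1 + w" by (simp add: w_def)
    have "has_dirichlet_integral n g w ?X
       (of_real (dirichlet_total n g w) * poly p (of_real (1 + w)))"
      unfolding p_def using n w g by (intro has_bochner_integral_density_expect) (auto simp: rows_ge_def)
    \<comment> \<open>On the simplex the coordinates sum to \<open>w\<close>, so the columns of
      length \<open>n\<close> contribute the constant \<open>(1 + w) ^ lk mu n\<close>.\<close>
    moreover have "dirichlet_density n g w ?X =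
       dirichlet_density n g w (?Y w)"
    proof
      fix t
      have "{1..n} = insert n {1..<n}" using n by auto
      then have "(\<Sum>i\<in>{1..n}. simplex_from n 1 w t i) = w" by (simp add: simplex_from_def)
      then have "(\<Prod>r\<in>{1..lk mu 1}. 1 + (\<Sum>i\<in>columns n mu r. simplex_from n 1 w t i)) =
        (1 + w) ^ lk mu n * (\<Prod>k\<in>{1..<n}. (1 + (\<Sum>i\<in>{1..k}. simplex_from n 1 w t i)) ^ e k)"
        using prod_columns[OF mu n, of "simplex_from n 1 w t"] by (simp add: e_def)
      then show "dirichlet_density n g w ?X t =
         dirichlet_density n g w (?Y w) t"
        unfolding dirichlet_density_def Let_def by (simp only: of_real_mult)
    qed
    moreover have "has_dirichlet_integral n g w (?Y w)
       (of_real ((1 + w) ^ lk mu n) * (of_real (dirichlet_total n g w) * of_real (?E w)))"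
      unfolding h_def by (intro has_bochner_integral_density_cmult has_bochner_integral_density_partial_sums n w g)
    ultimately have "of_real (dirichlet_total n g w) * poly p (of_real (1 + w)) =
      of_real ((1 + w) ^ lk mu n) * (of_real (dirichlet_total n g w) * of_real (?E w))"
      by (simp only: has_bochner_integral_eq)
    moreover have "dirichlet_total n g w \<noteq> 0"
      using w g n by (simp add: dirichlet_total_def Gamma_real_nonzero)
    ultimately have "poly p (of_real (1 + w)) = of_real ((1 + w) ^ lk mu n) * of_real (?E w)"
      by simp
    also have "\<dots> = poly q (of_real (1 + w))"
      by (simp add: q_def poly_sum poly_prod poly_power mult_ac)
    finally show "poly p (of_real x) = poly q (of_real x)" unfolding x .
  qed
  have hc: "complex_of_real (h k i) = pochhammer (of_nat i * of_real g) (\<Sum>j=1..i. k j) / pochhammer (of_nat (i +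
    1) * of_real g) (\<Sum>j=1..i. k j)" for k i
    unfolding h_def by (simp add: pochhammer_of_real[symmetric])
  have "poly p z = z ^ lk mu n * (\<Sum>k\<in>(\<Pi>\<^sub>E i\<in>{1..<n}. {0..e i}). \<Prod>i\<in>{1..<n}.
      (z - 1) ^ k i * of_nat (e i choose k i) * complex_of_real (h k i))"
    unfolding \<open>p = q\<close> q_def by (simp add: poly_sum poly_prod poly_power mult_ac)
  then show ?thesis
    unfolding p_def[symmetric] hc[symmetric] choose_pochhammer e_def[symmetric] .
qed

section \<open>Change of variables for complex integrands\<close>

lemma ordered_point_pos:
  assumes "ordered_point n y" "i \<in> {1..n}"
  shows "y i > 0"
proof -
  have "1 \<le> i" "i \<le> n" using assms(2) by auto
  then show ?thesis
  proof (induction i rule: dec_induct)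
    case base
    then show ?case using assms(1) by (simp add: ordered_point_def)
  next
    case (step k)
    then have "y k < y (k + 1)" using assms(1) by (simp add: ordered_point_def)
    with step show ?case by simp
  qed
qed

lemma ordered_point_less:
  assumes "ordered_point n y" "1 \<le> i" "i < k" "k \<le> n"
  shows "y i < y k"
proof -
  have "Suc i \<le> k" using assms(3) by simp
  then show ?thesis using assms(4)
  proof (induction k rule: dec_induct)
    case base
    then show ?case using assms(1,2) by (simp add: ordered_point_def)
  next
    case (step k)
    then have "y k < y (k + 1)" using assms(1,2) by (simp add: ordered_point_def)
    with step show ?case by simp
  qed
qed

lemma interlace_less:
  assumes y: "ordered_point n y" and x: "interlace_from n 1 y x" and "1 \<le> i" "i < k" "k \<le> n"
  shows "x i < y k" "x i < x k"
proof -
  have "x i < y (i + 1)" "y k < x k" using x assms(3-) by (auto simp: interlace_from_def)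
  moreover have "y (i + 1) \<le> y k" using ordered_point_less[OF y, of "i + 1" k] assms(3-) by (cases "i + 1 = k") auto
  ultimately show "x i < y k" "x i < x k" by auto
qed

lemma interlace_pos:
  assumes "ordered_point n y" "interlace_from n 1 y x" "i \<in> {1..n}"
  shows "x i > 0"
proof -
  have "y i < x i" using assms(2,3) by (simp add: interlace_from_def)
  then show ?thesis using ordered_point_pos[OF assms(1,3)] by simp
qed

lemma vandermonde_pos:
  assumes "\<And>i k. 1 \<le> i \<Longrightarrow> i < k \<Longrightarrow> k \<le> n \<Longrightarrow> x i < x k"
  shows "vandermonde_from n 1 x > 0"
  unfolding vandermonde_from_def by (intro prod_pos ballI) (use assms in auto)

lemma jac_nonneg:
  assumes "ordered_point n y" "interlace_from n 1 y x"
  shows "jac_from n 1 y x \<ge> 0"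
proof -
  have "(\<Prod>i\<in>{1..<n}. x i) > 0" using interlace_pos[OF assms] by (intro prod_pos ballI) auto
  then show ?thesis
    using vandermonde_pos[of n x] vandermonde_pos[of n y] interlace_less[OF assms] ordered_point_less[OF assms(1)]
    by (simp add: jac_from_def less_imp_le)
qed

text \<open>Interlacing gives \<open>x k - y i\<close> and \<open>y k - y i\<close> the same sign
  for \<open>k \<noteq> i\<close>, and \<open>x i - y i\<close> is positive.\<close>

lemma tau_pos:
  assumes y: "ordered_point n y" and x: "interlace_from n 1 y x" and i: "i \<in> {1..n}"
  shows "tau_from n 1 y x i > 0"
proof -
  have "(\<Prod>k\<in>{1..n}. x k - y i) = (x i - y i) * (\<Prod>k\<in>{1..n} - {i}. x k - y i)"
    using i by (intro prod.remove) auto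
  then have "xi_from n 1 y x i = (x i - y i) * (\<Prod>k\<in>{1..n} - {i}. (x k - y i) / (y k - y i))"
    by (simp add: xi_from_def prod_dividef)
  moreover have "x i - y i > 0" using x i by (simp add: interlace_from_def)
  moreover have "(\<Prod>k\<in>{1..n} - {i}. (x k - y i) / (y k - y i)) > 0"
  proof (intro prod_pos ballI)
    fix k assume k: "k \<in> {1..n} - {i}"
    show "(x k - y i) / (y k - y i) > 0"
    proof (cases "k < i")
      case True
      then have "x k < y i" "y k < y i"
        using interlace_less(1)[OF y x, of k i] ordered_point_less[OF y, of k i] k i by auto
      then show ?thesis by (intro divide_neg_neg) auto
    next
      case False
      then have "y i < y k" "y k < x k"
        using ordered_point_less[OF y, of i k] x k i by (auto simp: interlace_from_def)
      then show ?thesis by (intro divide_pos_pos) auto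
    qed
  qed
  ultimately have "xi_from n 1 y x i > 0" by simp
  then show ?thesis using ordered_point_pos[OF y i] i by (simp add: tau_from_def)
qed

text \<open>For indicators the nonnegative identity says that two weighted measures have the same
  image on coordinate space; the transformation rule for Bochner integrals then asks only for
  measurability of \<open>H\<close>, so no integrability has to be established.\<close>

theorem change_of_variables_integral:
  fixes H :: "(nat \<Rightarrow> real) \<Rightarrow> complex"
  assumes n: "n \<ge> 1" and y: "ordered_point n y" and z: "z > 0"
    and H: "H \<in> borel_measurable (leb {1..n})"
  shows "(\<integral>u. (let x = graph_from n 1 y z u in
      if interlace_from n 1 y x then of_real (jac_from n 1 y x) * H (tau_from n 1 y x) else 0) \<partial>leb {1..<n}) =
    (\<integral>t. simplex_integrand n 1 (z - 1) H t \<partial>leb {1..<n})"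
proof -
  let ?N = "leb {1..n}"
  define v where "v x = (if interlace_from n 1 y x then jac_from n 1 y x else 0)" for x
  define p where "p t = (if \<forall>i\<in>{1..n}. t i > 0 then 1 else 0 :: real)" for t :: "nat \<Rightarrow> real"
  define P where "P u = tau_from n 1 y (graph_from n 1 y z u)" for u
  define w1 where "w1 u = v (graph_from n 1 y z u)" for u
  define w2 where "w2 t = p (simplex_from n 1 (z - 1) t)" for t
  have v0: "v x \<ge> 0" for x using jac_nonneg[OF y] by (simp add: v_def)
  have vm: "v \<in> borel_measurable ?N" unfolding v_def[abs_def] by measurable
  have pm: "p \<in> borel_measurable ?N" unfolding p_def[abs_def] by measurable
  have w1[measurable]: "w1 \<in> borel_measurable (leb {1..<n})"
    unfolding w1_def[abs_def] by (rule measurable_compose[OF measurable_graph_from[OF n] vm])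
  have w2[measurable]: "w2 \<in> borel_measurable (leb {1..<n})"
    unfolding w2_def[abs_def] by (rule measurable_compose[OF measurable_simplex_from[OF n] pm])
  have P[measurable]: "P \<in> leb {1..<n} \<rightarrow>\<^sub>M ?N"
    unfolding P_def[abs_def] by (rule measurable_compose[OF measurable_graph_from[OF n] measurable_tau_from])
  note S[measurable] = measurable_simplex_from[OF n, of "z - 1"]
  define M1 where "M1 = density (leb {1..<n}) (\<lambda>u. ennreal (w1 u))"
  define M2 where "M2 = density (leb {1..<n}) (\<lambda>u. ennreal (w2 u))"
  have s1: "sets M1 = sets (leb {1..<n})" and s2: "sets M2 = sets (leb {1..<n})" by (simp_all add: M1_def M2_def)
  have P1: "P \<in> M1 \<rightarrow>\<^sub>M ?N" using P measurable_cong_sets[OF s1 refl] by blast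
  have S2: "simplex_from n 1 (z - 1) \<in> M2 \<rightarrow>\<^sub>M ?N" using S measurable_cong_sets[OF s2 refl] by blast
  have "distr M1 ?N P = distr M2 ?N (simplex_from n 1 (z - 1))"
  proof (rule measure_eqI)
    fix A assume "A \<in> sets (distr M1 ?N P)"
    then have A: "A \<in> sets ?N" by simp
    have iP: "(\<lambda>u. indicator A (P u) :: ennreal) \<in> borel_measurable (leb {1..<n})"
      by (rule measurable_compose[OF P]) (use A in simp)
    have iS: "(\<lambda>u. indicator A (simplex_from n 1 (z - 1) u) :: ennreal) \<in> borel_measurable (leb {1..<n})"
      by (rule measurable_compose[OF S]) (use A in simp)
    have "emeasure (distr M1 ?N P) A = (\<integral>\<^sup>+x. indicator A x \<partial>distr M1 ?N P)"
      using A by simp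
    also have "\<dots> = (\<integral>\<^sup>+u. indicator A (P u) \<partial>M1)"
      using A by (intro nn_integral_distr P1) simp
    also have "\<dots> = (\<integral>\<^sup>+u. ennreal (w1 u) * indicator A (P u) \<partial>leb {1..<n})"
      unfolding M1_def by (rule nn_integral_density[OF measurable_compose[OF w1 measurable_ennreal] iP])
    also have "\<dots> = (\<integral>\<^sup>+u. jacobian_integrand n 1 y z (indicator A) u \<partial>leb {1..<n})"
      by (intro nn_integral_cong) (simp add: w1_def v_def P_def Let_def)
    also have "\<dots> = (\<integral>\<^sup>+t. simplex_integrand n 1 (z - 1) (indicator A) t \<partial>leb {1..<n})"
    proof (rule change_of_variables[OF n _ _ z])
      show "0 < y 1" using y by (simp add: ordered_point_def)
      show "strict_mono_on {1..n} y" using ordered_point_less[OF y] by (auto simp: strict_mono_on_def)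
    qed (use A in simp)
    also have "\<dots> = (\<integral>\<^sup>+u. ennreal (w2 u) * indicator A (simplex_from n 1 (z - 1) u) \<partial>leb {1..<n})"
      by (intro nn_integral_cong) (auto simp: w2_def p_def Let_def)
    also have "\<dots> = (\<integral>\<^sup>+u. indicator A (simplex_from n 1 (z - 1) u) \<partial>M2)"
      unfolding M2_def by (rule nn_integral_density[symmetric, OF measurable_compose[OF w2 measurable_ennreal] iS])
    also have "\<dots> = (\<integral>\<^sup>+x. indicator A x \<partial>distr M2 ?N (simplex_from n 1 (z - 1)))"
      using A by (intro nn_integral_distr[symmetric] S2) simp
    also have "\<dots> = emeasure (distr M2 ?N (simplex_from n 1 (z - 1))) A" using A by simp
    finally show "emeasure (distr M1 ?N P) A = emeasure (distr M2 ?N (simplex_from n 1 (z - 1))) A" .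
  qed simp
  then have "(\<integral>x. H x \<partial>distr M1 ?N P) = (\<integral>x. H x \<partial>distr M2 ?N (simplex_from n 1 (z - 1)))" by simp
  also have "(\<integral>x. H x \<partial>distr M1 ?N P) = (\<integral>u. H (P u) \<partial>M1)" by (rule integral_distr[OF P1 H])
  also have "\<dots> = (\<integral>u. w1 u *\<^sub>R H (P u) \<partial>leb {1..<n})"
    unfolding M1_def using v0 by (intro integral_density measurable_compose[OF P H] w1) (simp add: w1_def)
  also have "(\<integral>x. H x \<partial>distr M2 ?N (simplex_from n 1 (z - 1))) = (\<integral>u. H (simplex_from n 1 (z - 1) u) \<partial>M2)"
    by (rule integral_distr[OF S2 H])
  also have "\<dots> = (\<integral>u. w2 u *\<^sub>R H (simplex_from n 1 (z - 1) u) \<partial>leb {1..<n})"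
    unfolding M2_def by (intro integral_density measurable_compose[OF S H] w2) (simp add: w2_def p_def)
  finally have "(\<integral>u. w1 u *\<^sub>R H (P u) \<partial>leb {1..<n}) = (\<integral>u. w2 u *\<^sub>R H (simplex_from n 1 (z - 1) u) \<partial>leb {1..<n})" .
  moreover have "(\<lambda>u. w1 u *\<^sub>R H (P u)) = (\<lambda>u. let x = graph_from n 1 y z u in
      if interlace_from n 1 y x then of_real (jac_from n 1 y x) * H (tau_from n 1 y x) else 0)"
    by (auto simp: w1_def v_def P_def Let_def scaleR_conv_of_real fun_eq_iff)
  moreover have "(\<lambda>u. w2 u *\<^sub>R H (simplex_from n 1 (z - 1) u)) = (\<lambda>t. simplex_integrand n 1 (z - 1) H t)"
    unfolding w2_def p_def Let_def by (rule ext) (simp only: if_distrib[of "\<lambda>c. c *\<^sub>R _"] scaleR_one scaleR_zero_left)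
  ultimately show ?thesis by (simp only:)
qed

section \<open>Elementary symmetric functions in the new variables\<close>

lemma prod_one_plus_subsets:
  fixes y :: "'i \<Rightarrow> real"
  assumes "finite I"
  shows "(\<Prod>k\<in>I. 1 + s * y k) = (\<Sum>S\<in>Pow I. s ^ card S * prod y S)"
proof -
  have "(\<Prod>k\<in>I. 1 + s * y k) = (\<Sum>S\<in>Pow I. \<Prod>k\<in>S. s * y k)"
    using prod_add[OF assms, of "\<lambda>k. s * y k" "\<lambda>_. 1"] by (simp add: add.commute)
  then show ?thesis by (simp add: prod.distrib)
qed

text \<open>The interpolation identity at \<open>t = - 1 / s\<close>, scaled by a power of
  \<open>s\<close>, relates the generating functions of the elementary symmetric polynomials, and
  coefficients of \<open>s\<close> are then compared. The term with \<open>\<tau> i\<close> collects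
  the subsets that contain \<open>i\<close>, which is where \<open>sum \<tau> S\<close> comes
  from.\<close>

lemma elementary_interpolation:
  fixes x y :: "'i \<Rightarrow> real"
  assumes I: "finite I" and inj: "inj_on y I" and nz: "\<And>i. i \<in> I \<Longrightarrow> y i \<noteq> 0"
    and \<tau>: "\<And>i. i \<in> I \<Longrightarrow> \<tau> i = (\<Prod>k\<in>I. x k - y i) / (\<Prod>k\<in>I - {i}. y k - y i) / y i"
  shows "(\<Sum>S | S \<subseteq> I \<and> card S = k. prod x S) = (\<Sum>S | S \<subseteq> I \<and> card S = k. prod y S * (1 + sum \<tau> S))"
proof -
  have main: "(\<Prod>k\<in>I. 1 + s * x k) = (\<Prod>k\<in>I. 1 + s * y k) + (\<Sum>i\<in>I. s * y i * \<tau> i * (\<Prod>k\<in>I - {i}. 1 + s * y k))" for s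
  proof (cases "s = 0")
    case False
    have scale: "(\<Prod>k\<in>J. 1 + s * f k) = s ^ card J * (\<Prod>k\<in>J. f k - (- 1 / s))" for J and f :: "'i \<Rightarrow> real"
    proof -
      have "1 + s * f k = s * (f k - (- 1 / s))" for k using False by (simp add: distrib_left)
      then show ?thesis by (simp only: prod.distrib prod_constant)
    qed
    have "(\<Prod>k\<in>I. 1 + s * x k) = s ^ card I * ((\<Prod>k\<in>I. y k - (- 1 / s)) +
      (\<Sum>i\<in>I. (\<Prod>k\<in>I. x k - y i) / (\<Prod>k\<in>I - {i}. y k - y i) * (\<Prod>k\<in>I - {i}. y k - (- 1 / s))))"
      unfolding scale prod_interpolation[OF I inj, of x "- 1 / s"] ..
    also have "\<dots> = (\<Prod>k\<in>I. 1 + s * y k) + (\<Sum>i\<in>I. s * y i * \<tau> i * (\<Prod>k\<in>I - {i}. 1 + s * y k))"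
      unfolding scale distrib_left sum_distrib_left
    proof (intro arg_cong2[where f = "(+)"] refl sum.cong)
      fix i assume i: "i \<in> I"
      have "card I = Suc (card (I - {i}))" using i I by (metis card_Suc_Diff1)
      then show "s ^ card I * ((\<Prod>k\<in>I. x k - y i) / (\<Prod>k\<in>I - {i}. y k - y i) * (\<Prod>k\<in>I - {i}. y k - (- 1 / s))) =
        s * y i * \<tau> i * (s ^ card (I - {i}) * (\<Prod>k\<in>I - {i}. y k - (- 1 / s)))"
        using nz[OF i] by (simp add: \<tau>[OF i])
    qed
    finally show ?thesis .
  qed simp
  have part: "s * y i * (\<Prod>k\<in>I - {i}. 1 + s * y k) = (\<Sum>S\<in>Pow I. if i \<in> S then s ^ card S * prod y S else 0)"
    if i: "i \<in> I" for s i
  proof -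
    \<comment> \<open>Replacing the constant 1 of factor \<open>i\<close> by 0 selects the subsets
      that contain \<open>i\<close>.\<close>
    have "s * y i * (\<Prod>k\<in>I - {i}. 1 + s * y k) = (\<Prod>k\<in>I. s * y k + (if k = i then 0 else 1))"
      using i I by (subst prod.remove[of I i]) (auto intro!: prod.cong simp: add.commute)
    also have "\<dots> = (\<Sum>S\<in>Pow I. (\<Prod>k\<in>S. s * y k) * (\<Prod>k\<in>I - S. if k = i then 0 else 1))"
      by (rule prod_add[OF I])
    also have "\<dots> = (\<Sum>S\<in>Pow I. if i \<in> S then s ^ card S * prod y S else 0)"
    proof (intro sum.cong refl)
      fix S assume "S \<in> Pow I"
      have "(\<Prod>k\<in>I - S. if k = i then 0 else 1 :: real) = (if i \<in> S then 1 else 0)"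
      proof (cases "i \<in> S")
        case False
        then show ?thesis using i I by (simp add: prod_zero_iff)
      qed (auto intro!: prod.neutral)
      then show "(\<Prod>k\<in>S. s * y k) * (\<Prod>k\<in>I - S. if k = i then 0 else 1) = (if i \<in> S then s ^ card S * prod y S else 0)"
        by (simp add: prod.distrib)
    qed
    finally show ?thesis .
  qed
  have "(\<Sum>S\<in>Pow I. s ^ card S * prod x S) = (\<Sum>S\<in>Pow I. s ^ card S * (prod y S * (1 + sum \<tau> S)))" for s
  proof -
    have "(\<Sum>i\<in>I. s * y i * \<tau> i * (\<Prod>k\<in>I - {i}. 1 + s * y k)) =
        (\<Sum>i\<in>I. \<Sum>S\<in>Pow I. if i \<in> S then s ^ card S * prod y S * \<tau> i else 0)"
    proof (intro sum.cong refl)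
      fix i assume "i \<in> I"
      have "s * y i * \<tau> i * (\<Prod>k\<in>I - {i}. 1 + s * y k) = (s * y i * (\<Prod>k\<in>I - {i}. 1 + s * y k)) * \<tau> i"
        by (simp add: mult_ac)
      also have "\<dots> = (\<Sum>S\<in>Pow I. if i \<in> S then s ^ card S * prod y S * \<tau> i else 0)"
        unfolding part[OF \<open>i \<in> I\<close>] sum_distrib_right by (intro sum.cong) auto
      finally show "s * y i * \<tau> i * (\<Prod>k\<in>I - {i}. 1 + s * y k) =
        (\<Sum>S\<in>Pow I. if i \<in> S then s ^ card S * prod y S * \<tau> i else 0)" .
    qed
    also have "\<dots> = (\<Sum>S\<in>Pow I. \<Sum>i\<in>I. if i \<in> S then s ^ card S * prod y S * \<tau> i else 0)" by (rule sum.swap)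
    also have "\<dots> = (\<Sum>S\<in>Pow I. s ^ card S * prod y S * sum \<tau> S)"
    proof (intro sum.cong refl)
      fix S assume "S \<in> Pow I"
      then have "I \<inter> S = S" by auto
      then show "(\<Sum>i\<in>I. if i \<in> S then s ^ card S * prod y S * \<tau> i else 0) = s ^ card S * prod y S * sum \<tau> S"
        using I by (simp add: sum.inter_restrict[symmetric] sum_distrib_left)
    qed
    finally show ?thesis
      using main[of s] unfolding prod_one_plus_subsets[OF I] by (simp add: algebra_simps sum.distrib)
  qed
  then have "poly (\<Sum>S\<in>Pow I. monom (prod x S) (card S)) s = poly (\<Sum>S\<in>Pow I. monom (prod y S * (1 +
    sum \<tau> S)) (card S)) s" for s
    by (simp add: poly_sum poly_monom mult.commute)
  then have "(\<Sum>S\<in>Pow I. monom (prod x S) (card S)) = (\<Sum>S\<in>Pow I. monom (prod y S * (1 + sum \<tau> S)) (card S))"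
    using poly_eq_poly_eq_iff by blast
  then have "coeff (\<Sum>S\<in>Pow I. monom (prod x S) (card S)) k = coeff (\<Sum>S\<in>Pow I. monom (prod y S * (1 +
    sum \<tau> S)) (card S)) k"
    by simp
  moreover have "coeff (\<Sum>S\<in>Pow I. monom (f S) (card S)) k = (\<Sum>S | S \<subseteq> I \<and> card S = k. f S)" for f :: "'i set \<Rightarrow> real"
  proof -
    have "{S. S \<subseteq> I \<and> card S = k} = Pow I \<inter> {S. card S = k}" by auto
    then show ?thesis using I by (simp only: coeff_sum coeff_monom) (simp add: sum.If_cases)
  qed
  ultimately show ?thesis by simp
qed

lemma monom_eval_add: "monom_eval (a + b) x = monom_eval a x * monom_eval b x"
proof -
  have "ks (a + b) \<subseteq> ks a \<union> ks b" by (rule keys_add)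
  then show ?thesis
    by (simp add: monom_eval_superset[of "ks a \<union> ks b"] lookup_add power_add prod.distrib)
qed

lemma monom_eval_sum: "monom_eval (\<Sum>a\<in>A. f a) x = (\<Prod>a\<in>A. monom_eval (f a) x)"
  by (induction A rule: infinite_finite_induct) (auto simp: monom_eval_add, auto simp: monom_eval_def)

lemma monom_eval_content: "monom_eval (tuple_content N B) x = (\<Prod>r\<in>{1..N}. prod x (B r))"
  by (simp add: tuple_content_def monom_eval_sum) (simp add: monom_eval_def)

lemma eval_elementary_product:
  assumes y: "ordered_point n y"
  shows "eval_mpoly (elementary_product n mu) (\<lambda>i. complex_of_real (x i)) =
    (\<Sum>B\<in>tuples n mu. monom_eval (exponents mu B) (\<lambda>i. of_real (y i)) *
      of_real (\<Prod>r\<in>{1..lk mu 1}. 1 + (\<Sum>i\<in>B r. tau_from n 1 y x i)))"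
proof -
  define T where "T r = {S. S \<subseteq> {1..n} \<and> card S = card (rows_ge n mu r)}" for r
  have fin: "finite (T r)" for r unfolding T_def by (rule finite_subset[of _ "Pow {1..n}"]) auto
  have tup: "tuples n mu = PiE {1..lk mu 1} T" unfolding tuples_def T_def ..
  have "eval_mpoly (elementary_product n mu) (\<lambda>i. complex_of_real (x i)) =
     of_real (\<Sum>B\<in>tuples n mu. \<Prod>r\<in>{1..lk mu 1}. prod x (B r))"
    unfolding elementary_product_def eval_mpoly_sum eval_mpoly_single monom_eval_content by simp
  also have "(\<Sum>B\<in>tuples n mu. \<Prod>r\<in>{1..lk mu 1}. prod x (B r)) = (\<Prod>r\<in>{1..lk mu 1}. \<Sum>S\<in>T r. prod x S)"
    unfolding tup by (rule prod_sum_PiE[symmetric]) (auto simp: fin)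
  also have "\<dots> = (\<Prod>r\<in>{1..lk mu 1}. \<Sum>S\<in>T r. prod y S * (1 + sum (tau_from n 1 y x) S))"
    unfolding T_def
  proof (intro prod.cong refl elementary_interpolation)
    show "inj_on y {1..n}"
      using ordered_point_less[OF y] by (intro strict_mono_on_imp_inj_on) (auto simp: strict_mono_on_def)
    show "y i \<noteq> 0" if "i \<in> {1..n}" for i using ordered_point_pos[OF y that] by simp
  qed (auto simp: tau_from_def xi_from_def)
  also have "\<dots> = (\<Sum>B\<in>tuples n mu. \<Prod>r\<in>{1..lk mu 1}. prod y (B r) * (1 + sum (tau_from n 1 y x) (B r)))"
    unfolding tup by (rule prod_sum_PiE) (auto simp: fin)
  finally show ?thesis by (simp add: monom_eval_content prod.distrib)
qed

section \<open>The integral operator on products of elementary polynomials\<close>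

lemma Q_graph_deriv:
  assumes "i \<in> {1..<n}" "u i \<noteq> 0"
  shows "partial_at (Q_graph n z y) i u = - Q_graph n z y u / u i"
proof -
  define K where "K = z * (\<Prod>i=1..n. y i) / (\<Prod>k\<in>{1..<n} - {i}. u k)"
  have "Q_graph n z y (u(i := t)) = K / t" for t
  proof -
    have "(\<Prod>k\<in>{1..<n}. (u(i := t)) k) = t * (\<Prod>k\<in>{1..<n} - {i}. (u(i := t)) k)"
      using assms(1) by (subst prod.remove[of _ i]) auto
    also have "(\<Prod>k\<in>{1..<n} - {i}. (u(i := t)) k) = (\<Prod>k\<in>{1..<n} - {i}. u k)"
      by (intro prod.cong) auto
    finally show ?thesis by (simp add: Q_graph_def K_def)
  qed
  moreover from this[of "u i"] have "Q_graph n z y u = K / u i" by simp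
  moreover have "((\<lambda>t. K / t) has_real_derivative - (K / u i) / u i) (at (u i))"
    using assms(2) by (auto intro!: derivative_eq_intros simp: power2_eq_square)
  ultimately show ?thesis by (simp add: partial_at_def DERIV_imp_deriv)
qed

lemma Q_constraint_deriv:
  assumes "i \<in> {1..n}" "x i \<noteq> 0"
  shows "partial_at (Q_constraint n z y) i x = (\<Prod>k\<in>{1..n}. x k) / x i"
proof -
  define K where "K = (\<Prod>k\<in>{1..n} - {i}. x k)"
  have "Q_constraint n z y (x(i := t)) = t * K - z * (\<Prod>i=1..n. y i)" for t
  proof -
    have "(\<Prod>k\<in>{1..n}. (x(i := t)) k) = t * (\<Prod>k\<in>{1..n} - {i}. (x(i := t)) k)"
      using assms(1) by (subst prod.remove[of _ i]) auto
    also have "(\<Prod>k\<in>{1..n} - {i}. (x(i := t)) k) = K"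
      unfolding K_def by (intro prod.cong) auto
    finally show ?thesis by (simp add: Q_constraint_def)
  qed
  moreover have "((\<lambda>t. t * K - z * (\<Prod>i=1..n. y i)) has_real_derivative K) (at (x i))"
    by (auto intro!: derivative_eq_intros)
  moreover have "(\<Prod>k\<in>{1..n}. x k) = x i * K"
    unfolding K_def using assms(1) by (intro prod.remove) auto
  ultimately show ?thesis using assms(2) by (simp add: partial_at_def DERIV_imp_deriv)
qed

text \<open>With \<open>P\<close> the product of the first \<open>n - 1\<close> variables, the
  partial derivatives are \<open>- x n / x i\<close> for the graph and \<open>P * x n / x i\<close>
  for the constraint. The latter is \<open>P\<close> at \<open>i = n\<close>, which matches the 1
  under the first root, so the roots differ by the factor \<open>P\<close>.\<close>

lemma surface_factor:
  assumes n: "n \<ge> 1" and u: "\<And>i. i \<in> {1..n} \<Longrightarrow> x i > 0"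
    and x: "x = u(n := Q_graph n z y u)"
  shows "sqrt (1 + (\<Sum>i\<in>{1..<n}. (partial_at (Q_graph n z y) i u)\<^sup>2)) /
     sqrt (\<Sum>i\<in>{1..n}. (partial_at (Q_constraint n z y) i x)\<^sup>2) = 1 / (\<Prod>i\<in>{1..<n}. x i)"
proof -
  define P where "P = (\<Prod>k\<in>{1..<n}. x k)"
  have P: "P > 0" unfolding P_def using u by (intro prod_pos) auto
  have ins: "{1..n} = insert n {1..<n}" using n by auto
  have xn: "x n > 0" using u n by simp
  have prod: "(\<Prod>k\<in>{1..n}. x k) = x n * P" unfolding ins P_def by simp
  have 1: "(partial_at (Q_graph n z y) i u)\<^sup>2 = (x n / x i)\<^sup>2" if "i \<in> {1..<n}" for i
  proof -
    have "u i = x i" using that x by simp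
    then have "u i \<noteq> 0" using u[of i] that by simp
    from Q_graph_deriv[where u = u and i = i, OF that this, of z y] show ?thesis using x \<open>u i =
      x i\<close> by (simp add: power2_eq_square)
  qed
  have 2: "(partial_at (Q_constraint n z y) i x)\<^sup>2 = P\<^sup>2 * (x n / x i)\<^sup>2" if "i \<in> {1..n}" for i
  proof -
    have "x i \<noteq> 0" using u[OF that] by simp
    from Q_constraint_deriv[where x = x and i = i, OF that this, of z y] show ?thesis
      unfolding prod by (simp add: power_mult_distrib power_divide)
  qed
  have "(\<Sum>i\<in>{1..n}. (partial_at (Q_constraint n z y) i x)\<^sup>2) = P\<^sup>2 * (\<Sum>i\<in>{1..n}. (x n / x i)\<^sup>2)"
    unfolding sum_distrib_left by (intro sum.cong refl 2)
  also have "(\<Sum>i\<in>{1..n}. (x n / x i)\<^sup>2) = 1 + (\<Sum>i\<in>{1..<n}. (x n / x i)\<^sup>2)"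
    unfolding ins using xn by simp
  also have "\<dots> = 1 + (\<Sum>i\<in>{1..<n}. (partial_at (Q_graph n z y) i u)\<^sup>2)"
    by (intro arg_cong2[where f = "(+)"] sum.cong refl) (simp only: 1)
  finally have "sqrt (\<Sum>i\<in>{1..n}. (partial_at (Q_constraint n z y) i x)\<^sup>2) =
      P * sqrt (1 + (\<Sum>i\<in>{1..<n}. (partial_at (Q_graph n z y) i u)\<^sup>2))"
    using P by (simp add: real_sqrt_mult)
  moreover have "1 + (\<Sum>i\<in>{1..<n}. (partial_at (Q_graph n z y) i u)\<^sup>2) > 0"
    by (intro add_pos_nonneg sum_nonneg) auto
  ultimately show ?thesis using P by (simp add: P_def)
qed

text \<open>Everything outside the polynomial cancels: \<open>xi = y * \<tau>\<close> releases the
  powers of \<open>y\<close>, the Vandermonde quotient with the surface factor is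
  \<open>jac_from\<close>, and the remaining constants and the power of \<open>z - 1\<close> invert
  the total Dirichlet mass. What is left is an expectation.\<close>

theorem Q_integral_elementary:
  assumes n: "n \<ge> 1" and g: "g > 0" and z: "z > 1" and y: "ordered_point n y"
    and p: "p = (\<Sum>mu\<in>D. Const (d mu) * elementary_product n mu)" and D: "finite D"
  shows "Q_integral n g z p y = (\<Sum>mu\<in>D. d mu * (\<Sum>B\<in>tuples n mu.
    monom_eval (exponents mu B) (\<lambda>i. of_real (y i)) * poly (expect_poly n g {1..lk mu 1} B) (of_real z)))"
proof -
  let ?DI = "delta_integral n (Omega n y) (Q_constraint n z y) (Q_graph n z y)
      (\<lambda>x. of_real (vandermonde n x * (\<Prod>i=1..n. xi n y x i powr (g - 1))) * eval_mpoly p (\<lambda>i. of_real (x i)))"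
  let ?sq = "\<lambda>u x. sqrt (1 + (\<Sum>i\<in>{1..<n}. (partial_at (Q_graph n z y) i u)\<^sup>2)) /
    sqrt (\<Sum>i\<in>{1..n}. (partial_at (Q_constraint n z y) i x)\<^sup>2)"
  let ?S = "(\<Sum>mu\<in>D. d mu * (\<Sum>B\<in>tuples n mu.
    monom_eval (exponents mu B) (\<lambda>i. of_real (y i)) * poly (expect_poly n g {1..lk mu 1} B) (of_real z)))"
  let ?G = "\<lambda>H u. (let x = graph_from n 1 y z u in
    if interlace_from n 1 y x then complex_of_real (jac_from n 1 y x) * H (tau_from n 1 y x) else 0)"
  define w where "w = z - 1"
  have w: "w > 0" using z by (simp add: w_def)
  define \<Phi> where "\<Phi> t = (\<Sum>mu\<in>D. d mu * (\<Sum>B\<in>tuples n mu. monom_eval (exponents mu B) (\<lambda>i. of_real (y i)) *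
      of_real (\<Prod>r\<in>{1..lk mu 1}. 1 + (\<Sum>i\<in>B r. t i))))" for t
  define H where "H t = of_real (\<Prod>i\<in>{1..n}. t i powr (g - 1)) * \<Phi> t" for t
  define c where "c = vandermonde n y * (\<Prod>i=1..n. y i powr (g - 1))"
  have vand: "vandermonde n x = vandermonde_from n 1 x" for x
    by (simp add: vandermonde_def vandermonde_from_def)
  have xi: "xi n y x i = xi_from n 1 y x i" for x i by (simp add: xi_def xi_from_def)
  have vy: "vandermonde n y > 0" unfolding vand using ordered_point_less[OF y] by (intro vandermonde_pos)
  have "(\<Prod>i=1..n. y i powr (g - 1)) > 0" using ordered_point_pos[OF y] by (intro prod_pos) (simp, force)
  then have c: "c > 0" using vy by (simp add: c_def)
  have Hm: "H \<in> borel_measurable (leb {1..n})"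
  proof -
    have m: "(\<lambda>t. \<Sum>i\<in>B r. t i) \<in> borel_measurable (leb {1..n})" if "B \<in> tuples n mu" "r \<in> {1..lk mu 1}" for B mu r
      using tuplesD(1)[OF that] measurable_component_singleton[of _ "{1..n}" "\<lambda>_. lborel :: real measure"]
      by (intro borel_measurable_sum) auto
    have pr: "(\<lambda>t. \<Prod>r\<in>{1..lk mu 1}. 1 + (\<Sum>i\<in>B r. t i)) \<in> borel_measurable (leb {1..n})" if "B \<in> tuples n mu" for B mu
      using m[OF that] by (intro borel_measurable_prod borel_measurable_add borel_measurable_const)
    have "(\<lambda>t. complex_of_real (\<Prod>r\<in>{1..lk mu 1}. 1 + (\<Sum>i\<in>B r. t i))) \<in> borel_measurable (leb {1..n})"
      if "B \<in> tuples n mu" for B mu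
      by (rule measurable_compose[OF pr[OF that] borel_measurable_of_real])
    then have "\<Phi> \<in> borel_measurable (leb {1..n})"
      unfolding \<Phi>_def[abs_def]
      by (intro borel_measurable_sum borel_measurable_times borel_measurable_const)
    moreover have "(\<lambda>t. complex_of_real (\<Prod>i\<in>{1..n}. t i powr (g - 1))) \<in> borel_measurable (leb {1..n})"
      by measurable
    ultimately show ?thesis unfolding H_def[abs_def] by (rule borel_measurable_times[rotated])
  qed
  have "?DI =
    (\<integral>u. of_real c * ?G H u \<partial>leb {1..<n})"
    unfolding delta_integral_def
  proof (rule Bochner_Integration.integral_cong[OF refl])
    fix u :: "nat \<Rightarrow> real"
    define x where "x = u(n := Q_graph n z y u)"
    have gx: "graph_from n 1 y z u = x" by (simp add: graph_from_def x_def Q_graph_def)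
    have om: "x \<in> Omega n y \<longleftrightarrow> interlace_from n 1 y x" by (simp add: Omega_def interlace_from_def)
    have "of_real (vandermonde n x * (\<Prod>i=1..n. xi n y x i powr (g - 1))) * eval_mpoly p (\<lambda>i. of_real (x i)) *
       of_real (?sq u x) =
       of_real c * (of_real (jac_from n 1 y x) * H (tau_from n 1 y x))" if I: "interlace_from n 1 y x"
    proof -
      have s: "?sq u x = 1 / (\<Prod>i\<in>{1..<n}. x i)"
        by (rule surface_factor[OF n interlace_pos[OF y I] x_def])
      have e: "eval_mpoly p (\<lambda>i. of_real (x i)) = \<Phi> (tau_from n 1 y x)"
        unfolding p eval_mpoly_sum eval_mpoly_Const_mult eval_elementary_product[OF y] \<Phi>_def ..
      have "(\<Prod>i=1..n. xi n y x i powr (g - 1)) = (\<Prod>i=1..n. y i powr (g - 1) * tau_from n 1 y x i powr (g - 1))"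
      proof (intro prod.cong refl)
        fix i assume i: "i \<in> {1..n}"
        have "xi n y x i = y i * tau_from n 1 y x i"
          using ordered_point_pos[OF y i] i by (simp add: xi tau_from_def)
        then show "xi n y x i powr (g - 1) = y i powr (g - 1) * tau_from n 1 y x i powr (g - 1)"
          using ordered_point_pos[OF y i] tau_pos[OF y I i] by (simp add: powr_mult)
      qed
      then have "vandermonde n x * (\<Prod>i=1..n. xi n y x i powr (g - 1)) * (1 / (\<Prod>i\<in>{1..<n}. x i)) =
        c * (jac_from n 1 y x * (\<Prod>i\<in>{1..n}. tau_from n 1 y x i powr (g - 1)))"
        using vy by (simp add: c_def jac_from_def vand prod.distrib)
      from arg_cong[OF this, of complex_of_real]
      have "of_real (vandermonde n x * (\<Prod>i=1..n. xi n y x i powr (g - 1))) * of_real (1 / (\<Prod>i\<in>{1..<n}. x i)) =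
        of_real c * (of_real (jac_from n 1 y x) * complex_of_real (\<Prod>i\<in>{1..n}. tau_from n 1 y x i powr (g - 1)))"
        by (simp only: of_real_mult)
      moreover have "a * f * b = c * (d * (e * f))" if "a * b = c * (d * e)" for a b c d e f :: complex
        using arg_cong[OF that, of "\<lambda>v. v * f"] by (simp only: mult_ac)
      ultimately show ?thesis unfolding s e H_def by blast
    qed
    then show "(let x = u(n := Q_graph n z y u) in
        if x \<in> Omega n y
        then of_real (vandermonde n x * (\<Prod>i=1..n. xi n y x i powr (g - 1))) * eval_mpoly p (\<lambda>i. of_real (x i)) *
          of_real (?sq u x)
        else 0) =
      of_real c * ?G H u"
      unfolding Let_def gx x_def[symmetric] om by (cases "interlace_from n 1 y x") (simp_all only: if_True
        if_False simp_thms mult_zero_right)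
  qed
  also have "\<dots> = of_real c * (\<integral>u. ?G H u \<partial>leb {1..<n})"
    by (rule integral_mult_right_zero)
  also have "(\<integral>u. ?G H u \<partial>leb {1..<n}) =
     (\<integral>t. simplex_integrand n 1 (z - 1) H t \<partial>leb {1..<n})"
    using z by (intro change_of_variables_integral[OF n y _ Hm]) simp
  also have "(\<lambda>t. simplex_integrand n 1 (z - 1) H t) =
     dirichlet_density n g w \<Phi>"
    unfolding dirichlet_density_def[abs_def] H_def w_def ..
  also have "(\<integral>t. dirichlet_density n g w \<Phi> t \<partial>leb {1..<n}) =
     (\<Sum>mu\<in>D. d mu * (\<Sum>B\<in>tuples n mu. monom_eval (exponents mu B) (\<lambda>i. of_real (y i)) *
        (of_real (dirichlet_total n g w) * poly (expect_poly n g {1..lk mu 1} B) (of_real (1 + w)))))"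
    unfolding \<Phi>_def[abs_def]
  proof (rule has_bochner_integral_integral_eq, rule has_bochner_integral_density_sum[OF D],
      rule has_bochner_integral_density_cmult, rule has_bochner_integral_density_sum[OF finite_tuples],
      rule has_bochner_integral_density_cmult)
    fix mu B assume "B \<in> tuples n mu"
    then show "has_dirichlet_integral n g w (\<lambda>t. of_real (\<Prod>r\<in>{1..lk mu 1}. 1 + (\<Sum>i\<in>B r. t i)))
      (of_real (dirichlet_total n g w) * poly (expect_poly n g {1..lk mu 1} B) (of_real (1 + w)))"
      using tuplesD(1) by (intro has_bochner_integral_density_expect n w g) auto
  qed
  also have "\<dots> = of_real (dirichlet_total n g w) * ?S"
    unfolding sum_distrib_left by (simp add: w_def mult_ac)
  finally have "?DI =
    of_real c * (of_real (dirichlet_total n g w) * ?S)" .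
  moreover have "Gamma (real n * g) / Gamma g ^ n * ((z - 1) powr (1 - real n * g) / c) * (c *
    dirichlet_total n g w) = 1"
  proof -
    have "w powr (1 - real n * g) * w powr (real n * g - 1) = 1"
      using w by (simp add: powr_add[symmetric])
    moreover have "Gamma (real n * g) \<noteq> 0" "Gamma g \<noteq> 0" using n g by (simp_all add: Gamma_real_nonzero)
    ultimately show ?thesis using c by (simp add: dirichlet_total_def w_def field_simps)
  qed
  then have "complex_of_real (Gamma (real n * g) / Gamma g ^ n * ((z - 1) powr (1 - real n * g) / c)) *
     (of_real c * of_real (dirichlet_total n g w)) = 1"
    by (metis of_real_1 of_real_mult)
  ultimately show ?thesis
    unfolding Q_integral_def c_def[symmetric] by (simp only: mult.assoc[symmetric] mult_1_left)
qed

section \<open>The polynomial \<open>Q\<^sub>z p\<close>\<close>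

text \<open>\<open>map_poly (sng v) f\<close> encodes the polynomial \<open>f\<close> in
  \<open>z\<close> times the monomial in \<open>y\<close> with exponent vector
  \<open>v\<close>.\<close>

definition Q_expansion :: "nat \<Rightarrow> real \<Rightarrow> (nat \<Rightarrow>\<^sub>0 nat) set \<Rightarrow> ((nat \<Rightarrow>\<^sub>0 nat) \<Rightarrow> complex) \<Rightarrow> complex mpoly poly" where
  "Q_expansion n g D d = (\<Sum>mu\<in>D. \<Sum>B\<in>tuples n mu.
     map_poly (sng (exponents mu B)) (smult (d mu) (expect_poly n g {1..lk mu 1} B)))"

lemma poly_map_single:
  fixes f :: "complex poly"
  shows "poly (map_poly (sng v) f) (Const z) = sng v (poly f z)"
proof (induction f)
  case (pCons a f)
  have "map_poly (sng v) (pCons a f) = pCons (sng v a) (map_poly (sng v) f)"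
    using pCons by (intro map_poly_pCons) auto
  then show ?case by (simp only: poly_pCons pCons.IH) (simp add: Const_def mult_single single_add)
qed simp

lemma poly_Q_expansion:
  "poly (Q_expansion n g D d) (Const z) = (\<Sum>mu\<in>D. \<Sum>B\<in>tuples n mu.
     sng (exponents mu B) (d mu * poly (expect_poly n g {1..lk mu 1} B) z))"
  unfolding Q_expansion_def poly_sum poly_map_single by simp

lemma lookup_coeff_Q_expansion:
  "lk (coeff (Q_expansion n g D d) k) m = (\<Sum>mu\<in>D. \<Sum>B\<in>tuples n mu.
     if exponents mu B = m then d mu * coeff (expect_poly n g {1..lk mu 1} B) k else 0)"
  unfolding Q_expansion_def coeff_sum lookup_sum
  by (intro sum.cong refl) (simp add: coeff_map_poly lookup_single when_def)

lemma dirichlet_moment_permute: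
  assumes s: "s permutes {1..n}"
  shows "dirichlet_moment n g (\<lambda>i. a (s i)) = dirichlet_moment n g a"
  unfolding dirichlet_moment_def
  using prod.permute[OF s, of "\<lambda>i. Gamma (g + real (a i))"] sum.permute[OF s, of "\<lambda>i. g + real (a i)"]
  by (simp add: o_def)

text \<open>With equal parameters \<open>g\<close> the Dirichlet distribution is exchangeable, so
  relabelling coordinates leaves the expectation unchanged; this is why the result is symmetric in
  \<open>y\<close>.\<close>

lemma expect_poly_perm_tuple:
  assumes s: "s permutes {1..n}"
  shows "expect_poly n g {1..N} (perm_tuple s N B) = expect_poly n g {1..N} B"
proof -
  have inv: "s (inv s i) = i" "inv s (s i) = i" for i using permutes_inverses[OF s] by auto
  show ?thesis
    unfolding expect_poly_def
  proof (rule sum.cong[OF refl])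
    fix A assume A: "A \<in> Pow {1..N}"
    then have pt: "perm_tuple s N B r = s ` B r" if "r \<in> A" for r using that by (auto simp: perm_tuple_def)
    let ?f = "\<lambda>c. smult (of_real (dirichlet_moment n g (\<lambda>i. card {r\<in>A. c r = i}))) ([:- 1, 1 :: complex:] ^ card A)"
    show "(\<Sum>c\<in>PiE A (perm_tuple s N B). ?f c) =
      (\<Sum>c\<in>PiE A B. ?f c)"
    proof (rule sum.reindex_bij_witness[of _ "\<lambda>c. \<lambda>r\<in>A. s (c r)" "\<lambda>c. \<lambda>r\<in>A. inv s (c r)"])
      fix c assume c: "c \<in> PiE A (perm_tuple s N B)"
      show "(\<lambda>r\<in>A. s ((\<lambda>r\<in>A. inv s (c r)) r)) = c"
        using c by (auto simp: fun_eq_iff inv PiE_def extensional_def)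
      show "(\<lambda>r\<in>A. inv s (c r)) \<in> PiE A B"
        using c pt inv by (fastforce simp: PiE_def Pi_def)
      have "(\<lambda>i. card {r\<in>A. (\<lambda>r\<in>A. inv s (c r)) r = i}) = (\<lambda>i. (\<lambda>i. card {r\<in>A. c r = i}) (s i))"
      proof
        fix i
        have "{r\<in>A. (\<lambda>r\<in>A. inv s (c r)) r = i} = {r\<in>A. c r = s i}" using inv by auto
        then show "card {r\<in>A. (\<lambda>r\<in>A. inv s (c r)) r = i} = card {r\<in>A. c r = s i}" by simp
      qed
      then show "?f (\<lambda>r\<in>A. inv s (c r)) =
         ?f c"
        using dirichlet_moment_permute[OF s, of g "\<lambda>i. card {r\<in>A. c r = i}"] by (simp only:)
    next
      fix c assume c: "c \<in> PiE A B"
      show "(\<lambda>r\<in>A. inv s ((\<lambda>r\<in>A. s (c r)) r)) = c"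
        using c by (auto simp: fun_eq_iff inv PiE_def extensional_def)
      show "(\<lambda>r\<in>A. s (c r)) \<in> PiE A (perm_tuple s N B)"
        using c pt by (auto simp: PiE_def Pi_def)
    qed
  qed
qed

lemma symmetric_coeff_Q_expansion:
  "symmetric_mpoly n (coeff (Q_expansion n g D d) k)"
  unfolding symmetric_mpoly_def
proof (intro conjI ballI allI impI)
  fix m assume "m \<in> ks (coeff (Q_expansion n g D d) k)"
  then have "lk (coeff (Q_expansion n g D d) k) m \<noteq> 0" by (simp add: in_keys_iff)
  then obtain mu where "(\<Sum>B\<in>tuples n mu.
     if exponents mu B = m then d mu * coeff (expect_poly n g {1..lk mu 1} B) k else 0) \<noteq> 0"
    unfolding lookup_coeff_Q_expansion by (rule sum.not_neutral_contains_not_neutral)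
  then obtain B where B: "B \<in> tuples n mu"
     "(if exponents mu B = m then d mu * coeff (expect_poly n g {1..lk mu 1} B) k else 0) \<noteq> 0"
    by (rule sum.not_neutral_contains_not_neutral)
  then have "exponents mu B = m" by (auto split: if_splits)
  then show "ks m \<subseteq> {1..n}" using keys_content[of "lk mu 1" B "{1..n}"] tuplesD(1)[OF B(1)] by blast
next
  fix s m assume s: "s permutes {1..n}"
  show "lk (coeff (Q_expansion n g D d) k) (permuted s m) = lk (coeff (Q_expansion n g D d) k) m"
    unfolding lookup_coeff_Q_expansion
    by (intro sum.cong refl sum_tuples_perm s) (simp only: expect_poly_perm_tuple[OF s])
qed

lemma eval_mpoly_diff:
  fixes p q :: "'a::comm_ring_1 mpoly"
  shows "eval_mpoly (p - q) x = eval_mpoly p x - eval_mpoly q x"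
  using eval_mpoly_add[of "p - q" q x] by simp

lemma lookup_poly_Const:
  fixes R :: "complex mpoly poly"
  shows "lk (poly R (Const z)) m = (\<Sum>k\<le>degree R. z ^ k * lk (coeff R k) m)"
proof -
  have "Const z ^ k = Const (z ^ k)" for k
    by (induction k) (auto simp: Const_def mult_single single_one)
  then show ?thesis
    unfolding poly_altdef lookup_sum by (simp add: mult.commute[of "coeff R _"] lookup_Const_mult)
qed

text \<open>Uniqueness in two stages: at each real \<open>z > 1\<close> the difference vanishes at
  all ordered points and is the zero polynomial, so each of its coefficients, as a polynomial in
  \<open>z\<close>, has infinitely many zeros.\<close>

lemma Q_poly_eqI:
  assumes sym: "\<And>k. symmetric_mpoly n (coeff R k)"
    and eval: "\<And>z y. z > 1 \<Longrightarrow> ordered_point n y \<Longrightarrow>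
        eval_mpoly (poly R (Const (of_real z))) (\<lambda>i. of_real (y i)) = Q_integral n g z p y"
  shows "Q_poly n g p = R"
proof -
  let ?P = "\<lambda>R. (\<forall>k. symmetric_mpoly n (coeff R k)) \<and> (\<forall>z y. z > 1 \<longrightarrow> ordered_point n y \<longrightarrow>
        eval_mpoly (poly R (Const (of_real z))) (\<lambda>i. of_real (y i)) = Q_integral n g z p y)"
  show ?thesis unfolding Q_poly_def
  proof (rule the_equality)
  show "?P R"
    using assms by blast
  fix R' assume R': "?P R'"
  define S where "S = R' - R"
  have keys: "ks m \<subseteq> {1..n}" if "m \<in> ks (coeff S k)" for m k
  proof -
    have "m \<in> ks (coeff R' k) \<or> m \<in> ks (coeff R k)" using that by (auto simp: S_def in_keys_iff lookup_minus)
    then show ?thesis using sym R' unfolding symmetric_mpoly_def by blast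
  qed
  have 0: "poly S (Const (of_real z)) = 0" if "z > 1" for z :: real
  proof (rule eval_mpoly_ordered_eq_0[of _ n])
    fix m assume "m \<in> ks (poly S (Const (complex_of_real z)))"
    then have "(\<Sum>k\<le>degree S. of_real z ^ k * lk (coeff S k) m) \<noteq> 0"
      by (simp add: in_keys_iff lookup_poly_Const)
    then obtain k where "of_real z ^ k * lk (coeff S k) m \<noteq> 0" by (rule sum.not_neutral_contains_not_neutral)
    then have "m \<in> ks (coeff S k)" by (simp add: in_keys_iff)
    then show "ks m \<subseteq> {1..n}" by (rule keys)
  next
    fix y assume "ordered_point n y"
    then show "eval_mpoly (poly S (Const (complex_of_real z))) (\<lambda>i. of_real (y i)) = 0"
      using eval[OF that] R' that by (simp add: S_def eval_mpoly_diff)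
  qed
  have "lk (coeff S k) m = 0" for k m
  proof -
    define q where "q = (\<Sum>k\<le>degree S. monom (lk (coeff S k) m) k)"
    have "q = 0"
    proof (rule poly_eq_on_reals)
      fix x :: real assume "x > 1"
      have "poly q (of_real x) = lk (poly S (Const (of_real x))) m"
        by (simp add: q_def poly_sum poly_monom lookup_poly_Const mult.commute)
      then show "poly q (of_real x) = poly 0 (of_real x)" using 0[OF \<open>x > 1\<close>] by simp
    qed
    then have "coeff q k = 0" by simp
    then show ?thesis
      by (cases "k \<le> degree S") (auto simp: q_def coeff_sum coeff_eq_0)
  qed
  then have "S = 0" by (intro poly_eqI poly_mapping_eqI) simp
  then show "R' = R" by (simp add: S_def)
qed
qed

lemma Q_poly_elementary:
  assumes "n \<ge> 1" "g > 0" "finite D" "p = (\<Sum>mu\<in>D. Const (d mu) * elementary_product n mu)"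
  shows "Q_poly n g p = Q_expansion n g D d"
proof (rule Q_poly_eqI[OF symmetric_coeff_Q_expansion])
  fix z :: real and y assume z: "z > 1" and y: "ordered_point n y"
  have "eval_mpoly (poly (Q_expansion n g D d) (Const (of_real z))) (\<lambda>i. of_real (y i)) =
    (\<Sum>mu\<in>D. \<Sum>B\<in>tuples n mu. d mu * poly (expect_poly n g {1..lk mu 1} B) (of_real z) *
       monom_eval (exponents mu B) (\<lambda>i. of_real (y i)))"
    unfolding poly_Q_expansion eval_mpoly_sum eval_mpoly_single ..
  also have "\<dots> = Q_integral n g z p y"
    unfolding Q_integral_elementary[OF assms(1,2) z y assms(4,3)] sum_distrib_left
    by (intro sum.cong refl) (simp only: mult_ac)
  finally show "eval_mpoly (poly (Q_expansion n g D d) (Const (of_real z))) (\<lambda>i. of_real (y i)) =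
    Q_integral n g z p y" .
qed

section \<open>The leading coefficient\<close>

lemma finite_dominated_partitions:
  "finite {mu. is_partition n mu \<and> dominated n mu lam}"
proof -
  define N where "N = (\<Sum>j=1..n. lk lam j)"
  have "inj_on (\<lambda>mu. \<lambda>i\<in>{1..n}. lk mu i) {mu. is_partition n mu \<and> dominated n mu lam}"
  proof (intro inj_onI poly_mapping_eqI)
    fix mu nu i assume m: "mu \<in> {mu. is_partition n mu \<and> dominated n mu lam}" "nu \<in> {mu. is_partition n mu \<and>
      dominated n mu lam}"
      and eq: "(\<lambda>i\<in>{1..n}. lk mu i) = (\<lambda>i\<in>{1..n}. lk nu i)"
    show "lk mu i = lk nu i"
    proof (cases "i \<in> {1..n}")
      case True
      then show ?thesis using fun_cong[OF eq, of i] by simp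
    next
      case False
      then show ?thesis using m lookup_outside[of mu "{1..n}" i] lookup_outside[of nu "{1..n}" i]
        by (simp add: is_partition_def)
    qed
  qed
  moreover have "(\<lambda>mu. \<lambda>i\<in>{1..n}. lk mu i) ` {mu. is_partition n mu \<and> dominated n mu lam} \<subseteq> (\<Pi>\<^sub>E i\<in>{1..n}. {0..N})"
  proof clarify
    fix mu assume "dominated n mu lam"
    then have "(\<Sum>j=1..n. lk mu j) = N" by (simp add: dominated_def N_def)
    moreover have "lk mu i \<le> (\<Sum>j=1..n. lk mu j)" if "i \<in> {1..n}" for i
      using that by (intro member_le_sum) auto
    ultimately show "(\<lambda>i\<in>{1..n}. lk mu i) \<in> (\<Pi>\<^sub>E i\<in>{1..n}. {0..N})" by auto
  qed
  ultimately show ?thesis by (meson finite_PiE finite_atLeastAtMost finite_imageD finite_subset)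
qed

lemma dominated_refl: "dominated n mu mu"
  by (simp add: dominated_def)

lemma dominated_trans: "dominated n mu nu \<Longrightarrow> dominated n nu \<kappa> \<Longrightarrow> dominated n mu \<kappa>"
  unfolding dominated_def by (metis order_trans)

lemma dominated_antisym:
  assumes "dominated n mu nu" "dominated n nu mu" "is_partition n mu" "is_partition n nu"
  shows "mu = nu"
proof (rule partial_sums_unique[of n])
  show "partial_sums n nu \<le> partial_sums n mu"
    unfolding partial_sums_def by (intro sum_mono dominated_le[OF assms(2)])
qed (use assms dominated_le[OF assms(1)] in \<open>auto simp: is_partition_def\<close>)

lemma lookup_monomial_symmetric:
  "lk (monomial_symmetric n mu :: 'a::comm_semiring_1 mpoly) m =
    (if \<exists>s. s permutes {1..n} \<and> m = permuted s mu then 1 else 0)"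
proof -
  have "{permuted s mu |s. s permutes {1..n}} = (\<lambda>s. permuted s mu) ` {s. s permutes {1..n}}" by auto
  then have "finite {permuted s mu |s. s permutes {1..n}}"
    using finite_permutations[of "{1..n}"] by simp
  then show ?thesis
    unfolding monomial_symmetric_def lookup_sum by (auto simp: lookup_single when_def)
qed

lemma lookup_monomial_symmetric_partition:
  assumes "is_partition n mu" "is_partition n \<kappa>"
  shows "lk (monomial_symmetric n mu :: 'a::comm_semiring_1 mpoly) \<kappa> = (if \<kappa> = mu then 1 else 0)"
proof -
  have "(\<exists>s. s permutes {1..n} \<and> \<kappa> = permuted s mu) \<longleftrightarrow> \<kappa> = mu"
  proof
    assume "\<kappa> = mu"
    then show "\<exists>s. s permutes {1..n} \<and> \<kappa> = permuted s mu"
      using map_key_id[of mu] permutes_id[of "{1..n}"] by (intro exI[of _ id]) (simp add: id_def)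
  qed (use partition_perm_unique[OF assms] in blast)
  then show ?thesis by (simp add: lookup_monomial_symmetric)
qed

section \<open>Specialised Jack polynomials and the eigenvalue\<close>

lemma ratfun_eval_0 [simp]: "ratfun_eval a 0 = 0"
  by (simp add: ratfun_eval_def)

lemma ratfun_eval_1 [simp]: "ratfun_eval a 1 = 1"
  by (simp add: ratfun_eval_def)

lemma lookup_specialize: "lk (specialize a P) m = ratfun_eval a (lk P m)"
  by (simp add: specialize_def map.rep_eq when_def)

lemma symmetric_specialize:
  assumes "symmetric_mpoly n P"
  shows "symmetric_mpoly n (specialize a P)"
proof -
  have "m \<in> ks P" if "m \<in> ks (specialize a P)" for m
    using that by (auto simp: in_keys_iff lookup_specialize)
  then show ?thesis using assms by (auto simp: symmetric_mpoly_def lookup_specialize)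
qed

text \<open>The orbit of a partition under permutations contains no other partition, so at a
  partition exponent the coefficient of \<open>P\<close> is read off the expansion directly.\<close>

lemma jack_triangular:
  assumes "is_jack n g lam P" "is_partition n lam"
  shows "lk P lam = 1" "\<And>m. m \<in> ks P \<Longrightarrow> is_partition n m \<Longrightarrow> dominated n m lam"
proof -
  obtain v where v: "P = monomial_symmetric n lam +
      (\<Sum>mu\<in>{mu. is_partition n mu \<and> dominated n mu lam \<and> mu \<noteq> lam}. Const (v mu) * monomial_symmetric n mu)"
    using assms(1) by (auto simp: is_jack_def)
  have P: "lk P m = (if m = lam then 1 else 0) +
      (\<Sum>mu\<in>{mu. is_partition n mu \<and> dominated n mu lam \<and> mu \<noteq> lam}. if m = mu then v mu else 0)"
    if "is_partition n m" for m
    unfolding v lookup_add lookup_sum lookup_Const_mult lookup_monomial_symmetric_partition[OF assms(2) that]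
    by (intro arg_cong2[where f = "(+)"] sum.cong refl) (auto simp: lookup_monomial_symmetric_partition that)
  have "(\<Sum>mu\<in>{mu. is_partition n mu \<and> dominated n mu lam \<and> mu \<noteq> lam}. if lam = mu then v mu else 0) = 0"
    by (intro sum.neutral) auto
  then show "lk P lam = 1" using P[OF assms(2)] by simp
  fix m assume m: "m \<in> ks P" "is_partition n m"
  show "dominated n m lam"
  proof (rule ccontr)
    assume nd: "\<not> dominated n m lam"
    then have "m \<noteq> lam" using dominated_refl by blast
    moreover have "(\<Sum>mu\<in>{mu. is_partition n mu \<and> dominated n mu lam \<and> mu \<noteq> lam}. if m = mu then v mu else 0) = 0"
      using nd by (intro sum.neutral) auto
    ultimately have "lk P m = 0" using P[OF m(2)] by simp
    then show False using m(1) by (simp add: in_keys_iff)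
  qed
qed

text \<open>The coefficient of \<open>lam\<close> is compared on both sides. Any \<open>mu\<close>
  in \<open>D\<close> other than \<open>lam\<close> contributes only exponents dominated by
  \<open>mu\<close>, never \<open>lam\<close>, and for \<open>lam\<close> itself only the tuple of
  columns produces that exponent.\<close>

lemma eigenvalue_leading_coefficient:
  assumes n: "n \<ge> 1" and g: "g > 0" and lam: "is_partition n lam"
    and p: "symmetric_mpoly n p" "lk p lam = 1" "\<And>m. m \<in> ks p \<Longrightarrow> is_partition n m \<Longrightarrow> dominated n m lam"
    and eig: "Q_op n g z p = Const q * p"
  shows "q = poly (expect_poly n g {1..lk lam 1} (columns n lam)) z"
proof -
  define D where "D = {mu. is_partition n mu \<and> dominated n mu lam}"
  have D: "finite D" unfolding D_def by (rule finite_dominated_partitions)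
  have "\<exists>d. p = (\<Sum>mu\<in>D. Const (d mu) * elementary_product n mu)"
  proof (rule symmetric_elementary_expansion[OF n D _ _ p(1)])
    show "is_partition n mu" if "mu \<in> D" for mu using that by (simp add: D_def)
    show "\<kappa> \<in> D" if "mu \<in> D" "is_partition n \<kappa>" "dominated n \<kappa> mu" for mu \<kappa>
      using that dominated_trans[of n \<kappa> mu lam] by (simp add: D_def)
    show "m \<in> D" if "m \<in> ks p" "is_partition n m" for m using p(3) that by (simp add: D_def)
  qed
  then obtain d where d: "p = (\<Sum>mu\<in>D. Const (d mu) * elementary_product n mu)" by blast
  have lamD: "lam \<in> D" using lam dominated_refl by (simp add: D_def)
  define col where "col = columns n lam"
  \<comment> \<open>Stated for a general \<open>f\<close> as it serves twice: for the coefficient of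
    \<open>p\<close>, giving \<open>d lam = 1\<close>, and for that of its image under
    \<open>Q_op\<close>.\<close>
  have lead: "(\<Sum>mu\<in>D. \<Sum>B\<in>tuples n mu. if exponents mu B = lam then f mu B else 0) = f lam col"
    for f :: "(nat \<Rightarrow>\<^sub>0 nat) \<Rightarrow> (nat \<Rightarrow> nat set) \<Rightarrow> complex"
  proof -
    have "(\<Sum>B\<in>tuples n mu. if exponents mu B = lam then f mu B else 0) = 0" if mu: "mu \<in> D - {lam}" for mu
    proof (intro sum.neutral ballI)
      fix B assume B: "B \<in> tuples n mu"
      have "exponents mu B \<noteq> lam"
        using content_dominated[OF _ n B] dominated_antisym[of n mu lam] mu lam by (auto simp: D_def)
      then show "(if exponents mu B = lam then f mu B else 0) = 0" by simp
    qed
    then have "(\<Sum>mu\<in>D. \<Sum>B\<in>tuples n mu. if exponents mu B = lam then f mu B else 0) =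
       (\<Sum>B\<in>tuples n lam. if exponents lam B = lam then f lam B else 0)"
      using D lamD by (subst sum.remove[of D lam]) auto
    also have "\<dots> = f lam col" unfolding col_def by (rule sum_tuples_leading[OF lam n])
    finally show ?thesis .
  qed
  have "d lam = lk p lam"
    unfolding d lookup_sum lookup_Const_mult lookup_elementary_product sum_distrib_left
    using lead[of "\<lambda>mu B. d mu"] by (simp add: if_distrib cong: if_cong)
  then have "d lam = 1" using p(2) by simp
  have "lk (Q_op n g z p) lam = (\<Sum>mu\<in>D. \<Sum>B\<in>tuples n mu. if exponents mu B = lam
      then d mu * poly (expect_poly n g {1..lk mu 1} B) z else 0)"
    unfolding Q_op_def Q_poly_elementary[OF n g D d] poly_Q_expansion lookup_sum
    by (intro sum.cong refl) (simp add: lookup_single when_def)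
  also have "\<dots> = poly (expect_poly n g {1..lk lam 1} col) z"
    unfolding lead using \<open>d lam = 1\<close> by simp
  finally show ?thesis using p(2) unfolding eig col_def by (simp add: lookup_Const_mult)
qed

theorem theorem5p1:
  fixes n :: nat and g :: real and lam :: "nat \<Rightarrow>\<^sub>0 nat"
    and P :: "ratfun mpoly" and z q :: complex
  assumes "n \<ge> 1" and "g > 0"
    and "is_partition n lam"
    and "is_jack n ratfun_gen lam P"
    and "Q_op n g z (specialize (of_real g) P) = Const q * specialize (of_real g) P"
  shows "q = z ^ Poly_Mapping.lookup lam n *
    (\<Sum>k\<in>(\<Pi>\<^sub>E i\<in>{1..n - 1}. {0..Poly_Mapping.lookup lam i - Poly_Mapping.lookup lam (i + 1)}).
      \<Prod>i=1..n - 1. (1 - z) ^ k i *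
        (pochhammer (- of_nat (Poly_Mapping.lookup lam i - Poly_Mapping.lookup lam (i + 1))) (k i)
          / fact (k i)) *
        (pochhammer (of_nat i * of_real g) (\<Sum>j=1..i. k j)
          / pochhammer (of_nat (i + 1) * of_real g) (\<Sum>j=1..i. k j)))"
proof -
  have sym: "symmetric_mpoly n P" using assms(4) by (simp add: is_jack_def)
  have "q = poly (expect_poly n g {1..lk lam 1} (columns n lam)) z"
  proof (rule eigenvalue_leading_coefficient[OF assms(1-3) symmetric_specialize[OF sym] _ _ assms(5)])
    show "lk (specialize (of_real g) P) lam = 1"
      using jack_triangular(1)[OF assms(4,3)] by (simp add: lookup_specialize)
    fix m assume m: "m \<in> ks (specialize (of_real g) P)" "is_partition n m"
    then have "m \<in> ks P" by (auto simp: in_keys_iff lookup_specialize)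
    then show "dominated n m lam" using m(2) by (rule jack_triangular(2)[OF assms(4,3)])
  qed
  moreover have "{1..n - 1} = {1..<n}" using assms(1) by auto
  ultimately show ?thesis using poly_expect_columns[OF assms(3,1,2), of z] by simp
qed

end
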